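(* Let $\Omega$ be a finite connected graph and let $m\in\{1,\dots,\mathrm{rk}(\Omega)\}$. Then \[ \limsup_{t\to\infty}\left[\sum_{w\in\mathcal{CP}_t^m(\Omega)}|\mathrm{Crit}(w)|\right]^{1/t}\leq(2m-1)\cdot\rho, \] where $\rho=\rho_A(\Omega)$.
   Context: Graphs may have loops and multiple edges. $\Omega$ has $k$ edges, oriented arbitrarily and labeled $X=\{x_1,\dots,x_k\}$; $\mathbf{F}_k$ is the free group on $X$; $\mathrm{rk}(\Omega)=|E(\Omega)|-|V(\Omega)|+1$. $\mathcal{CP}_t(\Omega)$ is the set of closed paths of length $t$ in $\Omega$, each regarded as a word in $(X\cup X^{-1})^t$ and hence as an element of $\mathbf{F}_k$; $\mathcal{CP}_t^m(\Omega)=\{w\in\mathcal{CP}_t(\Omega):\pi(w)=m\}$. An element $w$ of a free group $J$ is primitive in $J$ if it belongs to a basis of $J$. The primitivity rank is $\pi(w)=\min\{\mathrm{rk}(J): w\in J\leq\mathbf{F}_k,\ w\text{ not primitive in }J\}$ ($\infty$ if no such $J$); the subgroups attaining the minimum are $w$-critical and form $\mathrm{Crit}(w)$. $\rho_A(\Omega)$ is the spectral radius of the adjacency operator $(Af)(u)=\sum_{v\sim u}f(v)$ on $\ell^2$ of the vertex set of the universal covering tree of $\Omega$. *)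

theory Defs
  imports
    "HOL-Analysis.Analysis"
    "HOL-Algebra.Group"
    "Graph_Theory.Digraph_Component"
    "Graph_Theory.Arc_Walk"
    "HOL-Library.Extended_Nat"
begin

section \<open>Free groups\<close>

text \<open>
  A letter (x, True) stands for the generator x and (x, False) for its inverse.  The free group
  on a set is the set of reduced words under concatenation followed by free reduction.
\<close>

definition inv_letter :: "'x \<times> bool \<Rightarrow> 'x \<times> bool" where
  "inv_letter a = (fst a, \<not> snd a)"

definition reduced :: "('x \<times> bool) list \<Rightarrow> bool" where
  "reduced w \<longleftrightarrow> successively (\<lambda>a b. b \<noteq> inv_letter a) w"

fun cons_reduce :: "'x \<times> bool \<Rightarrow> ('x \<times> bool) list \<Rightarrow> ('x \<times> bool) list" where
  "cons_reduce a [] = [a]"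
| "cons_reduce a (b # w) = (if b = inv_letter a then w else a # b # w)"

definition reduce :: "('x \<times> bool) list \<Rightarrow> ('x \<times> bool) list" where
  "reduce w = foldr cons_reduce w []"

definition free_group :: "'x set \<Rightarrow> ('x \<times> bool) list monoid" where
  "free_group X =
     \<lparr>carrier = {w. set w \<subseteq> X \<times> UNIV \<and> reduced w},
      mult = (\<lambda>u v. reduce (u @ v)),
      one = []\<rparr>"

definition word_value :: "('g, 'm) monoid_scheme \<Rightarrow> ('g \<times> bool) list \<Rightarrow> 'g" where
  "word_value G w =
     foldr (\<lambda>(x, b) y. (if b then x else inv\<^bsub>G\<^esub> x) \<otimes>\<^bsub>G\<^esub> y) w \<one>\<^bsub>G\<^esub>"

text \<open>B is a basis of G if the canonical map from the free group on B to G is an isomorphism.\<close>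

definition is_basis :: "('g, 'm) monoid_scheme \<Rightarrow> 'g set \<Rightarrow> bool" where
  "is_basis G B \<longleftrightarrow> B \<subseteq> carrier G \<and> word_value G \<in> iso (free_group B) G"

definition primitive_in :: "('g, 'm) monoid_scheme \<Rightarrow> 'g \<Rightarrow> bool" where
  "primitive_in G w \<longleftrightarrow> (\<exists>B. is_basis G B \<and> w \<in> B)"

definition ecard :: "'a set \<Rightarrow> enat" where
  "ecard A = (if finite A then enat (card A) else \<infinity>)"

text \<open>Meaningful only if G is free; all bases then have the same cardinality.\<close>

definition free_rank :: "('g, 'm) monoid_scheme \<Rightarrow> enat" where
  "free_rank G = ecard (SOME B. is_basis G B)"

text \<open>
  In the following, F is the ambient free group.  The infimum over the empty set is \<open>\<infinity>\<close>;
  otherwise it is attained, as \<open>enat\<close> is well-ordered.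
\<close>

definition imprimitivity_subgroups :: "('g, 'm) monoid_scheme \<Rightarrow> 'g \<Rightarrow> 'g set set" where
  "imprimitivity_subgroups F w =
     {J. subgroup J F \<and> w \<in> J \<and> \<not> primitive_in (F\<lparr>carrier := J\<rparr>) w}"

definition primitivity_rank :: "('g, 'm) monoid_scheme \<Rightarrow> 'g \<Rightarrow> enat" where
  "primitivity_rank F w = (INF J \<in> imprimitivity_subgroups F w. free_rank (F\<lparr>carrier := J\<rparr>))"

definition Crit :: "('g, 'm) monoid_scheme \<Rightarrow> 'g \<Rightarrow> 'g set set" where
  "Crit F w =
     {J \<in> imprimitivity_subgroups F w. free_rank (F\<lparr>carrier := J\<rparr>) = primitivity_rank F w}"

section \<open>Graphs, closed paths and the universal covering tree\<close>

text \<open>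
  A graph with loops and multiple edges is given by a digraph: each arc is an undirected edge
  together with its (arbitrary) orientation.  Paths may traverse arcs in both directions: they are
  walks in the digraph below, where (e, True) is e and (e, False) is e traversed backwards.
\<close>

definition both_directions :: "('v, 'e) pre_digraph \<Rightarrow> ('v, 'e \<times> bool) pre_digraph" where
  "both_directions G =
     \<lparr>verts = verts G,
      arcs = arcs G \<times> UNIV,
      tail = (\<lambda>(e, b). if b then tail G e else head G e),
      head = (\<lambda>(e, b). if b then head G e else tail G e)\<rparr>"

abbreviation path :: "('v, 'e) pre_digraph \<Rightarrow> 'v \<Rightarrow> ('e \<times> bool) list \<Rightarrow> 'v \<Rightarrow> bool" where
  "path G \<equiv> pre_digraph.awalk (both_directions G)"

definition graph_rank :: "('v, 'e) pre_digraph \<Rightarrow> int" where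
  "graph_rank G = int (card (arcs G)) - int (card (verts G)) + 1"

text \<open>Closed paths need not be reduced; two of them may represent the same group element.\<close>

definition CP :: "('v, 'e) pre_digraph \<Rightarrow> nat \<Rightarrow> ('e \<times> bool) list set" where
  "CP G t = {w. length w = t \<and> (\<exists>v. path G v w v)}"

definition CPm :: "('v, 'e) pre_digraph \<Rightarrow> nat \<Rightarrow> nat \<Rightarrow> ('e \<times> bool) list set" where
  "CPm G m t = {w \<in> CP G t. primitivity_rank (free_group (arcs G)) (reduce w) = enat m}"

text \<open>
  The vertices of the universal covering tree are the non-backtracking paths starting at a base
  vertex r; adjacent vertices are those where one path extends the other by one step.
\<close>

definition universal_cover ::
  "('v, 'e) pre_digraph \<Rightarrow> 'v \<Rightarrow> ('e \<times> bool) list pair_pre_digraph" where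
  "universal_cover G r =
     (let V = {p. reduced p \<and> (\<exists>v. path G r p v)} in
       \<lparr>pverts = V,
        parcs = {(p, q). p \<in> V \<and> q \<in> V \<and> (\<exists>d. q = p @ [d] \<or> p = q @ [d])}\<rparr>)"

section \<open>The adjacency operator and its spectral radius\<close>

text \<open>Square-summable functions on V are represented as functions vanishing outside V.\<close>

definition ell2 :: "'a set \<Rightarrow> ('a \<Rightarrow> complex) set" where
  "ell2 V = {f. (\<forall>v. v \<notin> V \<longrightarrow> f v = 0) \<and> (\<lambda>v. (cmod (f v))\<^sup>2) summable_on V}"

definition ell2_norm :: "'a set \<Rightarrow> ('a \<Rightarrow> complex) \<Rightarrow> real" where
  "ell2_norm V f = sqrt (\<Sum>\<^sub>\<infinity>v\<in>V. (cmod (f v))\<^sup>2)"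

definition bounded_op :: "'a set \<Rightarrow> (('a \<Rightarrow> complex) \<Rightarrow> ('a \<Rightarrow> complex)) \<Rightarrow> bool" where
  "bounded_op V A \<longleftrightarrow>
     (\<forall>f\<in>ell2 V. A f \<in> ell2 V) \<and>
     (\<forall>f\<in>ell2 V. \<forall>g\<in>ell2 V. A (\<lambda>v. f v + g v) = (\<lambda>v. A f v + A g v)) \<and>
     (\<forall>f\<in>ell2 V. \<forall>c. A (\<lambda>v. c * f v) = (\<lambda>v. c * A f v)) \<and>
     (\<exists>C. \<forall>f\<in>ell2 V. ell2_norm V (A f) \<le> C * ell2_norm V f)"

definition ell2_spectrum ::
  "'a set \<Rightarrow> (('a \<Rightarrow> complex) \<Rightarrow> ('a \<Rightarrow> complex)) \<Rightarrow> complex set" where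
  "ell2_spectrum V A =
     {z. \<not> (\<exists>B. bounded_op V B \<and>
             (\<forall>f\<in>ell2 V. B (\<lambda>v. A f v - z * f v) = f \<and> (\<lambda>v. A (B f) v - z * B f v) = f))}"

definition ell2_spectral_radius ::
  "'a set \<Rightarrow> (('a \<Rightarrow> complex) \<Rightarrow> ('a \<Rightarrow> complex)) \<Rightarrow> real" where
  "ell2_spectral_radius V A = (SUP z\<in>ell2_spectrum V A. cmod z)"

definition adjacency_op ::
  "'a pair_pre_digraph \<Rightarrow> ('a \<Rightarrow> complex) \<Rightarrow> ('a \<Rightarrow> complex)" where
  "adjacency_op T f = (\<lambda>u. \<Sum>v | (u, v) \<in> parcs T. f v)"

text \<open>For connected G, all choices of base vertex give isomorphic covering trees.\<close>

definition rho_A :: "('v, 'e) pre_digraph \<Rightarrow> real" where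
  "rho_A G =
     (let T = universal_cover G (SOME r. r \<in> verts G)
      in ell2_spectral_radius (pverts T) (adjacency_op T))"

section \<open>Roots of extended natural numbers\<close>

definition eroot :: "nat \<Rightarrow> enat \<Rightarrow> ereal" where
  "eroot t x = (case x of enat n \<Rightarrow> ereal (root t (real n)) | \<infinity> \<Rightarrow> \<infinity>)"

end

theory Submission
  imports Defs "HOL-Algebra.Generated_Groups"
begin

text \<open>
  Let \<open>J\<close> be critical for the reduced word \<open>v\<close> with \<open>\<pi>(v) = m\<close>.  In the Schreier graph of \<open>J\<close> the
  closed path of \<open>v\<close> traverses a finite subgraph \<open>\<Gamma>\<close>.  Its fundamental group is a free factor of \<open>J\<close>
  in which \<open>v\<close> is not primitive, so by minimality it is \<open>J\<close> and \<open>\<Gamma>\<close> has rank \<open>m\<close>; and \<open>v\<close>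
  traverses every edge of \<open>\<Gamma>\<close> at least twice, as an edge traversed once would make \<open>v\<close> primitive.
  Reading \<open>v\<close> and building \<open>\<Gamma>\<close> step by step, one closes exactly \<open>m\<close> cycles, which costs only a
  polynomial factor, and at each step along a known edge there are at most \<open>2m - 1\<close> choices if \<open>v\<close> is
  cyclically reduced, to which one passes by conjugation.

  For \<open>0 < z < 1/\<rho>\<close> the Green function \<open>G\<close> of the covering tree is multiplicative along
  geodesics, and \<open>G(x,y) = sqrt (G(x,x) G(y,y)) \<cdot> (product of \<phi> over the edges from x to y)\<close> with symmetric
  edge weights \<open>\<phi> \<le> 1\<close>.  As every edge of \<open>\<Gamma>\<close> is used twice, the walks reducing to \<open>v\<close> have
  generating function at most a constant times the product of \<open>\<phi>\<^sup>2\<close> over the edges of \<open>\<Gamma>\<close>, and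
  the sum of these products over all paths of a given length is bounded, because \<open>G(x,\<cdot>)\<close> is
  square-summable.  Hence the sum in question is at most \<open>((2m - 1)/z)\<^sup>t\<close> up to a polynomial factor.
\<close>

section \<open>Reduction of words\<close>

text \<open>The sum counts pairs of a word and a critical subgroup, so a bound on words alone would
  not do. A pair can be recovered from its exploration because the subgroup is generated by the
  loops that arise whenever two prefixes of the word reach the same vertex. The base 2m - 1 comes
  from degrees: an exploration of rank r with n + 1 vertices has degree sum 2(n + r), and a vertex
  that has been passed through has degree at least 2. This leaves at most 2r at the current vertex,
  one of which is the forbidden way back. Only the starting vertex can spoil this count, hence the
  restriction to cyclically reduced words; a conjugator has its letters used twice, so its weights
  are squared and summable as well. The number of choices on a run of new edges is not limited by m
  at all; such a run is paid for by its weights. The spectral radius enters through a bound on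
  closed walks in the tree, which is taken from the log-convexity of the return counts and
  approximate eigenvectors instead of the spectral theorem.\<close>

definition winv :: "('x \<times> bool) list \<Rightarrow> ('x \<times> bool) list" where
  "winv w = rev (map inv_letter w)"

lemma inv_letter_inv_letter [simp]: "inv_letter (inv_letter a) = a"
  by (cases a) (simp add: inv_letter_def)

lemma inv_letter_neq [simp]: "inv_letter a \<noteq> a" "a \<noteq> inv_letter a"
  by (cases a; simp add: inv_letter_def)+

lemma inv_letter_eq_iff [simp]: "inv_letter a = inv_letter b \<longleftrightarrow> a = b"
  by (metis inv_letter_inv_letter)

lemma fst_inv_letter [simp]: "fst (inv_letter a) = fst a"
  and snd_inv_letter [simp]: "snd (inv_letter a) = (\<not> snd a)"
  by (simp_all add: inv_letter_def)

lemma winv_Nil [simp]: "winv [] = []"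
  and winv_Cons [simp]: "winv (a # w) = winv w @ [inv_letter a]"
  and winv_append [simp]: "winv (u @ v) = winv v @ winv u"
  and length_winv [simp]: "length (winv w) = length w"
  and set_winv: "set (winv w) = inv_letter ` set w"
  and winv_eq_Nil_iff [simp]: "winv w = [] \<longleftrightarrow> w = []"
  by (simp_all add: winv_def)

lemma winv_winv [simp]: "winv (winv w) = w"
  by (induction w) auto

lemma reduced_Nil [simp]: "reduced []"
  and reduced_single [simp]: "reduced [a]"
  and reduced_Cons: "reduced (a # w) \<longleftrightarrow> (w = [] \<or> hd w \<noteq> inv_letter a) \<and> reduced w"
  and reduced_append: "reduced (u @ v) \<longleftrightarrow>
        reduced u \<and> reduced v \<and> (u = [] \<or> v = [] \<or> hd v \<noteq> inv_letter (last u))"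
  by (auto simp: reduced_def successively_Cons successively_append_iff)

lemma reduced_winv [simp]: "reduced (winv w) \<longleftrightarrow> reduced w"
proof -
  have "reduced w \<Longrightarrow> reduced (winv w)" for w :: "('x \<times> bool) list"
    by (induction w) (auto simp: reduced_Cons reduced_append winv_def last_rev hd_map)
  from this[of w] this[of "winv w"] show ?thesis by auto
qed

lemma cons_reduce_alt:
  "cons_reduce a w = (if w \<noteq> [] \<and> hd w = inv_letter a then tl w else a # w)"
  by (cases w) auto

lemma reduced_cons_reduce: "reduced w \<Longrightarrow> reduced (cons_reduce a w)"
  by (cases w) (auto simp: reduced_Cons)

lemma reduce_Nil [simp]: "reduce [] = []"
  and reduce_Cons: "reduce (a # w) = cons_reduce a (reduce w)"
  by (simp_all add: reduce_def)

lemma reduced_reduce [simp]: "reduced (reduce w)"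
  by (induction w) (auto simp: reduce_Cons reduced_cons_reduce)

lemma reduce_reduced [simp]: "reduced w \<Longrightarrow> reduce w = w"
  by (induction w) (auto simp: reduce_Cons cons_reduce_alt reduced_Cons)

lemma cons_reduce_cancel:
  "reduced w \<Longrightarrow> cons_reduce a (cons_reduce (inv_letter a) w) = w"
  by (cases w) (auto simp: reduced_Cons cons_reduce_alt)

lemma reduce_append_foldr: "reduce (u @ v) = foldr cons_reduce u (reduce v)"
  by (simp add: reduce_def)

lemma reduce_append_reduce [simp]: "reduce (u @ reduce v) = reduce (u @ v)"
  by (simp add: reduce_append_foldr)

lemma reduce_Cons_cancel [simp]: "reduce (a # inv_letter a # v) = reduce v"
  by (simp add: reduce_Cons cons_reduce_cancel)

lemma reduce_Cons_cancel' [simp]: "reduce (inv_letter a # a # v) = reduce v"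
  using reduce_Cons_cancel[of "inv_letter a"] by simp

lemma reduce_append_cong: "reduce v = reduce v' \<Longrightarrow> reduce (u @ v) = reduce (u @ v')"
  by (simp add: reduce_append_foldr)

text \<open>With \<open>reduce_append_reduce\<close> this makes equality of reductions a congruence
  for concatenation; associativity in the free group rests on it.\<close>

lemma reduce_reduce_append [simp]: "reduce (reduce u @ v) = reduce (u @ v)"
proof (induction u)
  case (Cons a u)
  show ?case
  proof (cases "reduce u \<noteq> [] \<and> hd (reduce u) = inv_letter a")
    case True
    then obtain t where t: "reduce u = inv_letter a # t" by (cases "reduce u") auto
    have "reduce (a # u @ v) = reduce (a # (reduce u @ v))"
      using Cons by (simp add: reduce_Cons)
    then show ?thesis by (simp add: reduce_Cons t cons_reduce_cancel)
  next
    case False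
    then have "reduce (a # u) = a # reduce u" by (auto simp: reduce_Cons cons_reduce_alt)
    with Cons show ?thesis by (simp add: reduce_Cons)
  qed
qed auto

lemma reduce_append_mid [simp]: "reduce (u @ reduce v @ w) = reduce (u @ v @ w)"
  by (metis append_assoc reduce_append_reduce reduce_reduce_append)

lemma reduce_append_cong_left: "reduce u = reduce u' \<Longrightarrow> reduce (u @ v) = reduce (u' @ v)"
  by (metis reduce_reduce_append)

lemma reduce_winv_cancel [simp]: "reduce (u @ winv u @ v) = reduce v"
proof (induction u arbitrary: v)
  case (Cons a u)
  have "reduce (a # u @ winv u @ inv_letter a # v) = reduce (a # inv_letter a # v)"
    using Cons[of "inv_letter a # v"] by (simp add: reduce_Cons)
  then show ?case by simp
qed auto

lemma reduce_winv_cancel' [simp]: "reduce (winv u @ u @ v) = reduce v"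
  using reduce_winv_cancel[of "winv u"] by simp

lemma reduce_append_winv [simp]: "reduce (u @ winv u) = []" "reduce (winv u @ u) = []"
  using reduce_winv_cancel[of u "[]"] reduce_winv_cancel'[of u "[]"] by simp_all

lemma reduce_mid_cancel [simp]:
  "reduce (t @ u @ winv u @ v) = reduce (t @ v)" "reduce (t @ winv u @ u @ v) = reduce (t @ v)"
  by (rule reduce_append_cong, simp)+

lemma reduce_end_cancel [simp]:
  "reduce (t @ u @ winv u) = reduce t" "reduce (t @ winv u @ u) = reduce t"
  using reduce_mid_cancel[of t u "[]"] by simp_all

lemma reduce_winv: "reduce (winv u) = winv (reduce u)"
proof -
  have "reduce (winv u) = reduce (winv u @ reduce u @ winv (reduce u))"
    by (simp del: reduce_append_mid)
  also have "\<dots> = reduce (winv u @ u @ winv (reduce u))" by (rule reduce_append_mid)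
  also have "\<dots> = winv (reduce u)" by (simp del: reduce_end_cancel)
  finally show ?thesis .
qed

lemma reduce_cancel_left: "reduce (u @ v) = reduce (u @ v') \<longleftrightarrow> reduce v = reduce v'"
  by (metis reduce_append_cong reduce_winv_cancel')

lemma reduce_append_winv_eq_Nil_iff: "reduce (u @ winv v) = [] \<longleftrightarrow> reduce u = reduce v"
  by (metis append_Nil append_Nil2 append_assoc reduce_append_cong_left reduce_append_winv(1)
      reduce_end_cancel(2))

lemma set_reduce: "set (reduce w) \<subseteq> set w"
proof (induction w)
  case (Cons a w)
  then show ?case by (cases "reduce w") (auto simp: reduce_Cons)
qed auto

lemma length_reduce: "length (reduce w) \<le> length w"
proof (induction w)
  case (Cons a w)
  then show ?case by (cases "reduce w") (auto simp: reduce_Cons)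
qed auto

lemma reduce_snoc:
  assumes "reduced w"
  shows "reduce (w @ [d]) = (if w \<noteq> [] \<and> last w = inv_letter d then butlast w else w @ [d])"
proof (cases "w \<noteq> [] \<and> last w = inv_letter d")
  case True
  then obtain u where u: "w = u @ [inv_letter d]" by (metis append_butlast_last_id)
  with assms have "reduced u" by (simp add: reduced_append)
  have "reduce (w @ [d]) = reduce (u @ [])"
    unfolding u by (simp del: append_Nil2 add: reduce_append_foldr)
  with \<open>reduced u\<close> u show ?thesis by simp
next
  case False
  with assms have "reduced (w @ [d])" by (auto simp: reduced_append)
  with False show ?thesis by auto
qed

section \<open>Free groups and bases\<close>

lemma carrier_free_group [simp]:
    "carrier (free_group X) = {w. set w \<subseteq> X \<times> UNIV \<and> reduced w}"
  and mult_free_group [simp]: "u \<otimes>\<^bsub>free_group X\<^esub> v = reduce (u @ v)"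
  and one_free_group [simp]: "\<one>\<^bsub>free_group X\<^esub> = []"
  by (simp_all add: free_group_def)

lemma set_winv_subset: "set (winv w) \<subseteq> X \<times> UNIV \<longleftrightarrow> set w \<subseteq> X \<times> UNIV"
proof -
  have "set w \<subseteq> X \<times> UNIV \<Longrightarrow> set (winv w) \<subseteq> X \<times> UNIV" for w :: "('a \<times> bool) list"
    unfolding set_winv by (intro image_subsetI) (metis fst_inv_letter mem_Times_iff subsetD UNIV_I)
  from this[of w] this[of "winv w"] show ?thesis by auto
qed

lemma group_free_group: "group (free_group X)"
proof (rule groupI)
  fix x y assume "x \<in> carrier (free_group X)" "y \<in> carrier (free_group X)"
  then show "x \<otimes>\<^bsub>free_group X\<^esub> y \<in> carrier (free_group X)"
    using set_reduce[of "x @ y"] by auto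
next
  fix x assume x: "x \<in> carrier (free_group X)"
  have "winv x \<in> carrier (free_group X)" "winv x \<otimes>\<^bsub>free_group X\<^esub> x = []"
    using x by (simp_all add: set_winv_subset)
  then show "\<exists>y\<in>carrier (free_group X). y \<otimes>\<^bsub>free_group X\<^esub> x = \<one>\<^bsub>free_group X\<^esub>" by auto
qed auto

lemma inv_free_group:
  assumes "w \<in> carrier (free_group X)"
  shows "inv\<^bsub>free_group X\<^esub> w = winv w"
  using assms
  by (intro group.inv_equality[OF group_free_group]) (simp_all add: set_winv_subset)

lemma (in group) word_value_Nil [simp]: "word_value G [] = \<one>"
  and word_value_Cons:
    "word_value G (a # w) = (if snd a then fst a else inv (fst a)) \<otimes> word_value G w"
  by (simp_all add: word_value_def split: prod.splits)

lemma (in group) word_value_closed [simp]: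
  "set w \<subseteq> carrier G \<times> UNIV \<Longrightarrow> word_value G w \<in> carrier G"
  by (induction w) (auto simp: word_value_Cons)

lemma (in group) word_value_append:
  "set u \<subseteq> carrier G \<times> UNIV \<Longrightarrow> set v \<subseteq> carrier G \<times> UNIV \<Longrightarrow>
    word_value G (u @ v) = word_value G u \<otimes> word_value G v"
  by (induction u) (auto simp: word_value_Cons m_assoc)

lemma (in group) word_value_cons_reduce:
  "fst a \<in> carrier G \<Longrightarrow> set w \<subseteq> carrier G \<times> UNIV \<Longrightarrow>
    word_value G (cons_reduce a w) = word_value G (a # w)"
  by (cases w) (auto simp: word_value_Cons inv_letter_def m_assoc[symmetric])

lemma (in group) word_value_reduce:
  "set w \<subseteq> carrier G \<times> UNIV \<Longrightarrow> word_value G (reduce w) = word_value G w"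
proof (induction w)
  case (Cons a w)
  then have "set (reduce w) \<subseteq> carrier G \<times> UNIV" using set_reduce[of w] by auto
  with Cons show ?case by (auto simp: reduce_Cons word_value_cons_reduce word_value_Cons)
qed auto

lemma (in group) word_value_hom:
  "B \<subseteq> carrier G \<Longrightarrow> word_value G \<in> hom (free_group B) G"
proof (rule homI)
  fix u v assume B: "B \<subseteq> carrier G" and "u \<in> carrier (free_group B)" "v \<in> carrier (free_group B)"
  then have "set u \<subseteq> carrier G \<times> UNIV" "set v \<subseteq> carrier G \<times> UNIV" by auto
  then show "word_value G (u \<otimes>\<^bsub>free_group B\<^esub> v) = word_value G u \<otimes> word_value G v"
    by (simp add: word_value_reduce word_value_append)
next
  fix u assume B: "B \<subseteq> carrier G" and "u \<in> carrier (free_group B)"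
  then have "set u \<subseteq> carrier G \<times> UNIV" by auto
  then show "word_value G u \<in> carrier G" by simp
qed

lemma map_apfst_inv_letter [simp]: "apfst f (inv_letter a) = inv_letter (apfst f a)"
  by (cases a) (simp add: inv_letter_def)

lemma reduce_map_cons_reduce:
  "reduce (map (apfst f) (cons_reduce a w)) = reduce (map (apfst f) (a # w))"
  by (cases w) (auto simp: reduce_Cons cons_reduce_cancel)

text \<open>The renaming \<open>f\<close> may identify generators, so the image of a reduced word
  need not be reduced; only the reductions agree.\<close>

lemma reduce_map_reduce: "reduce (map (apfst f) (reduce w)) = reduce (map (apfst f) w)"
proof (induction w)
  case (Cons a w)
  have "reduce (map (apfst f) (reduce (a # w))) = reduce (map (apfst f) (a # reduce w))"
    unfolding reduce_Cons by (rule reduce_map_cons_reduce)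
  with Cons show ?case by (simp add: reduce_Cons)
qed auto

lemma (in group) generate_eq_word_value:
  assumes "C \<subseteq> carrier G"
  shows "generate G C = word_value G ` {w. set w \<subseteq> C \<times> UNIV}"
proof
  have C: "set w \<subseteq> C \<times> UNIV \<Longrightarrow> set w \<subseteq> carrier G \<times> UNIV" for w :: "('a \<times> bool) list"
    using assms by auto
  show "generate G C \<subseteq> word_value G ` {w. set w \<subseteq> C \<times> UNIV}"
  proof
    fix x assume "x \<in> generate G C"
    then show "x \<in> word_value G ` {w. set w \<subseteq> C \<times> UNIV}"
    proof induction
      case one
      then show ?case by (intro image_eqI[of _ _ "[]"]) auto
    next
      case (incl h)
      then show ?case using assms
        by (intro image_eqI[of _ _ "[(h, True)]"]) (auto simp: word_value_Cons)
    next
      case (inv h)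
      then show ?case using assms
        by (intro image_eqI[of _ _ "[(h, False)]"]) (auto simp: word_value_Cons)
    next
      case (eng h1 h2)
      then obtain u v where "h1 = word_value G u" "h2 = word_value G v"
        "set u \<subseteq> C \<times> UNIV" "set v \<subseteq> C \<times> UNIV" by auto
      then show ?case using C[of u] C[of v]
        by (intro image_eqI[of _ _ "u @ v"]) (auto simp: word_value_append)
    qed
  qed
  show "word_value G ` {w. set w \<subseteq> C \<times> UNIV} \<subseteq> generate G C"
  proof safe
    fix w :: "('a \<times> bool) list" assume "set w \<subseteq> C \<times> UNIV"
    then show "word_value G w \<in> generate G C"
      by (induction w) (auto simp: word_value_Cons intro!: generate.one generate.eng
          intro: generate.incl generate.inv)
  qed
qed

lemma is_basis_subset: "is_basis G B \<Longrightarrow> B \<subseteq> carrier G"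
  by (simp add: is_basis_def)

text \<open>One homomorphism replaces a normal form argument: since \<open>\<psi>\<close> sends each
  \<open>c\<close> to its letter, it is a left inverse of \<open>word_value\<close> on reduced
  words, which makes evaluation injective.\<close>

lemma basisI:
  assumes "group G" "C \<subseteq> carrier G" and gen: "carrier G \<subseteq> generate G C"
    and \<psi>: "\<psi> \<in> hom G (free_group C)" "\<And>c. c \<in> C \<Longrightarrow> \<psi> c = [(c, True)]"
  shows "is_basis G C"
proof -
  interpret G: group G by fact
  interpret H: group "free_group C" by (rule group_free_group)
  interpret \<psi>: group_hom G "free_group C" \<psi>
    using \<psi>(1) by (unfold_locales) 
  have C: "set w \<subseteq> carrier G \<times> UNIV" if "set w \<subseteq> C \<times> UNIV" for w :: "('a \<times> bool) list"
    using that assms(2) by auto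
  have inv: "\<psi> (word_value G w) = reduce w" if "set w \<subseteq> C \<times> UNIV" for w
    using that
  proof (induction w)
    case (Cons a w)
    then have a: "fst a \<in> C" and w: "set w \<subseteq> C \<times> UNIV" by auto
    have "\<psi> (if snd a then fst a else inv\<^bsub>G\<^esub> fst a) = [a]"
      using a assms(2) \<psi>(2)[OF a]
      by (cases a) (auto simp: inv_free_group inv_letter_def subset_iff)
    then show ?case
      using Cons.IH[OF w] a assms(2) C[OF w] reduce_append_reduce[of "[a]" w]
      by (subst G.word_value_Cons, subst \<psi>.hom_mult) (auto simp del: reduce_append_reduce)
  qed auto
  have "bij_betw (word_value G) (carrier (free_group C)) (carrier G)"
  proof (rule bij_betwI')
    fix x y assume "x \<in> carrier (free_group C)" "y \<in> carrier (free_group C)"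
    then show "(word_value G x = word_value G y) \<longleftrightarrow> x = y"
      using inv[of x] inv[of y] by (metis (mono_tags, lifting) carrier_free_group mem_Collect_eq reduce_reduced)
  next
    fix x assume "x \<in> carrier (free_group C)"
    then show "word_value G x \<in> carrier G" using C[of x] by auto
  next
    fix g assume "g \<in> carrier G"
    with gen G.generate_eq_word_value[OF assms(2)] obtain w where
      w: "g = word_value G w" "set w \<subseteq> C \<times> UNIV" by auto
    then have "g = word_value G (reduce w)" using C by (simp add: G.word_value_reduce)
    moreover have "reduce w \<in> carrier (free_group C)" using w set_reduce[of w] by auto
    ultimately show "\<exists>x\<in>carrier (free_group C). g = word_value G x" by blast
  qed
  then show ?thesis
    using assms(2) G.word_value_hom[OF assms(2)] by (simp add: is_basis_def iso_def)
qed

lemma basis_generate: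
  assumes "group G" "is_basis G B"
  shows "generate G B = carrier G"
proof -
  interpret G: group G by fact
  have B: "B \<subseteq> carrier G" and bij: "bij_betw (word_value G) (carrier (free_group B)) (carrier G)"
    using assms(2) by (simp_all add: is_basis_def iso_def)
  have "carrier G = word_value G ` carrier (free_group B)"
    using bij by (simp add: bij_betw_def)
  also have "\<dots> \<subseteq> generate G B"
    using G.generate_eq_word_value[OF B] by auto
  finally show ?thesis using G.generate_incl[OF B] by auto
qed

text \<open>The universal property, which reduces every later construction of a homomorphism to a
  choice of images for the basis elements.\<close>

lemma basis_extend:
  assumes "group G" "group H" "is_basis G B" "\<And>b. b \<in> B \<Longrightarrow> f b \<in> carrier H"
  obtains h where "h \<in> hom G H" "\<And>b. b \<in> B \<Longrightarrow> h b = f b"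
proof -
  interpret G: group G by fact
  interpret H: group H by fact
  have B: "B \<subseteq> carrier G" and iso: "word_value G \<in> iso (free_group B) G"
    using assms(3) by (simp_all add: is_basis_def)
  define j where "j = inv_into (carrier (free_group B)) (word_value G)"
  have j: "j \<in> iso G (free_group B)"
    unfolding j_def by (intro group.iso_set_sym[OF group_free_group] iso)
  have jhom: "j \<in> hom G (free_group B)" using j by (simp add: iso_def)
  define F where "F = (\<lambda>w. word_value H (map (apfst f) w))"
  have Fs: "set (map (apfst f) w) \<subseteq> carrier H \<times> UNIV" if "set w \<subseteq> B \<times> UNIV" for w :: "('a \<times> bool) list"
    using that assms(4) by fastforce
  have Fr: "F (reduce w) = F w" if w: "set w \<subseteq> B \<times> UNIV" for w
  proof -
    have "set (reduce w) \<subseteq> B \<times> UNIV" using w set_reduce[of w] by auto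
    then have "F (reduce w) = word_value H (reduce (map (apfst f) (reduce w)))"
      using Fs[of "reduce w"] by (simp add: F_def H.word_value_reduce)
    also have "\<dots> = F w" using Fs[OF w] by (simp add: F_def reduce_map_reduce H.word_value_reduce)
    finally show ?thesis .
  qed
  have Fhom: "F \<in> hom (free_group B) H"
  proof (rule homI)
    fix u v assume "u \<in> carrier (free_group B)" "v \<in> carrier (free_group B)"
    then show "F (u \<otimes>\<^bsub>free_group B\<^esub> v) = F u \<otimes>\<^bsub>H\<^esub> F v"
      using Fs[of u] Fs[of v] Fr[of "u @ v"] by (simp add: F_def H.word_value_append)
  next
    fix u assume "u \<in> carrier (free_group B)"
    then show "F u \<in> carrier H" using Fs[of u] by (simp add: F_def)
  qed
  show thesis
  proof
    show "F \<circ> j \<in> hom G H" using jhom Fhom by (rule hom_compose)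
    fix b assume b: "b \<in> B"
    then have "word_value G [(b, True)] = b" using B by (auto simp: G.word_value_Cons)
    moreover have "inj_on (word_value G) (carrier (free_group B))"
      using iso by (simp add: iso_def bij_betw_def)
    ultimately have "j b = [(b, True)]"
      unfolding j_def using b by (intro inv_into_f_eq) auto
    then show "(F \<circ> j) b = f b"
      using assms(4)[OF b] by (simp add: F_def H.word_value_Cons)
  qed
qed

lemma hom_agree_on_generate:
  assumes "group G" "group H" "h \<in> hom G H" "h' \<in> hom G H" "C \<subseteq> carrier G"
    "\<And>c. c \<in> C \<Longrightarrow> h c = h' c" "x \<in> generate G C"
  shows "h x = h' x"
proof -
  interpret G: group G by fact
  interpret H: group H by fact
  interpret h: group_hom G H h using assms by (unfold_locales)
  interpret h': group_hom G H h' using assms by (unfold_locales)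
  from assms(7) show ?thesis
  proof induction
    case one
    then show ?case by simp
  next
    case (incl c)
    then show ?case using assms(6) by simp
  next
    case (inv c)
    then show ?case using assms(5,6) by (simp add: subset_iff)
  next
    case (eng h1 h2)
    then show ?case using G.generate_in_carrier[OF assms(5)] by simp
  qed
qed

section \<open>Invariance of the rank\<close>

definition xor_group :: "bool monoid" where
  "xor_group = \<lparr>carrier = UNIV, mult = (\<lambda>x y. x \<noteq> y), one = False\<rparr>"

lemma group_xor_group: "group xor_group"
  by (rule groupI) (auto simp: xor_group_def)

text \<open>A homomorphism to the group of order two is a free choice of the basis elements sent to
  \<open>True\<close>, so the subsets of any basis are counted by a set that does not mention the
  basis. Among \<open>extensional\<close> functions, homomorphisms are equal once they agree on the
  carrier.\<close>

lemma bij_betw_homs_Pow_basis: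
  assumes "group G" "is_basis G B"
  shows "bij_betw (\<lambda>h. {b \<in> B. h b}) (hom G xor_group \<inter> extensional (carrier G)) (Pow B)"
proof (rule bij_betwI')
  interpret G: group G by fact
  have B: "B \<subseteq> carrier G" using assms(2) by (rule is_basis_subset)
  fix h h' assume h: "h \<in> hom G xor_group \<inter> extensional (carrier G)"
    and h': "h' \<in> hom G xor_group \<inter> extensional (carrier G)"
  show "({b \<in> B. h b} = {b \<in> B. h' b}) = (h = h')"
  proof
    assume "{b \<in> B. h b} = {b \<in> B. h' b}"
    then have "h b = h' b" if "b \<in> B" for b using that by blast
    moreover have "h \<in> hom G xor_group" "h' \<in> hom G xor_group" using h h' by simp_all
    ultimately have "h x = h' x" if "x \<in> carrier G" for x
      using that unfolding basis_generate[OF assms, symmetric]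
      by (intro hom_agree_on_generate[OF assms(1) group_xor_group _ _ B, of h h' x]) simp_all
    with h h' show "h = h'" by (intro extensionalityI[of h "carrier G"]) simp_all
  qed auto
next
  fix S assume S: "S \<in> Pow B"
  have B: "B \<subseteq> carrier G" using assms(2) by (rule is_basis_subset)
  obtain h where h: "h \<in> hom G xor_group" "\<And>b. b \<in> B \<Longrightarrow> h b = (b \<in> S)"
  proof -
    have "(b \<in> S) \<in> carrier xor_group" for b by (simp add: xor_group_def)
    note ext = basis_extend[OF assms(1) group_xor_group assms(2) this] 
    show thesis by (rule ext) (rule that)
  qed
  have "restrict h (carrier G) \<in> hom G xor_group \<inter> extensional (carrier G)"
    using h(1) group.is_monoid[OF assms(1)] by (auto simp: hom_def monoid.m_closed)
  moreover have "{b \<in> B. restrict h (carrier G) b} = S" using h(2) S B by auto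
  ultimately show "\<exists>x\<in>hom G xor_group \<inter> extensional (carrier G). S = {b \<in> B. x b}" by blast
qed blast

text \<open>The number of subsets determines a finite cardinality, and finiteness itself passes
  along the bijection of power sets; \<open>ecard\<close> distinguishes nothing further.\<close>

lemma basis_ecard_unique:
  assumes "group G" "is_basis G B" "is_basis G C"
  shows "ecard B = ecard C"
proof -
  have *: "bij_betw (inv_into (hom G xor_group \<inter> extensional (carrier G)) (\<lambda>h. {b \<in> B. h b}))
          (Pow B) (hom G xor_group \<inter> extensional (carrier G))"
    by (rule bij_betw_inv_into[OF bij_betw_homs_Pow_basis[OF assms(1,2)]])
  obtain f where f: "bij_betw f (Pow B) (Pow C)"
    by (rule that[OF bij_betw_trans[OF * bij_betw_homs_Pow_basis[OF assms(1,3)]]])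
  show ?thesis
  proof (cases "finite B")
    case True
    then have "finite C" using bij_betw_finite[OF f] by simp
    moreover have "card (Pow B) = card (Pow C)" using f by (rule bij_betw_same_card)
    ultimately show ?thesis using True by (simp add: card_Pow ecard_def)
  next
    case False
    then have "infinite C" using bij_betw_finite[OF f] by simp
    with False show ?thesis by (simp add: ecard_def)
  qed
qed

lemma free_rank_eq:
  assumes "group G" "is_basis G B"
  shows "free_rank G = ecard B"
  unfolding free_rank_def
  using basis_ecard_unique[OF assms(1) someI[of "is_basis G", OF assms(2)] assms(2)] .

section \<open>Free factors and Nielsen moves\<close>

lemma hom_restrict_carrier:
  "h \<in> hom G H \<Longrightarrow> K \<subseteq> carrier G \<Longrightarrow> h \<in> hom (G\<lparr>carrier := K\<rparr>) H"
  by (auto simp: hom_def)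

text \<open>Killing the basis elements outside \<open>C\<close> maps the group onto the words in
  \<open>C\<close>; restricted to the generated subgroup, this is the homomorphism that
  \<open>basisI\<close> asks for.\<close>

lemma subset_of_basis:
  assumes "group G" "is_basis G B" "C \<subseteq> B"
  shows "is_basis (G\<lparr>carrier := generate G C\<rparr>) C"
proof -
  interpret G: group G by fact
  have C: "C \<subseteq> carrier G" using is_basis_subset[OF assms(2)] assms(3) by simp
  have sub: "subgroup (generate G C) G" using C by (rule G.generate_is_subgroup)
  obtain h where h: "h \<in> hom G (free_group C)"
      "\<And>b. b \<in> B \<Longrightarrow> h b = (if b \<in> C then [(b, True)] else [])"
  proof -
    have "(if b \<in> C then [(b, True)] else []) \<in> carrier (free_group C)" for b by simp
    note ext = basis_extend[OF assms(1) group_free_group assms(2) this] 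
    show thesis by (rule ext) (rule that)
  qed
  show ?thesis
  proof (rule basisI)
    show "group (G\<lparr>carrier := generate G C\<rparr>)" using sub assms(1) by (rule subgroup.subgroup_is_group)
    show "h \<in> hom (G\<lparr>carrier := generate G C\<rparr>) (free_group C)"
      using h(1) sub by (intro hom_restrict_carrier) (auto dest: subgroup.subset)
    show "C \<subseteq> carrier (G\<lparr>carrier := generate G C\<rparr>)" by (auto intro: generate.incl)
    show "carrier (G\<lparr>carrier := generate G C\<rparr>) \<subseteq> generate (G\<lparr>carrier := generate G C\<rparr>) C"
      using G.generate_consistent[OF _ sub, of C] by (auto intro: generate.incl)
  qed (use h(2) assms(3) in auto)
qed

text \<open>A basis \<open>D\<close> of the free factor is completed by \<open>B - C\<close>. Read
  backwards, imprimitivity passes down to every free factor containing the element, which is what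
  lets minimality of the rank act on a critical subgroup.\<close>

lemma primitive_in_subset_of_basis:
  assumes "group G" "is_basis G B" "C \<subseteq> B" "primitive_in (G\<lparr>carrier := generate G C\<rparr>) v"
  shows "primitive_in G v"
proof -
  interpret G: group G by fact
  let ?H = "G\<lparr>carrier := generate G C\<rparr>"
  have B: "B \<subseteq> carrier G" and C: "C \<subseteq> carrier G"
    using is_basis_subset[OF assms(2)] assms(3) by auto
  have sub: "subgroup (generate G C) G" using C by (rule G.generate_is_subgroup)
  have H: "group ?H" using sub assms(1) by (rule subgroup.subgroup_is_group)
  obtain D where D: "is_basis ?H D" and v: "v \<in> D" using assms(4) by (auto simp: primitive_in_def)
  have DC: "D \<subseteq> generate G C" using is_basis_subset[OF D] by simp
  have genC: "generate ?H C = generate G C"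
    using sub by (intro G.generate_consistent) (auto intro: generate.incl)
  have genD: "generate G D = generate G C"
    using basis_generate[OF H D] G.generate_consistent[OF DC sub] by simp
  define E where "E = D \<union> (B - C)"
  have E: "E \<subseteq> carrier G" using DC B subgroup.subset[OF sub] by (auto simp: E_def)
  obtain h1 where h1: "h1 \<in> hom ?H (free_group E)" "\<And>b. b \<in> D \<Longrightarrow> h1 b = [(b, True)]"
  proof -
    have "[(b, True)] \<in> carrier (free_group E)" if "b \<in> D" for b using that by (simp add: E_def)
    note ext = basis_extend[where f = "\<lambda>b. [(b, True)]", OF H group_free_group D this] 
    show thesis by (rule ext, assumption, rule that)
  qed
  \<comment> \<open>On the free factor, elements must be expressed in the letters of
    \<open>D\<close>, which \<open>h1\<close> does; the other basis elements keep their own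
    letters.\<close>
  obtain h where h: "h \<in> hom G (free_group E)"
      "\<And>b. b \<in> B \<Longrightarrow> h b = (if b \<in> C then h1 b else [(b, True)])"
  proof -
    have "(if b \<in> C then h1 b else [(b, True)]) \<in> carrier (free_group E)" if "b \<in> B" for b
      using that hom_in_carrier[OF h1(1), of b] generate.incl[of b C G]
      by (simp add: E_def del: carrier_free_group) (simp add: E_def)
    note ext = basis_extend[where f = "\<lambda>b. if b \<in> C then h1 b else [(b, True)]",
        OF assms(1) group_free_group[of E] assms(2) this]
    show thesis by (rule ext, assumption, rule that)
  qed
  have agree: "h x = h1 x" if "x \<in> generate G C" for x
  proof (rule hom_agree_on_generate[OF H group_free_group[of E]])
    show "h \<in> hom ?H (free_group E)"
      using h(1) subgroup.subset[OF sub] by (rule hom_restrict_carrier)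
    show "h c = h1 c" if "c \<in> C" for c using that h(2)[of c] assms(3) by auto
  qed (use h1(1) that genC in \<open>auto intro: generate.incl\<close>)
  have "is_basis G E"
  proof (rule basisI[OF assms(1) E _ h(1)])
    have "generate G C \<subseteq> generate G E" unfolding genD[symmetric] by (rule G.mono_generate) (auto simp: E_def)
    then have "B \<subseteq> generate G E"
      using generate.incl[of _ C G] generate.incl[of _ E G] unfolding E_def by blast
    then have "generate G B \<subseteq> generate G E"
      by (intro G.generate_subgroup_incl G.generate_is_subgroup E)
    then show "carrier G \<subseteq> generate G E" using basis_generate[OF assms(1,2)] by simp
    show "h c = [(c, True)]" if "c \<in> E" for c
      using that agree[of c] h1(2)[of c] h(2)[of c] DC unfolding E_def by fastforce
  qed
  with v show ?thesis by (auto simp: primitive_in_def E_def)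
qed

text \<open>A Nielsen move: \<open>b\<close> may be replaced in the basis by the product, because
  \<open>c\<close> is recovered from it with the help of the other basis elements.\<close>

lemma primitive_in_exchange:
  assumes "group G" "is_basis G B" "b \<in> B"
    and x: "x \<in> generate G (B - {b})" and y: "y \<in> generate G (B - {b})"
    and c: "c = b \<or> c = inv\<^bsub>G\<^esub> b"
  shows "primitive_in G (x \<otimes>\<^bsub>G\<^esub> c \<otimes>\<^bsub>G\<^esub> y)"
proof -
  interpret G: group G by fact
  define v where "v = x \<otimes>\<^bsub>G\<^esub> c \<otimes>\<^bsub>G\<^esub> y"
  define E where "E = insert v (B - {b})"
  interpret F: group "free_group E" by (rule group_free_group)
  have B: "B \<subseteq> carrier G" using assms(2) by (rule is_basis_subset)
  then have b: "b \<in> carrier G" using assms(3) by auto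
  have Bb: "B - {b} \<subseteq> carrier G" using B by auto
  have carr: "x \<in> carrier G" "y \<in> carrier G" "c \<in> carrier G"
    using G.generate_in_carrier[OF Bb] x y c b by auto
  have E: "E \<subseteq> carrier G" using B carr by (auto simp: E_def v_def)
  have c_eq: "c = inv\<^bsub>G\<^esub> x \<otimes>\<^bsub>G\<^esub> v \<otimes>\<^bsub>G\<^esub> inv\<^bsub>G\<^esub> y"
    using carr by (simp add: v_def G.m_assoc G.inv_solve_left)
  have F1: "[(e, True)] \<in> carrier (free_group E)" if "e \<in> E" for e using that by auto
  \<comment> \<open>The images of \<open>x\<close> and \<open>y\<close> are needed before that of
    \<open>b\<close> is fixed. Killing \<open>b\<close> gives them, since elements generated without
    \<open>b\<close> do not see its image.\<close>
  obtain h0 where h0: "h0 \<in> hom G (free_group E)"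
      "\<And>b'. b' \<in> B \<Longrightarrow> h0 b' = (if b' = b then [] else [(b', True)])"
  proof -
    have "(if b' = b then [] else [(b', True)]) \<in> carrier (free_group E)" if "b' \<in> B" for b'
      using that by (simp add: E_def)
    note ext = basis_extend[where f = "\<lambda>b'. if b' = b then [] else [(b', True)]",
        OF assms(1) group_free_group assms(2) this] 
    show thesis by (rule ext, assumption, rule that)
  qed
  have h0c: "h0 x \<in> carrier (free_group E)" "h0 y \<in> carrier (free_group E)"
    using carr by (blast intro: hom_in_carrier[OF h0(1)])+
  \<comment> \<open>The image of \<open>c\<close> is forced by the demand that \<open>v\<close> go
    to its own letter.\<close>
  define t where "t = inv\<^bsub>free_group E\<^esub> (h0 x) \<otimes>\<^bsub>free_group E\<^esub> [(v, True)] \<otimes>\<^bsub>free_group E\<^esub> inv\<^bsub>free_group E\<^esub> (h0 y)"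
  have v1: "[(v, True)] \<in> carrier (free_group E)" by (rule F1) (simp add: E_def)
  have t: "t \<in> carrier (free_group E)"
    unfolding t_def by (intro F.m_closed F.inv_closed h0c v1)
  define t' where "t' = (if c = b then t else inv\<^bsub>free_group E\<^esub> t)"
  have t': "t' \<in> carrier (free_group E)" unfolding t'_def using t F.inv_closed by presburger
  obtain h where h: "h \<in> hom G (free_group E)"
      "\<And>b'. b' \<in> B \<Longrightarrow> h b' = (if b' = b then t' else [(b', True)])"
  proof -
    have "(if b' = b then t' else [(b', True)]) \<in> carrier (free_group E)" if "b' \<in> B" for b'
      using that t' F1[of b'] by (simp add: E_def)
    note ext = basis_extend[where f = "\<lambda>b'. if b' = b then t' else [(b', True)]",
        OF assms(1) group_free_group[of E] assms(2) this]
    show thesis by (rule ext, assumption, rule that)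
  qed
  interpret h: group_hom G "free_group E" h using h(1) by unfold_locales
  have agree: "h z = h0 z" if "z \<in> generate G (B - {b})" for z
    by (rule hom_agree_on_generate[OF assms(1) group_free_group[of E] h(1) h0(1) Bb _ that])
      (simp add: h(2) h0(2))
  have hc: "h c = t"
  proof (cases "c = b")
    case True
    then show ?thesis using h(2)[OF assms(3)] by (simp add: t'_def)
  next
    case False
    then have "h c = inv\<^bsub>free_group E\<^esub> t'" using c h(2)[OF assms(3)] b by simp
    with False t show ?thesis by (simp add: t'_def del: carrier_free_group)
  qed
  have hv: "h v = [(v, True)]"
  proof -
    have "h v = h0 x \<otimes>\<^bsub>free_group E\<^esub> t \<otimes>\<^bsub>free_group E\<^esub> h0 y"
      unfolding v_def using carr hc agree[OF x] agree[OF y] h.hom_mult by (metis G.m_closed)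
    also have "\<dots> = [(v, True)]"
      unfolding t_def using h0c v1 F.inv_closed[OF h0c(1)] F.inv_closed[OF h0c(2)]
      by (metis F.m_assoc F.m_closed F.r_inv F.l_inv F.l_one F.r_one)
    finally show ?thesis .
  qed
  have "is_basis G E"
  proof (rule basisI[OF assms(1) E _ h(1)])
    have sub: "subgroup (generate G E) G" using E by (rule G.generate_is_subgroup)
    have le: "generate G (B - {b}) \<subseteq> generate G E" by (rule G.mono_generate) (auto simp: E_def)
    have "c \<in> generate G E"
      unfolding c_eq using x y le generate.incl[of v E G]
      by (intro subgroup.m_closed[OF sub] subgroup.m_inv_closed[OF sub]) (auto simp: E_def)
    then have "b \<in> generate G E" using c b subgroup.m_inv_closed[OF sub, of c] by auto
    then have "B \<subseteq> generate G E" using generate.incl[of _ E G] unfolding E_def by blast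
    then have "generate G B \<subseteq> generate G E" using sub by (intro G.generate_subgroup_incl)
    then show "carrier G \<subseteq> generate G E" using basis_generate[OF assms(1,2)] by simp
    show "h e = [(e, True)]" if "e \<in> E" for e using that hv h(2)[of e] unfolding E_def by auto
  qed
  then show ?thesis by (auto simp: primitive_in_def E_def v_def)
qed

section \<open>Transport along isomorphisms\<close>

lemma is_basis_iso:
  assumes "group G" "group H" "h \<in> iso G H" "is_basis G B"
  shows "is_basis H (h ` B)"
proof -
  interpret G: group G by fact
  interpret H: group H by fact
  interpret h: group_hom G H h using assms(3) by (unfold_locales) (simp add: iso_def)
  have B: "B \<subseteq> carrier G" using assms(4) by (rule is_basis_subset)
  have inj: "inj_on h (carrier G)" and img: "h ` carrier G = carrier H"
    using assms(3) by (auto simp: iso_def bij_betw_def)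
  define k where "k = inv_into (carrier G) h"
  have k: "k \<in> hom H G" using G.iso_set_sym[OF assms(3)] by (simp add: k_def iso_def)
  obtain f where f: "f \<in> hom G (free_group (h ` B))" "\<And>b. b \<in> B \<Longrightarrow> f b = [(h b, True)]"
  proof -
    have "[(h b, True)] \<in> carrier (free_group (h ` B))" if "b \<in> B" for b using that by simp
    note ext = basis_extend[where f = "\<lambda>b. [(h b, True)]", OF assms(1) group_free_group assms(4) this] 
    show thesis by (rule ext, assumption, rule that)
  qed
  show ?thesis
  proof (rule basisI[OF assms(2)])
    show "h ` B \<subseteq> carrier H" using B by auto
    show "carrier H \<subseteq> generate H (h ` B)"
      using h.generate_img[OF B] basis_generate[OF assms(1,4)] img by simp
    show "f \<circ> k \<in> hom H (free_group (h ` B))" using k f(1) by (rule hom_compose)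
    show "(f \<circ> k) c = [(c, True)]" if c: "c \<in> h ` B" for c
    proof -
      obtain b where b: "b \<in> B" "c = h b" using c by auto
      then have "k c = b" unfolding k_def using inj B by (auto simp: inv_into_f_f)
      with b f(2) show ?thesis by simp
    qed
  qed
qed

lemma primitive_in_iso:
  assumes "group G" "group H" "h \<in> iso G H" "primitive_in G w"
  shows "primitive_in H (h w)"
  using assms is_basis_iso[OF assms(1-3)] by (auto simp: primitive_in_def)

lemma ecard_image_inj: "inj_on f A \<Longrightarrow> ecard (f ` A) = ecard A"
  by (auto simp: ecard_def card_image finite_image_iff)

lemma free_rank_iso:
  assumes "group G" "group H" "h \<in> iso G H" "is_basis G B"
  shows "free_rank H = free_rank G"
proof -
  have "inj_on h B" using assms(3) is_basis_subset[OF assms(4)]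
    by (auto simp: iso_def bij_betw_def intro: inj_on_subset)
  then show ?thesis
    using free_rank_eq[OF assms(1,4)] free_rank_eq[OF assms(2) is_basis_iso[OF assms]]
    by (simp add: ecard_image_inj)
qed

section \<open>Schreier graphs of subgroups of free groups\<close>

text \<open>The ambient group is free on all letters. Subgroups of \<open>free_group X\<close> are
  subgroups of it too, so no alphabet has to be carried along.\<close>

locale free_subgroup =
  fixes J :: "('x \<times> bool) list set"
  assumes sub: "subgroup J (free_group UNIV)"
begin

abbreviation "F \<equiv> free_group (UNIV :: 'x set)"
abbreviation "G \<equiv> F\<lparr>carrier := J\<rparr>"

lemma group_G: "group G"
  using sub group_free_group by (rule subgroup.subgroup_is_group)

lemma reduced_J: "w \<in> J \<Longrightarrow> reduced w"
  using subgroup.subset[OF sub] by auto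

lemma Nil_J: "[] \<in> J"
  using subgroup.one_closed[OF sub] by simp

lemma reduce_append_J: "u \<in> J \<Longrightarrow> v \<in> J \<Longrightarrow> reduce (u @ v) \<in> J"
  using subgroup.m_closed[OF sub, of u v] by simp

lemma winv_J: "u \<in> J \<Longrightarrow> winv u \<in> J"
  using subgroup.m_inv_closed[OF sub, of u] reduced_J[of u] by (simp add: inv_free_group)

lemma inv_G: "w \<in> J \<Longrightarrow> inv\<^bsub>G\<^esub> w = winv w"
  using reduced_J[of w] winv_J[of w] by (intro group.inv_equality[OF group_G]) auto

text \<open>The vertices of the Schreier graph are the right cosets of \<open>J\<close>; \<open>st u\<close> is the end of the
  path from the base vertex that is labelled by the (not necessarily reduced) word \<open>u\<close>.\<close>

definition st :: "('x \<times> bool) list \<Rightarrow> ('x \<times> bool) list set" where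
  "st u = {w. reduce (w @ winv u) \<in> J}"

lemma st_eq_iff: "st u = st v \<longleftrightarrow> reduce (u @ winv v) \<in> J"
proof
  assume "st u = st v"
  moreover have "u \<in> st u" by (simp add: st_def Nil_J)
  ultimately show "reduce (u @ winv v) \<in> J" by (simp add: st_def)
next
  have *: "st u \<subseteq> st v" if "reduce (u @ winv v) \<in> J" for u v
  proof
    fix w assume "w \<in> st u"
    then have "reduce (w @ winv u) \<in> J" by (simp add: st_def)
    from reduce_append_J[OF this that]
    show "w \<in> st v" by (simp add: st_def)
  qed
  assume a: "reduce (u @ winv v) \<in> J"
  have "reduce (v @ winv u) = winv (reduce (u @ winv v))" by (simp flip: reduce_winv)
  then show "st u = st v" using *[OF a] *[of v u] winv_J[OF a] by simp
qed

lemma st_append_cong: "st u = st v \<Longrightarrow> st (u @ w) = st (v @ w)"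
  by (simp add: st_eq_iff)

lemma st_cong: "reduce u = reduce v \<Longrightarrow> st u = st v"
  by (simp add: st_eq_iff reduce_append_winv_eq_Nil_iff[THEN iffD2] Nil_J)

lemma st_reduce [simp]: "st (reduce u) = st u"
  by (rule st_cong) simp

lemma st_eq_base_iff: "st u = st [] \<longleftrightarrow> reduce u \<in> J"
  by (simp add: st_eq_iff)

lemma st_append_winv [simp]: "st (u @ w @ winv w) = st u"
  by (rule st_cong) simp

lemma st_snoc_cancel [simp]: "st (u @ [d, inv_letter d]) = st u" "st (u @ [inv_letter d, d]) = st u"
  using st_append_winv[of u "[d]"] st_append_winv[of u "[inv_letter d]"] by simp_all

text \<open>An edge is stored as its tail and generator in the positive orientation, so that
  traversing it backwards gives the same pair.\<close>

definition edge :: "('x \<times> bool) list \<Rightarrow> 'x \<times> bool \<Rightarrow> ('x \<times> bool) list set \<times> 'x" where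
  "edge u d = (if snd d then st u else st (u @ [d]), fst d)"

lemma snd_edge [simp]: "snd (edge u d) = fst d"
  by (simp add: edge_def)

lemma edge_cong: "st u = st v \<Longrightarrow> edge u d = edge v d"
  by (simp add: edge_def st_append_cong[of u v "[d]"])

lemma edge_inv_letter [simp]: "edge (u @ [d]) (inv_letter d) = edge u d"
  by (simp add: edge_def)

lemma edge_eqD:
  assumes "edge u d = edge u' d'"
  shows "st u = st u' \<and> st (u @ [d]) = st (u' @ [d']) \<and> d = d' \<or>
    st u = st (u' @ [d']) \<and> st (u @ [d]) = st u' \<and> d = inv_letter d'"
proof (cases "snd d = snd d'")
  case True
  then have d: "d = d'" using assms by (auto simp: edge_def prod_eq_iff)
  show ?thesis
  proof (cases "snd d")
    case True
    then have "st u = st u'" using assms d by (simp add: edge_def)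
    then show ?thesis using d st_append_cong by blast
  next
    case False
    then have "st (u @ [d]) = st (u' @ [d'])" using assms d by (simp add: edge_def)
    moreover from st_append_cong[OF this, of "[inv_letter d]"] have "st u = st u'"
      using d by simp
    ultimately show ?thesis using d by simp
  qed
next
  case False
  then have d: "d = inv_letter d'" using assms by (auto simp: edge_def prod_eq_iff)
  show ?thesis
  proof (cases "snd d")
    case True
    then have "st u = st (u' @ [d'])" using assms d by (simp add: edge_def)
    from this st_append_cong[OF this, of "[inv_letter d']"] show ?thesis
      using d by simp
  next
    case False
    then have "st (u @ [d]) = st u'" using assms d by (simp add: edge_def)
    from this st_append_cong[OF this, of "[d']"] show ?thesis
      using d by simp
  qed
qed

fun trav :: "('x \<times> bool) list \<Rightarrow> ('x \<times> bool) list \<Rightarrow> (('x \<times> bool) list set \<times> 'x) set" where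
  "trav u [] = {}"
| "trav u (d # w) = insert (edge u d) (trav (u @ [d]) w)"

lemma trav_append: "trav u (v @ w) = trav u v \<union> trav (u @ v) w"
  by (induction v arbitrary: u) auto

lemma trav_cong: "st u = st v \<Longrightarrow> trav u w = trav v w"
proof (induction w arbitrary: u v)
  case (Cons d w)
  show ?case
    using Cons.IH[OF st_append_cong[OF Cons.prems, of "[d]"]]
    by (simp only: trav.simps edge_cong[OF Cons.prems])
qed auto

lemma trav_winv: "trav (u @ w) (winv w) = trav u w"
proof (induction w arbitrary: u)
  case (Cons d w)
  have "trav (u @ d # w @ winv w) [inv_letter d] = trav (u @ [d]) [inv_letter d]"
    using st_append_winv[of "u @ [d]" w] by (intro trav_cong) simp
  with Cons[of "u @ [d]"] show ?case by (simp add: trav_append)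
qed auto

lemma finite_trav [simp]: "finite (trav u w)"
  by (induction w arbitrary: u) auto

lemma trav_conv_nth: "trav u w = (\<lambda>i. edge (u @ take i w) (w ! i)) ` {..<length w}"
proof (induction w arbitrary: u)
  case (Cons d w)
  show ?case unfolding trav.simps Cons
    by (simp add: lessThan_Suc_eq_insert_0 image_image del: lessThan_Suc)
qed auto

text \<open>Reading \<open>w\<close> while contracting the edges in \<open>T\<close> leaves a word
  in the oriented edges outside \<open>T\<close>. For a spanning tree this is the map to the
  fundamental group of the quotient, a bouquet of circles.\<close>

fun psi :: "(('x \<times> bool) list set \<times> 'x) set \<Rightarrow> ('x \<times> bool) list \<Rightarrow> ('x \<times> bool) list \<Rightarrow>
    ((('x \<times> bool) list set \<times> 'x) \<times> bool) list" where
  "psi T u [] = []"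
| "psi T u (d # w) = (if edge u d \<in> T then [] else [(edge u d, snd d)]) @ psi T (u @ [d]) w"

lemma psi_append: "psi T u (v @ w) = psi T u v @ psi T (u @ v) w"
  by (induction v arbitrary: u) auto

lemma psi_cong: "st u = st v \<Longrightarrow> psi T u w = psi T v w"
proof (induction w arbitrary: u v)
  case (Cons d w)
  show ?case
    using Cons.IH[OF st_append_cong[OF Cons.prems, of "[d]"]]
    by (simp only: psi.simps edge_cong[OF Cons.prems])
qed auto

lemma psi_winv: "psi T (u @ w) (winv w) = winv (psi T u w)"
proof (induction w arbitrary: u)
  case (Cons d w)
  have "psi T (u @ d # w @ winv w) [inv_letter d] = psi T (u @ [d]) [inv_letter d]"
    using st_append_winv[of "u @ [d]" w] by (intro psi_cong) simp
  also have "\<dots> = (if edge u d \<in> T then [] else [inv_letter (edge u d, snd d)])"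
    by (simp add: inv_letter_def[of "(edge u d, snd d)"])
  finally show ?case using Cons[of "u @ [d]"] by (simp add: psi_append)
qed auto

lemma psi_cons_reduce: "reduce (psi T u (cons_reduce a w)) = reduce (psi T u (a # w))"
proof (cases "w \<noteq> [] \<and> hd w = inv_letter a")
  case True
  then obtain t where t: "w = inv_letter a # t" by (cases w) auto
  have "psi T (u @ [a, inv_letter a]) t = psi T u t" by (rule psi_cong) simp
  moreover have "(edge u a, \<not> snd a) = inv_letter (edge u a, snd a)" by (simp add: inv_letter_def)
  ultimately show ?thesis unfolding t by simp
next
  case False
  then show ?thesis by (auto simp: cons_reduce_alt)
qed

lemma psi_reduce: "reduce (psi T u (reduce w)) = reduce (psi T u w)"
proof (induction w arbitrary: u)
  case (Cons a w)
  have "reduce (psi T u (reduce (a # w))) = reduce (psi T u (a # reduce w))"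
    unfolding reduce_Cons by (rule psi_cons_reduce)
  also have "\<dots> = reduce (psi T u (a # w))"
    unfolding psi.simps by (rule reduce_append_cong) (rule Cons)
  finally show ?case .
qed auto

lemma set_psi: "fst ` set (psi T u w) \<subseteq> trav u w - T"
  by (induction w arbitrary: u) auto

end

text \<open>A spanning tree of the Schreier graph, given by the parent of each vertex other than the root
  together with the label of the edge from the parent.\<close>

locale schreier_tree = free_subgroup +
  fixes key :: "('a \<times> bool) list set \<Rightarrow> nat"
    and par :: "('a \<times> bool) list set \<Rightarrow> ('a \<times> bool) list set \<times> ('a \<times> bool)"
  assumes key_root: "key (st []) = 0"
    and par_range: "q \<in> range st \<Longrightarrow> q \<noteq> st [] \<Longrightarrow> fst (par q) \<in> range st"
    and par_step: "st u \<noteq> st [] \<Longrightarrow> st v = fst (par (st u)) \<Longrightarrow> st (v @ [snd (par (st u))]) = st u"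
    and par_key: "q \<in> range st \<Longrightarrow> q \<noteq> st [] \<Longrightarrow> key (fst (par q)) < key q"
begin

text \<open>The label of the tree path from the root. The test on \<open>key\<close> makes the
  recursion terminate for every argument; on cosets other than the root it always succeeds.\<close>

function tau :: "('a \<times> bool) list set \<Rightarrow> ('a \<times> bool) list" where
  "tau q = (if key (fst (par q)) < key q then tau (fst (par q)) @ [snd (par q)] else [])"
  by auto
termination by (relation "Wellfounded.measure key") auto

declare tau.simps [simp del]

lemma tau_root [simp]: "tau (st []) = []"
  by (subst tau.simps) (simp add: key_root)

lemma tau_step:
  "q \<in> range st \<Longrightarrow> q \<noteq> st [] \<Longrightarrow> tau q = tau (fst (par q)) @ [snd (par q)]"
  by (subst tau.simps) (simp add: par_key)

lemma st_tau: "q \<in> range st \<Longrightarrow> st (tau q) = q"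
proof (induction "key q" arbitrary: q rule: less_induct)
  case less
  show ?case
  proof (cases "q = st []")
    case False
    then have "st (tau (fst (par q))) = fst (par q)"
      by (intro less.hyps par_key par_range less.prems)
    moreover obtain u where "q = st u" using less.prems by auto
    ultimately show ?thesis using False par_step[of u "tau (fst (par q))"] tau_step[of q] by simp
  qed auto
qed

lemma st_tau_st [simp]: "st (tau (st u)) = st u"
  by (rule st_tau) simp

definition tree_edge :: "('a \<times> bool) list set \<Rightarrow> ('a \<times> bool) list set \<times> 'a" where
  "tree_edge q = edge (tau (fst (par q))) (snd (par q))"

definition tree_edges :: "(('a \<times> bool) list set \<times> 'a) set" where
  "tree_edges = tree_edge ` (range st - {st []})"

definition chords :: "(('a \<times> bool) list set \<times> 'a) set" where
  "chords = {edge u d |u d. True} - tree_edges"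

text \<open>The Schreier generator of an edge: along the tree to its tail, across it, and back along
  the tree.\<close>

definition gam :: "('a \<times> bool) list set \<times> 'a \<Rightarrow> ('a \<times> bool) list" where
  "gam e = reduce (tau (fst e) @ [(snd e, True)] @ winv (tau (st (tau (fst e) @ [(snd e, True)]))))"

definition step :: "('a \<times> bool) list \<Rightarrow> 'a \<times> bool \<Rightarrow> ('a \<times> bool) list" where
  "step u d = reduce (tau (st u) @ [d] @ winv (tau (st (u @ [d]))))"

lemma gam_edge: "gam (edge u d) = (if snd d then step u d else winv (step u d))"
proof (cases "snd d")
  case True
  then obtain x where d: "d = (x, True)" by (cases d) auto
  have "st (tau (st u) @ [d]) = st (u @ [d])" by (rule st_append_cong) simp
  then show ?thesis by (simp add: gam_def step_def edge_def d)
next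
  case False
  then have d: "(fst d, True) = inv_letter d" by (simp add: inv_letter_def)
  have "st (tau (st (u @ [d])) @ [inv_letter d]) = st (u @ [d] @ [inv_letter d])"
    by (subst append_assoc[symmetric], rule st_append_cong) simp
  then have "gam (edge u d) =
      reduce (tau (st (u @ [d])) @ [inv_letter d] @ winv (tau (st u)))"
    using False d by (simp add: gam_def edge_def)
  also have "\<dots> = winv (step u d)" by (simp add: step_def flip: reduce_winv)
  finally show ?thesis using False by simp
qed

lemma step_eq: "step u d = (if snd d then gam (edge u d) else winv (gam (edge u d)))"
  by (simp add: gam_edge)

lemma step_J: "step u d \<in> J"
proof -
  have "st (tau (st u) @ [d] @ winv (tau (st (u @ [d])))) = st (tau (st (u @ [d])) @ winv (tau (st (u @ [d]))))"
  proof (subst append_assoc[symmetric], rule st_append_cong)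
    show "st (tau (st u) @ [d]) = st (tau (st (u @ [d])))"
      using st_append_cong[of "tau (st u)" u "[d]"] by simp
  qed
  also have "\<dots> = st []" using st_append_winv[of "[]"] by simp
  finally show ?thesis by (simp add: step_def st_eq_base_iff)
qed

lemma gam_J: "gam (edge u d) \<in> J"
  using step_J[of u d] winv_J[of "step u d"] by (simp add: gam_edge)

lemma gam_chords_J: "gam ` chords \<subseteq> J"
proof
  fix w assume "w \<in> gam ` chords"
  then obtain u d where "w = gam (edge u d)" unfolding chords_def by blast
  then show "w \<in> J" by (simp add: gam_J)
qed

lemma gam_tree_edge: "e \<in> tree_edges \<Longrightarrow> gam e = []"
proof -
  assume "e \<in> tree_edges"
  then obtain q where q: "q \<in> range st" "q \<noteq> st []" and e: "e = tree_edge q"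
    by (auto simp: tree_edges_def)
  let ?q = "fst (par q)" and ?d = "snd (par q)"
  have "st (tau ?q) = ?q" using par_range[OF q] by (rule st_tau)
  moreover have "st (tau ?q @ [?d]) = q" using st_tau[OF q(1)] tau_step[OF q] by simp
  ultimately have "step (tau ?q) ?d = reduce (tau q @ winv (tau q))"
    by (simp add: step_def tau_step[OF q])
  then show ?thesis by (simp add: e tree_edge_def gam_edge del: append_assoc)
qed

lemma trav_edges: "trav u w \<subseteq> {edge u d |u d. True}"
  by (induction w arbitrary: u) auto

lemma trav_chords: "trav u w - tree_edges \<subseteq> chords"
  using trav_edges[of u w] unfolding chords_def by (rule Diff_mono) simp

text \<open>Inserting \<open>tau\<close> and its inverse after every letter turns the word into a
  product of Schreier generators, up to inversion, of the edges traversed. A general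
  \<open>K\<close> lets the result be read off for any set of chords containing those
  traversed.\<close>

lemma telescope:
  assumes K: "subgroup K F" and "\<And>e. e \<in> trav u w - tree_edges \<Longrightarrow> gam e \<in> K"
  shows "reduce (tau (st u) @ w @ winv (tau (st (u @ w)))) \<in> K"
  using assms(2)
proof (induction w arbitrary: u)
  case Nil
  then show ?case using subgroup.one_closed[OF K] by simp
next
  case (Cons d w)
  have winv: "winv a \<in> K" if "a \<in> K" for a
    using subgroup.m_inv_closed[OF K that] subgroup.subset[OF K] that by (auto simp: inv_free_group)
  have "gam (edge u d) \<in> K"
    using Cons.prems[of "edge u d"] gam_tree_edge[of "edge u d"] subgroup.one_closed[OF K]
    by (cases "edge u d \<in> tree_edges") auto
  then have s: "step u d \<in> K" using winv by (simp add: step_eq)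
  have "reduce (tau (st (u @ [d])) @ w @ winv (tau (st ((u @ [d]) @ w)))) \<in> K"
    using Cons.prems by (intro Cons.IH) auto
  from subgroup.m_closed[OF K s this]
  have "reduce (tau (st u) @ [d] @ winv (tau (st (u @ [d]))) @ tau (st (u @ [d])) @ w @
      winv (tau (st (u @ d # w)))) \<in> K"
    by (simp add: step_def)
  then show ?case using reduce_mid_cancel(2)[of "tau (st u) @ [d]"] by simp
qed

lemma psi_tau: "q \<in> range st \<Longrightarrow> psi tree_edges [] (tau q) = []"
proof (induction "key q" arbitrary: q rule: less_induct)
  case less
  show ?case
  proof (cases "q = st []")
    case False
    have "edge (tau (fst (par q))) (snd (par q)) \<in> tree_edges"
      using False less.prems by (auto simp: tree_edges_def tree_edge_def)
    then show ?thesis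
      using less.hyps[OF par_key[OF less.prems False] par_range[OF less.prems False]]
      by (simp add: tau_step[OF less.prems False] psi_append)
  qed auto
qed

text \<open>Apart from the chord itself its loop runs in the tree, so contracting the tree leaves a
  single letter.\<close>

lemma psi_gam:
  assumes "e \<in> chords"
  shows "reduce (psi tree_edges [] (gam e)) = [(e, True)]"
proof -
  obtain u d where "e = edge u d" using assms by (auto simp: chords_def)
  then have q: "fst e \<in> range st" by (simp add: edge_def)
  let ?d = "(snd e, True)"
  let ?q = "st (tau (fst e) @ [?d])"
  have e: "edge (tau (fst e)) ?d = e" using st_tau[OF q] by (simp add: edge_def)
  have "psi tree_edges (tau (fst e) @ [?d]) (winv (tau ?q)) = psi tree_edges (tau ?q) (winv (tau ?q))"
    by (rule psi_cong) simp
  also have "\<dots> = []" using psi_winv[of tree_edges "[]" "tau ?q"] psi_tau[of ?q] by simp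
  finally have "psi tree_edges [] (tau (fst e) @ [?d] @ winv (tau ?q)) = [(e, True)]"
    using assms psi_tau[OF q] e by (simp add: psi_append chords_def)
  then show ?thesis unfolding gam_def by (simp add: psi_reduce)
qed

lemma inj_on_gam: "inj_on gam chords"
  by (rule inj_onI) (metis psi_gam list.inject prod.inject)

lemma generate_gam_subgroup:
  assumes "C \<subseteq> chords"
  shows "subgroup (generate G (gam ` C)) F"
proof -
  have "gam ` C \<subseteq> J" using assms gam_chords_J by blast
  then show ?thesis
    using group.generate_is_subgroup[OF group_G, of "gam ` C"] group.incl_subgroup[OF group_free_group sub]
    by simp
qed

lemma trav_generate:
  assumes "trav u w - tree_edges \<subseteq> C" "C \<subseteq> chords"
  shows "reduce (tau (st u) @ w @ winv (tau (st (u @ w)))) \<in> generate G (gam ` C)"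
  using assms(1) by (intro telescope generate_gam_subgroup[OF assms(2)]) (auto intro: generate.incl)

text \<open>The Nielsen-Schreier theorem with an explicit basis. Contracting the tree and renaming
  chords by \<open>gam\<close> is the homomorphism required by \<open>basisI\<close>; it is
  multiplicative on \<open>J\<close> because elements of \<open>J\<close> lead back to the
  root.\<close>

lemma is_basis_gam: "is_basis G (gam ` chords)"
proof (rule basisI[OF group_G])
  let ?\<psi> = "\<lambda>w. reduce (map (apfst gam) (psi tree_edges [] w))"
  show "gam ` chords \<subseteq> carrier G" using gam_chords_J by simp
  show "carrier G \<subseteq> generate G (gam ` chords)"
  proof
    fix w assume w: "w \<in> carrier G"
    then have "reduce w = w" "st w = st []" using reduced_J by (simp_all add: st_eq_base_iff)
    then show "w \<in> generate G (gam ` chords)"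
      using trav_generate[OF trav_chords order_refl, of "[]" w] by simp
  qed
  show "?\<psi> \<in> hom G (free_group (gam ` chords))"
  proof (rule homI)
    fix w :: "('a \<times> bool) list"
    have "fst ` set (psi tree_edges [] w) \<subseteq> chords"
      using set_psi trav_chords by (rule order_trans)
    then have "set (map (apfst gam) (psi tree_edges [] w)) \<subseteq> gam ` chords \<times> UNIV"
      by (auto simp: apfst_def map_prod_def)
    then show "?\<psi> w \<in> carrier (free_group (gam ` chords))"
      using set_reduce[of "map (apfst gam) (psi tree_edges [] w)"] by simp
  next
    fix u v assume u: "u \<in> carrier G" and v: "v \<in> carrier G"
    then have "st u = st []" using reduced_J by (simp add: st_eq_base_iff)
    then have "psi tree_edges u v = psi tree_edges [] v" by (rule psi_cong)
    then have "reduce (psi tree_edges [] (reduce (u @ v)))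
        = reduce (psi tree_edges [] u @ psi tree_edges [] v)"
      by (simp add: psi_reduce psi_append)
    then have "?\<psi> (reduce (u @ v)) = reduce (map (apfst gam) (psi tree_edges [] u @ psi tree_edges [] v))"
      by (metis reduce_map_reduce)
    then show "?\<psi> (u \<otimes>\<^bsub>G\<^esub> v) = ?\<psi> u \<otimes>\<^bsub>free_group (gam ` chords)\<^esub> ?\<psi> v" by simp
  qed
  show "?\<psi> c = [(c, True)]" if c: "c \<in> gam ` chords" for c
  proof -
    obtain e where e: "e \<in> chords" "c = gam e" using c by auto
    have "?\<psi> c = reduce (map (apfst gam) (reduce (psi tree_edges [] c)))"
      by (simp add: reduce_map_reduce)
    then show ?thesis using psi_gam[OF e(1)] by (simp add: e(2))
  qed
qed

text \<open>If two cosets owned the same edge in opposite directions, each would be the parent of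
  the other, against the decrease of \<open>key\<close>.\<close>

lemma inj_on_tree_edge: "inj_on tree_edge (range st - {st []})"
proof (rule inj_onI)
  fix q q' assume "q \<in> range st - {st []}" "q' \<in> range st - {st []}" and eq: "tree_edge q = tree_edge q'"
  then have q: "q \<in> range st" "q \<noteq> st []" and q': "q' \<in> range st" "q' \<noteq> st []" by auto
  have "st (tau (fst (par q)) @ [snd (par q)]) = q" "st (tau (fst (par q')) @ [snd (par q')]) = q'"
    using st_tau q q' tau_step by metis+
  with edge_eqD[OF eq[unfolded tree_edge_def]] show "q = q'"
    using par_key[OF q] par_key[OF q'] st_tau[OF par_range[OF q]] st_tau[OF par_range[OF q']] by auto
qed

lemma tree_edge_ends:
  assumes "tree_edge q = edge u d" "q \<in> range st" "q \<noteq> st []"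
  shows "q = st u \<or> q = st (u @ [d])"
proof -
  have "st (tau (fst (par q)) @ [snd (par q)]) = q" using st_tau assms tau_step by metis
  with edge_eqD[OF assms(1)[unfolded tree_edge_def]] show ?thesis by auto
qed

end

section \<open>Spanning trees adapted to a word\<close>

context free_subgroup
begin

definition visited :: "('x \<times> bool) list \<Rightarrow> ('x \<times> bool) list set set" where
  "visited v = (\<lambda>j. st (take j v)) ` {..length v}"

lemma finite_visited [simp]: "finite (visited v)"
  by (simp add: visited_def)

lemma st_Nil_visited: "st [] \<in> visited v"
  unfolding visited_def by (rule image_eqI[of _ _ 0]) auto

text \<open>The tree grows along the first visits of \<open>v\<close> and, outside the part traversed by \<open>v\<close>,
  along shortest words.\<close>

lemma exploration_tree:
  obtains key par where "schreier_tree J key par"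
    "\<And>q. q \<in> visited v \<Longrightarrow> q \<noteq> st [] \<Longrightarrow>
       \<exists>i<length v. par q = (st (take i v), v ! i) \<and> st (take (Suc i) v) = q"
proof -
  define fv where "fv q = (LEAST j. st (take j v) = q)" for q
  define len where "len q = (LEAST n. \<exists>w. length w = n \<and> st w = q)" for q
  \<comment> \<open>Keys of visited cosets are at most \<open>length v\<close>, and all other cosets
    get larger ones. So \<open>key\<close> still decreases when the shortest word to an unvisited
    coset comes out of the visited part.\<close>
  define key where "key q = (if q \<in> visited v then fv q else length v + len q)" for q
  define P where "P q p \<longleftrightarrow>
      fst p \<in> range st \<and> (\<forall>u. st u = fst p \<longrightarrow> st (u @ [snd p]) = q) \<and> key (fst p) < key q \<and>
      (q \<in> visited v \<longrightarrow> (\<exists>i<length v. p = (st (take i v), v ! i) \<and> st (take (Suc i) v) = q))"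
    for q p
  have ex: "\<exists>p. P q p" if q: "q \<in> range st" "q \<noteq> st []" for q
  proof (cases "q \<in> visited v")
    case True
    then obtain j where j: "j \<le> length v" "st (take j v) = q" by (auto simp: visited_def)
    have fv: "st (take (fv q) v) = q" unfolding fv_def using j(2) by (rule LeastI)
    have "fv q \<le> j" unfolding fv_def using j(2) by (rule Least_le)
    moreover have "fv q \<noteq> 0" using fv q(2) by (intro notI) simp
    ultimately obtain i where i: "fv q = Suc i" "i < length v"
      using j(1) by (intro that[of "fv q - 1"]) simp_all
    have tk: "take (Suc i) v = take i v @ [v ! i]" using i(2) by (rule take_Suc_conv_app_nth)
    have "st (take i v) \<in> visited v" using i(2) by (auto simp: visited_def)
    moreover have "fv (st (take i v)) \<le> i" unfolding fv_def by (rule Least_le) simp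
    ultimately have "key (st (take i v)) < key q" using True i by (simp add: key_def)
    moreover have fvi: "st (take (Suc i) v) = q" using fv i(1) by simp
    then have "st (u @ [v ! i]) = q" if "st u = st (take i v)" for u
      unfolding tk using st_append_cong[OF that, of "[v ! i]"] by (rule trans[rotated])
    ultimately show ?thesis using i(2) fvi
      unfolding P_def by (intro exI[of _ "(st (take i v), v ! i)"] conjI impI allI exI[of _ i]) simp_all
  next
    case False
    have "\<exists>n w. length w = n \<and> st w = q" using q(1) by auto
    then have "\<exists>w. length w = len q \<and> st w = q"
      unfolding len_def by (rule LeastI_ex)
    then obtain w where w: "length w = len q" "st w = q" by auto
    with q(2) obtain w' d where wd: "w = w' @ [d]" by (cases w rule: rev_cases) auto
    have "len (st w') \<le> length w'" unfolding len_def by (rule Least_le) auto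
    moreover have "fv p \<le> length v" if "p \<in> visited v" for p
      using that unfolding visited_def fv_def by (auto intro: Least_le order_trans)
    moreover have "length w' < len q" using w(1) wd by simp
    moreover have "key q = length v + len q" using False by (simp add: key_def)
    ultimately have "key (st w') < key q"
      unfolding key_def[of "st w'"] by (cases "st w' \<in> visited v") fastforce+
    moreover have "st (u @ [d]) = q" if "st u = st w'" for u
      using w(2) st_append_cong[OF that, of "[d]"] unfolding wd by (rule trans[rotated])
    ultimately show ?thesis using False unfolding P_def by (intro exI[of _ "(st w', d)"]) simp
  qed
  define par where "par q = (SOME p. P q p)" for q
  have par: "P q (par q)" if "q \<in> range st" "q \<noteq> st []" for q
    unfolding par_def using ex[OF that] by (rule someI_ex)
  show thesis
  proof
    have "fv (st []) = 0" unfolding fv_def by (rule Least_equality) auto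
    then have k0: "key (st []) = 0" using st_Nil_visited by (simp add: key_def)
    show "schreier_tree J key par"
    proof
      show "key (st []) = 0" by (rule k0)
    next
      fix q assume "q \<in> range st" "q \<noteq> st []"
      from par[OF this] show "fst (par q) \<in> range st" "key (fst (par q)) < key q"
        by (simp_all add: P_def)
    next
      fix u w assume "st u \<noteq> st []" "st w = fst (par (st u))"
      with par[of "st u"] show "st (w @ [snd (par (st u))]) = st u" by (simp add: P_def)
    qed
    fix q assume q: "q \<in> visited v" "q \<noteq> st []"
    then have "q \<in> range st" by (auto simp: visited_def)
    from par[OF this q(2)] q(1)
    show "\<exists>i<length v. par q = (st (take i v), v ! i) \<and> st (take (Suc i) v) = q"
      by (simp add: P_def)
  qed
qed

end

context schreier_tree
begin

text \<open>Each visited coset other than the root hangs on an edge of \<open>v\<close>, and a tree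
  edge traversed by \<open>v\<close> has its child among the visited cosets. So the traversed tree
  edges number \<open>V - 1\<close>, and the chords \<open>E - V + 1\<close>.\<close>

lemma card_chords_trav:
  assumes vis: "\<And>q. q \<in> visited v \<Longrightarrow> q \<noteq> st [] \<Longrightarrow>
       \<exists>i<length v. par q = (st (take i v), v ! i) \<and> st (take (Suc i) v) = q"
  shows "card (trav [] v - tree_edges) + card (visited v) = card (trav [] v) + 1"
proof -
  have vr: "visited v \<subseteq> range st" by (auto simp: visited_def)
  have tr: "trav [] v = (\<lambda>i. edge (take i v) (v ! i)) ` {..<length v}"
    using trav_conv_nth[of "[]" v] by simp
  have "tree_edges \<inter> trav [] v = tree_edge ` (visited v - {st []})"
  proof (intro equalityI subsetI)
    fix e assume "e \<in> tree_edges \<inter> trav [] v"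
    then obtain q i where q: "q \<in> range st" "q \<noteq> st []" "e = tree_edge q"
      and i: "i < length v" "tree_edge q = edge (take i v) (v ! i)"
      unfolding tree_edges_def tr by auto
    have "q = st (take i v) \<or> q = st (take (Suc i) v)"
      using tree_edge_ends[OF i(2) q(1,2)] i(1) by (simp add: take_Suc_conv_app_nth)
    then have "q \<in> visited v" using i(1) by (auto simp: visited_def)
    with q show "e \<in> tree_edge ` (visited v - {st []})" by auto
  next
    fix e assume "e \<in> tree_edge ` (visited v - {st []})"
    then obtain q where q: "q \<in> visited v" "q \<noteq> st []" "e = tree_edge q" by auto
    from vis[OF q(1,2)] obtain i where i: "i < length v" "par q = (st (take i v), v ! i)" by auto
    have "e = edge (take i v) (v ! i)"
      unfolding q(3) tree_edge_def i(2) by (simp add: edge_cong[of "tau (st (take i v))" "take i v"])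
    then have "e \<in> trav [] v" unfolding tr using i(1) by auto
    moreover have "e \<in> tree_edges" using q vr by (auto simp: tree_edges_def)
    ultimately show "e \<in> tree_edges \<inter> trav [] v" by simp
  qed
  moreover have "inj_on tree_edge (visited v - {st []})"
    using inj_on_tree_edge by (rule inj_on_subset) (use vr in auto)
  ultimately have "card (tree_edges \<inter> trav [] v) = card (visited v) - 1"
    using st_Nil_visited[of v] by (simp add: card_image)
  moreover have "card (visited v) > 0" using st_Nil_visited[of v] by (auto simp: card_gt_0_iff)
  moreover have "card (trav [] v) = card (trav [] v - tree_edges) + card (tree_edges \<inter> trav [] v)"
    by (subst card_Un_disjoint[symmetric]) (auto intro!: arg_cong[of _ _ card])
  ultimately show ?thesis by linarith
qed

end

context free_subgroup
begin

text \<open>If an edge were crossed once, the remaining parts of the path would still reach both its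
  ends, so some spanning tree would avoid it. Its generator would then occur exactly once in
  \<open>v\<close>, and a Nielsen move would make \<open>v\<close> a basis element.\<close>

lemma traversed_twice:
  assumes v: "v \<in> J" and np: "\<not> primitive_in G v" and e: "e \<in> trav [] v"
  shows "2 \<le> card {i. i < length v \<and> edge (take i v) (v ! i) = e}"
proof (rule ccontr)
  let ?I = "{i. i < length v \<and> edge (take i v) (v ! i) = e}"
  assume "\<not> 2 \<le> card ?I"
  moreover obtain i where i: "i \<in> ?I"
    using e trav_conv_nth[of "[]" v] by auto
  moreover from i have "card ?I \<noteq> 0" by auto
  ultimately have "card ?I = 1" by linarith
  then obtain i' where "?I = {i'}" by (rule card_1_singletonE)
  with i have I: "?I = {i}" by simp
  define p d q where "p = take i v" and "d = v ! i" and "q = drop (Suc i) v"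
  have il: "i < length v" and e_eq: "e = edge p d" using i by (auto simp: p_def d_def)
  have vpq: "v = p @ d # q" unfolding p_def d_def q_def using il by (rule id_take_nth_drop)
  have ep: "e \<notin> trav [] p"
  proof
    assume "e \<in> trav [] p"
    then obtain j where j: "j < length p" "e = edge (take j p) (p ! j)"
      using trav_conv_nth[of "[]" p] by auto
    moreover from j(1) have "j < i" by (simp add: p_def)
    ultimately have "j \<in> ?I" using il by (simp add: p_def)
    with \<open>j < i\<close> show False unfolding I by simp
  qed
  have eq: "e \<notin> trav (p @ [d]) q"
  proof
    assume "e \<in> trav (p @ [d]) q"
    then obtain j where j: "j < length q" "e = edge (p @ d # take j q) (q ! j)"
      using trav_conv_nth[of "p @ [d]" q] by auto
    moreover have "p @ d # take j q = take (Suc i + j) v" "q ! j = v ! (Suc i + j)"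
      unfolding take_add p_def d_def q_def using il by (simp_all add: take_Suc_conv_app_nth)
    ultimately have "Suc i + j \<in> ?I" using il by (simp add: q_def)
    then show False unfolding I by simp
  qed
  \<comment> \<open>This word reaches both ends of \<open>e\<close> without crossing it: one through
    \<open>p\<close>, the other by running backwards along \<open>q\<close> from the base. The tree
    is grown along it.\<close>
  define u where "u = p @ winv p @ winv q"
  have stq: "st (p @ [d]) = st (winv q)"
    using v reduced_J[OF v] by (simp add: st_eq_iff vpq)
  have "trav (winv q) q = trav (p @ [d]) q" by (rule trav_cong) (simp add: stq)
  moreover have "trav (p @ winv p) (winv q) = trav [] (winv q)" using st_append_winv[of "[]"] by (intro trav_cong) simp
  moreover have "trav [] (winv q) = trav (winv q) q" using trav_winv[of "[]" "winv q"] by simp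
  moreover have "trav p (winv p) = trav [] p" using trav_winv[of "[]" p] by simp
  ultimately have eu: "e \<notin> trav [] u" using ep eq by (simp add: u_def trav_append)
  obtain key par where "schreier_tree J key par" and
    vis: "\<And>q. q \<in> visited u \<Longrightarrow> q \<noteq> st [] \<Longrightarrow>
       \<exists>i<length u. par q = (st (take i u), u ! i) \<and> st (take (Suc i) u) = q"
    using exploration_tree[of u] by metis
  then interpret T: schreier_tree J key par by simp
  have "st p \<in> visited u" unfolding visited_def u_def by (rule image_eqI[of _ _ "length p"]) auto
  moreover have "st (p @ winv p @ winv q) = st (winv q)" by (rule st_cong) simp
  then have "st (p @ [d]) \<in> visited u"
    unfolding visited_def u_def stq by (intro image_eqI[of _ _ "length (p @ winv p @ winv q)"]) auto
  moreover have "e \<in> trav [] u" if x: "e = T.tree_edge x" "x \<in> range st" "x \<noteq> st []" "x \<in> visited u" for x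
  proof -
    from vis[OF x(4,3)] obtain i where i: "i < length u" "par x = (st (take i u), u ! i)" by auto
    have "e = edge (take i u) (u ! i)"
      unfolding x(1) T.tree_edge_def i(2) by (simp add: edge_cong[of "T.tau (st (take i u))" "take i u"])
    then show ?thesis using i(1) trav_conv_nth[of "[]" u] by auto
  qed
  \<comment> \<open>The child of a tree edge is one of its ends. Both ends of \<open>e\<close> are
    visited by \<open>u\<close>, and the tree edges of visited cosets are crossed by
    \<open>u\<close>, whereas \<open>e\<close> is not.\<close>
  ultimately have *: "False" if "e = T.tree_edge x" "x \<in> range st" "x \<noteq> st []" for x
    using eu T.tree_edge_ends[of x p d] e_eq that by metis
  have eT: "e \<notin> T.tree_edges"
  proof
    assume "e \<in> T.tree_edges"
    then obtain x where "x \<in> range st - {st []}" "e = T.tree_edge x"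
      unfolding T.tree_edges_def by (rule imageE)
    then show False using *[of x] by simp
  qed
  then have ec: "e \<in> T.chords" using e_eq unfolding T.chords_def by blast
  let ?B = "T.gam ` T.chords"
  have B: "is_basis G ?B" by (rule T.is_basis_gam)
  have im: "T.gam ` (T.chords - {e}) = ?B - {T.gam e}"
    using T.inj_on_gam ec by (auto dest: inj_onD)
  let ?x = "reduce (p @ winv (T.tau (st p)))" and ?y = "reduce (T.tau (st (p @ [d])) @ q)"
  have "?x \<in> generate G (?B - {T.gam e})"
    using T.trav_generate[of "[]" p "T.chords - {e}"] T.trav_chords[of "[]" p] ep im by auto
  moreover have "?y \<in> generate G (?B - {T.gam e})"
  proof -
    have "st (p @ d # q) = st []" using v reduced_J[OF v] by (simp add: st_eq_base_iff flip: vpq)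
    then show ?thesis
      using T.trav_generate[of "p @ [d]" q "T.chords - {e}"] T.trav_chords[of "p @ [d]" q] eq im by auto
  qed
  moreover have "T.step p d = T.gam e \<or> T.step p d = inv\<^bsub>G\<^esub> (T.gam e)"
    using T.gam_J[of p d] by (simp add: e_eq T.step_eq inv_G)
  ultimately have "primitive_in G (?x \<otimes>\<^bsub>G\<^esub> T.step p d \<otimes>\<^bsub>G\<^esub> ?y)"
    using ec by (intro primitive_in_exchange[OF group_G B]) auto
  moreover have "?x \<otimes>\<^bsub>G\<^esub> T.step p d \<otimes>\<^bsub>G\<^esub> ?y = v"
  proof -
    have "?x \<otimes>\<^bsub>G\<^esub> T.step p d \<otimes>\<^bsub>G\<^esub> ?y =
        reduce (p @ winv (T.tau (st p)) @ T.tau (st p) @ [d] @ winv (T.tau (st (p @ [d]))) @ T.tau (st (p @ [d])) @ q)"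
      by (simp add: T.step_def del: reduce_mid_cancel)
    also have "\<dots> = reduce (p @ [d] @ winv (T.tau (st (p @ [d]))) @ T.tau (st (p @ [d])) @ q)"
      by (rule reduce_mid_cancel)
    also have "\<dots> = reduce (p @ [d] @ q)"
      using reduce_mid_cancel(2)[of "p @ [d]"] by (simp del: reduce_mid_cancel)
    also have "\<dots> = v" using reduced_J[OF v] by (simp flip: vpq)
    finally show ?thesis .
  qed
  ultimately show False using np by simp
qed

text \<open>Loops closed up from two prefixes that reach the same coset. The set depends on
  \<open>J\<close> only through the coincidences among prefixes, which is what an exploration
  records.\<close>

definition loops :: "('x \<times> bool) list \<Rightarrow> ('x \<times> bool) list set" where
  "loops v = {reduce (take i v @ winv (take j v)) |i j.
     i \<le> length v \<and> j \<le> length v \<and> st (take i v) = st (take j v)}"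

text \<open>Minimality is applied to the subgroup generated by the chords that \<open>v\<close>
  crosses: it needs at least \<open>m\<close> of them, and there are only \<open>m\<close>. The
  second claim makes \<open>J\<close> recoverable from \<open>v\<close> and the coincidences of its
  prefixes.\<close>

lemma critical_structure:
  assumes v: "v \<in> J" and np: "\<not> primitive_in G v" and rank: "free_rank G = enat m"
    and min: "\<And>K. subgroup K F \<Longrightarrow> K \<subseteq> J \<Longrightarrow> v \<in> K \<Longrightarrow> \<not> primitive_in (F\<lparr>carrier := K\<rparr>) v \<Longrightarrow>
      enat m \<le> free_rank (F\<lparr>carrier := K\<rparr>)"
  shows "card (trav [] v) + 1 = m + card (visited v)" "J = generate F (loops v)"
proof -
  obtain key par where "schreier_tree J key par" and
    vis: "\<And>q. q \<in> visited v \<Longrightarrow> q \<noteq> st [] \<Longrightarrow>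
       \<exists>i<length v. par q = (st (take i v), v ! i) \<and> st (take (Suc i) v) = q"
    using exploration_tree[of v] by metis
  then interpret T: schreier_tree J key par by simp
  define C where "C = trav [] v - T.tree_edges"
  have C: "C \<subseteq> T.chords" unfolding C_def by (rule T.trav_chords)
  let ?B = "T.gam ` T.chords"
  have B: "is_basis G ?B" by (rule T.is_basis_gam)
  have finB: "finite ?B" and cardB: "card ?B = m"
    using rank free_rank_eq[OF group_G B] by (auto simp: ecard_def split: if_splits)
  have fin: "finite T.chords" and card: "card T.chords = m"
    using finB cardB T.inj_on_gam by (auto simp: finite_image_iff card_image)
  define K where "K = generate G (T.gam ` C)"
  have subK: "subgroup K F" unfolding K_def using C by (rule T.generate_gam_subgroup)
  have CB: "T.gam ` C \<subseteq> ?B" using C by auto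
  have KJ: "K \<subseteq> J"
    using group.generate_incl[OF group_G, of "T.gam ` C"] CB T.gam_chords_J unfolding K_def by auto
  have stv: "st v = st []" using v reduced_J[OF v] by (simp add: st_eq_base_iff)
  have vK: "v \<in> K"
    unfolding K_def using T.trav_generate[of "[]" v C] C reduced_J[OF v] stv by (simp add: C_def)
  have FK: "F\<lparr>carrier := K\<rparr> = G\<lparr>carrier := generate G (T.gam ` C)\<rparr>" by (simp add: K_def)
  have "\<not> primitive_in (F\<lparr>carrier := K\<rparr>) v"
    using np primitive_in_subset_of_basis[OF group_G B CB, of v] unfolding FK by blast
  with subK KJ vK have "enat m \<le> free_rank (F\<lparr>carrier := K\<rparr>)" by (intro min)
  moreover have "free_rank (F\<lparr>carrier := K\<rparr>) = ecard (T.gam ` C)"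
  proof (rule free_rank_eq)
    show "group (F\<lparr>carrier := K\<rparr>)" using subK group_free_group by (rule subgroup.subgroup_is_group)
    show "is_basis (F\<lparr>carrier := K\<rparr>) (T.gam ` C)"
      unfolding FK using group_G B CB by (rule subset_of_basis)
  qed
  moreover have "card (T.gam ` C) = card C"
    using T.inj_on_gam C by (intro card_image) (rule inj_on_subset)
  ultimately have "m \<le> card C" using finite_subset[OF C fin] by (simp add: ecard_def)
  then have CC: "C = T.chords" using C fin card by (metis card_seteq)
  show "card (trav [] v) + 1 = m + card (visited v)"
    using T.card_chords_trav[OF vis] CC card by (simp add: C_def)
  have J: "J = generate F (T.gam ` C)"
    using basis_generate[OF group_G B] group.generate_consistent[OF group_free_group _ sub, of "T.gam ` C"]
      T.gam_chords_J CC by simp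
  have lJ: "loops v \<subseteq> J" by (auto simp: loops_def st_eq_iff)
  then have lF: "loops v \<subseteq> carrier F" using reduced_J by auto
  define L where "L = generate F (loops v)"
  have L: "subgroup L F" unfolding L_def using lF by (rule group.generate_is_subgroup[OF group_free_group])
  have lL: "x \<in> L" if "x \<in> loops v" for x using that by (simp add: L_def generate.incl)
  have Lw: "winv x \<in> L" if "x \<in> L" for x
    using subgroup.m_inv_closed[OF L that] subgroup.subset[OF L] that by (auto simp: inv_free_group)
  have Lm: "reduce (x @ y) \<in> L" if "x \<in> L" "y \<in> L" for x y
    using subgroup.m_closed[OF L that] by simp
  \<comment> \<open>The tree grows along prefixes of \<open>v\<close>. By induction on
    \<open>key\<close>, a tree path therefore differs from any prefix with the same end only by
    loops of \<open>v\<close>.\<close>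
  have tauL: "reduce (T.tau (st (take i v)) @ winv (take i v)) \<in> L" if "i \<le> length v" for i
    using that
  proof (induction "key (st (take i v))" arbitrary: i rule: less_induct)
    case less
    show ?case
    proof (cases "st (take i v) = st []")
      case True
      have "reduce (take 0 v @ winv (take i v)) \<in> loops v"
        unfolding loops_def using True less.prems by (intro CollectI exI[of _ 0] exI[of _ i]) simp
      with True lL show ?thesis by simp
    next
      case False
      let ?q = "st (take i v)"
      have q: "?q \<in> visited v" using less.prems by (auto simp: visited_def)
      from vis[OF q False] obtain j where j: "j < length v" "par ?q = (st (take j v), v ! j)"
        "st (take (Suc j) v) = ?q" by auto
      have "key (st (take j v)) < key ?q" using T.par_key[OF _ False] j(2) by simp
      then have 1: "reduce (T.tau (st (take j v)) @ winv (take j v)) \<in> L"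
        using j(1) by (intro less.hyps) auto
      have "reduce (take (Suc j) v @ winv (take i v)) \<in> loops v"
        unfolding loops_def using j less.prems by (intro CollectI exI[of _ "Suc j"] exI[of _ i]) simp
      from Lm[OF 1 lL[OF this]]
      have "reduce (T.tau (st (take j v)) @ winv (take j v) @ take j v @ [v ! j] @ winv (take i v)) \<in> L"
        using j(1) by (simp add: take_Suc_conv_app_nth del: reduce_mid_cancel)
      then have "reduce (T.tau (st (take j v)) @ [v ! j] @ winv (take i v)) \<in> L"
        by (subst (asm) reduce_mid_cancel)
      then show ?thesis using T.tau_step[OF _ False] j(2) by simp
    qed
  qed
  have "T.gam ` C \<subseteq> L"
  proof
    fix x assume "x \<in> T.gam ` C"
    then obtain i where i: "i < length v" "x = T.gam (edge (take i v) (v ! i))"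
      unfolding C_def using trav_conv_nth[of "[]" v] by auto
    have "reduce (reduce (T.tau (st (take i v)) @ winv (take i v)) @
        winv (reduce (T.tau (st (take (Suc i) v)) @ winv (take (Suc i) v)))) \<in> L"
      using i(1) by (intro Lm Lw tauL) auto
    then have "reduce (T.tau (st (take i v)) @ winv (take i v) @ take i v @ [v ! i] @
        winv (T.tau (st (take (Suc i) v)))) \<in> L"
      using i(1) by (simp add: take_Suc_conv_app_nth flip: reduce_winv del: reduce_mid_cancel)
    then have "reduce (T.tau (st (take i v)) @ [v ! i] @ winv (T.tau (st (take (Suc i) v)))) \<in> L"
      by (subst (asm) reduce_mid_cancel)
    then have "T.step (take i v) (v ! i) \<in> L"
      using i(1) by (simp add: T.step_def take_Suc_conv_app_nth)
    with Lw show "x \<in> L" unfolding i(2) T.gam_edge by simp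
  qed
  then have "J \<subseteq> L" by (intro ord_eq_le_trans[OF J] group.generate_subgroup_incl[OF group_free_group _ L])
  moreover have "L \<subseteq> J" unfolding L_def
    by (rule group.generate_subgroup_incl[OF group_free_group lJ sub])
  ultimately show "J = generate F (loops v)" by (simp add: L_def)
qed

end

section \<open>Explorations of finite graphs\<close>

text \<open>An exploration records, newest step first, the letters read and the names of the vertices
  reached.  The name of a vertex is the time of its first visit.\<close>

type_synonym 'x exploration = "(('x \<times> bool) \<times> nat) list"

fun pos :: "'x exploration \<Rightarrow> nat" where
  "pos [] = 0"
| "pos ((d, c) # z) = c"

text \<open>Each edge is stored in both orientations, so that the degree of a vertex, with loops
  counted twice, is the number of darts leaving it.\<close>

fun darts :: "'x exploration \<Rightarrow> (nat \<times> ('x \<times> bool) \<times> nat) set" where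
  "darts [] = {}"
| "darts ((d, c) # z) = insert (pos z, d, c) (insert (c, inv_letter d, pos z) (darts z))"

definition names :: "'x exploration \<Rightarrow> nat set" where
  "names z = insert 0 (snd ` set z)"

definition lab :: "'x exploration \<Rightarrow> ('x \<times> bool) list" where
  "lab z = rev (map fst z)"

definition deg :: "'x exploration \<Rightarrow> nat \<Rightarrow> nat" where
  "deg z x = card (darts z `` {x})"

text \<open>The negated conjuncts keep the labelling deterministic in both directions.\<close>

definition nstep :: "'x exploration \<Rightarrow> 'x \<times> bool \<Rightarrow> nat \<Rightarrow> bool" where
  "nstep z d c \<longleftrightarrow> reduced (lab z @ [d]) \<and>
     ((pos z, d, c) \<in> darts z \<or>
      (\<forall>c'. (pos z, d, c') \<notin> darts z) \<and>
      (c = Suc (length z) \<or> c \<in> names z \<and> (\<forall>c'. (c, inv_letter d, c') \<notin> darts z)))"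

text \<open>Counts the steps that close a cycle, hence the rank of the graph explored so far: a new
  edge either closes a cycle or adds a vertex.\<close>

fun rk :: "'x exploration \<Rightarrow> nat" where
  "rk [] = 0"
| "rk ((d, c) # z) = rk z + (if (pos z, d, c) \<notin> darts z \<and> c \<in> names z then 1 else 0)"

fun fresh_count :: "'x exploration \<Rightarrow> nat" where
  "fresh_count [] = 0"
| "fresh_count ((d, c) # z) = fresh_count z + (if (pos z, d, c) \<notin> darts z \<and> c \<notin> names z then 1 else 0)"

fun valid :: "'x exploration \<Rightarrow> bool" where
  "valid [] = True"
| "valid ((d, c) # z) \<longleftrightarrow> valid z \<and> nstep z d c"

lemma lab_Nil [simp]: "lab [] = []"
  and lab_Cons [simp]: "lab (s # z) = lab z @ [fst s]"
  and length_lab [simp]: "length (lab z) = length z"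
  by (simp_all add: lab_def)

lemma names_Nil [simp]: "names [] = {0}"
  and names_Cons [simp]: "names (s # z) = insert (snd s) (names z)"
  and finite_names [simp]: "finite (names z)"
  and zero_names [simp]: "0 \<in> names z"
  by (auto simp: names_def)

lemma pos_names [simp]: "pos z \<in> names z"
  by (cases z rule: pos.cases) auto

lemma finite_darts [simp]: "finite (darts z)"
  by (induction z rule: darts.induct) auto

lemma darts_sym: "(x, d, y) \<in> darts z \<Longrightarrow> (y, inv_letter d, x) \<in> darts z"
  by (induction z rule: darts.induct) auto

lemma darts_names: "(x, d, y) \<in> darts z \<Longrightarrow> x \<in> names z \<and> y \<in> names z"
  by (induction z rule: darts.induct) auto

lemma arrival_dart: "z \<noteq> [] \<Longrightarrow> (pos z, inv_letter (fst (hd z)), pos (tl z)) \<in> darts z"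
  by (cases z rule: darts.cases) auto

lemma start_dart: "z \<noteq> [] \<Longrightarrow> darts z `` {0} \<noteq> {}"
proof (induction z rule: darts.induct)
  case (2 d c z)
  show ?case
  proof (cases "z = []")
    case True
    then have "(d, c) \<in> darts ((d, c) # z) `` {0}" by simp
    then show ?thesis by blast
  next
    case False
    moreover have "darts z `` {0} \<subseteq> darts ((d, c) # z) `` {0}" by auto
    ultimately show ?thesis using 2 by blast
  qed
qed auto

lemma valid_names_le: "valid z \<Longrightarrow> c \<in> names z \<Longrightarrow> c \<le> length z"
proof (induction z arbitrary: c rule: darts.induct)
  case (2 d c z c')
  show ?case
  proof (cases "c' \<in> names z")
    case True
    then have "c' \<le> length z" using 2 by simp
    then show ?thesis by simp
  next
    case False
    then have "c' = c" "nstep z d c" using 2 by auto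
    then have "c' = Suc (length z)" using darts_names[of "pos z" d c z] False by (auto simp: nstep_def)
    then show ?thesis by simp
  qed
qed auto

lemma nstep_fresh: "valid z \<Longrightarrow> nstep z d c \<Longrightarrow> c \<notin> names z \<Longrightarrow> c = Suc (length z)"
  using darts_names[of "pos z" d c z] by (auto simp: nstep_def)

lemma card_darts: "valid z \<Longrightarrow> card (darts z) = 2 * (fresh_count z + rk z)"
proof (induction z rule: darts.induct)
  case (2 d c z)
  show ?case
  proof (cases "(pos z, d, c) \<in> darts z")
    case True
    then have "darts ((d, c) # z) = darts z" using darts_sym[OF True] by auto
    then show ?thesis using True 2 by simp
  next
    case False
    then have "(c, inv_letter d, pos z) \<notin> darts z"
      using darts_sym[of c "inv_letter d" "pos z" z] by auto
    moreover have "(pos z, d, c) \<noteq> (c, inv_letter d, pos z)" by auto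
    ultimately have "card (darts ((d, c) # z)) = 2 + card (darts z)" using False by auto
    then show ?thesis using False 2 by auto
  qed
qed auto

lemma card_names: "card (names z) = Suc (fresh_count z)"
proof (induction z rule: darts.induct)
  case (2 d c z)
  then show ?case using darts_names[of "pos z" d c z] by (auto simp: insert_absorb)
qed auto

section \<open>Degrees in an exploration\<close>

lemma sum_deg: "sum (deg z) (names z) = card (darts z)"
proof -
  have "darts z = Sigma (names z) (\<lambda>x. darts z `` {x})" using darts_names by fastforce
  moreover have "card (Sigma (names z) (\<lambda>x. darts z `` {x})) = (\<Sum>x\<in>names z. deg z x)"
    unfolding deg_def by (intro card_SigmaI) (auto intro: finite_Image)
  ultimately show ?thesis by simp
qed

lemma deg_mono: "deg z x \<le> deg (s # z) x"
  unfolding deg_def by (intro card_mono finite_Image) (cases s; auto)+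

lemma two_le_deg: "{a, b} \<subseteq> darts z `` {x} \<Longrightarrow> a \<noteq> b \<Longrightarrow> 2 \<le> deg z x"
  unfolding deg_def using card_mono[of "darts z `` {x}" "{a, b}"] by (simp add: finite_Image)

text \<open>A walk without backtracking leaves a vertex by a dart other than the reverse of its
  arrival. The start may lack an arrival and the current vertex a departure, hence the two
  exceptions.\<close>

lemma inner_deg: "valid z \<Longrightarrow> x \<in> names z \<Longrightarrow> x \<noteq> 0 \<Longrightarrow> x \<noteq> pos z \<Longrightarrow> 2 \<le> deg z x"
proof (induction z arbitrary: x rule: darts.induct)
  case (2 d c z x)
  show ?case
  proof (cases "x = pos z")
    case False
    then have "2 \<le> deg z x" using 2 by auto
    then show ?thesis using deg_mono order_trans by blast
  next
    case True
    then have "z \<noteq> []" using 2 by auto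
    then have last: "last (lab z) = fst (hd z)" and ne: "lab z \<noteq> []" by (cases z; simp)+
    have "d \<noteq> inv_letter (fst (hd z))" using 2(2) last ne by (auto simp: nstep_def reduced_append)
    moreover have "(inv_letter (fst (hd z)), pos (tl z)) \<in> darts ((d, c) # z) `` {x}"
      using arrival_dart[OF \<open>z \<noteq> []\<close>] True by auto
    moreover have "(d, c) \<in> darts ((d, c) # z) `` {x}" using True by auto
    ultimately show ?thesis
      by (intro two_le_deg[of "(d, c)" "(inv_letter (fst (hd z)), pos (tl z))"]) auto
  qed
qed auto

text \<open>There are \<open>fresh_count z + 1\<close> vertices and the degrees add up to
  \<open>2 * (fresh_count z + rk z)\<close>. Setting aside 2 for each vertex but the current one
  leaves \<open>2 * rk z\<close>.\<close>

lemma deg_pos_le: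
  assumes "valid z" "pos z = 0 \<or> 2 \<le> deg z 0"
  shows "deg z (pos z) \<le> 2 * rk z"
proof -
  have arith: "a + S = 2 * (n + r) \<Longrightarrow> 2 * n \<le> S \<Longrightarrow> a \<le> 2 * r" for a S n r :: nat by presburger
  have s: "deg z (pos z) + sum (deg z) (names z - {pos z}) = 2 * (fresh_count z + rk z)"
    using sum.remove[of "names z" "pos z" "deg z"] sum_deg[of z] card_darts[OF assms(1)] by simp
  have "(\<Sum>x\<in>names z - {pos z}. 2) \<le> sum (deg z) (names z - {pos z})"
    using inner_deg[OF assms(1)] assms(2) by (intro sum_mono) auto
  then have "2 * fresh_count z \<le> sum (deg z) (names z - {pos z})" by (simp add: card_names)
  with s show ?thesis by (rule arith)
qed

text \<open>Here the start may be a leaf; it is credited with degree 1 only, and the bound grows by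
  one.\<close>

lemma deg_pos_le_Suc:
  assumes "valid z"
  shows "deg z (pos z) \<le> 2 * rk z + 1"
proof (cases "pos z = 0")
  case True
  then show ?thesis using deg_pos_le[OF assms] by simp
next
  case False
  have arith: "2 * (n - 1) \<le> S \<Longrightarrow> 1 \<le> b \<Longrightarrow> a + (b + S) = 2 * (n + r) \<Longrightarrow> a \<le> 2 * r + 1"
    for a b S n r :: nat by (cases n) simp_all
  have "z \<noteq> []" using False by auto
  have s: "deg z (pos z) + (deg z 0 + sum (deg z) (names z - {pos z} - {0})) = 2 * (fresh_count z + rk z)"
    using sum.remove[of "names z" "pos z" "deg z"] sum.remove[of "names z - {pos z}" 0 "deg z"]
      sum_deg[of z] card_darts[OF assms] False by simp
  have "(\<Sum>x\<in>names z - {pos z} - {0}. 2) \<le> sum (deg z) (names z - {pos z} - {0})"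
    using inner_deg[OF assms] by (intro sum_mono) auto
  then have "2 * (fresh_count z - 1) \<le> sum (deg z) (names z - {pos z} - {0})"
    using False by (simp add: card_names)
  moreover have "1 \<le> deg z 0"
    using start_dart[OF \<open>z \<noteq> []\<close>] unfolding deg_def by (simp add: Suc_le_eq card_gt_0_iff finite_Image)
  ultimately show ?thesis using s by (rule arith)
qed

definition known_steps :: "'x exploration \<Rightarrow> (('x \<times> bool) \<times> nat) set" where
  "known_steps z = {(d, c). nstep z d c \<and> (pos z, d, c) \<in> darts z}"

lemma finite_known_steps: "finite (known_steps z)"
  by (rule finite_subset[of _ "darts z `` {pos z}"]) (auto simp: known_steps_def finite_Image)

text \<open>One dart at the current vertex is the way back, which reducedness forbids. A start of
  degree one costs one more, but there is room for it while the rank is below \<open>m\<close>, and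
  at rank \<open>m\<close> the degree condition excludes it.\<close>

lemma card_known_steps:
  assumes "valid z" "1 \<le> m" "rk z \<le> m" "rk z = m \<Longrightarrow> 2 \<le> deg z 0"
  shows "card (known_steps z) \<le> 2 * m - 1"
proof (cases "z = []")
  case True
  then show ?thesis by (simp add: known_steps_def)
next
  case False
  then have last: "last (lab z) = fst (hd z)" and ne: "lab z \<noteq> []" by (cases z; simp)+
  let ?b = "(inv_letter (fst (hd z)), pos (tl z))"
  have b: "?b \<in> darts z `` {pos z}" using arrival_dart[OF False] by auto
  have "known_steps z \<subseteq> darts z `` {pos z} - {?b}"
    using last ne by (auto simp: known_steps_def nstep_def reduced_append)
  then have "card (known_steps z) \<le> card (darts z `` {pos z} - {?b})"
    by (intro card_mono) (auto simp: finite_Image)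
  also have "\<dots> = deg z (pos z) - 1" using b by (simp add: deg_def finite_Image)
  finally have "card (known_steps z) \<le> deg z (pos z) - 1" .
  moreover have "deg z (pos z) \<le> 2 * m"
  proof (cases "rk z = m")
    case True
    then show ?thesis using deg_pos_le[OF assms(1)] assms(4) by auto
  next
    case False
    then show ?thesis using deg_pos_le_Suc[OF assms(1)] assms(3) by linarith
  qed
  ultimately show ?thesis by linarith
qed

text \<open>A run of steps to new vertices can only be left by closing a cycle.\<close>

definition fresh_end :: "'x exploration \<Rightarrow> bool" where
  "fresh_end z \<longleftrightarrow> (\<forall>d c. nstep z d c \<longrightarrow> (pos z, d, c) \<notin> darts z)"

text \<open>The only dart at a vertex just created is the reverse of the arrival, and reducedness
  forbids it.\<close>

lemma fresh_end_new:
  assumes "c \<notin> names z"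
  shows "fresh_end ((d, c) # z)"
  unfolding fresh_end_def
proof (intro allI impI notI)
  fix d' c' assume n: "nstep ((d, c) # z) d' c'" and "(pos ((d, c) # z), d', c') \<in> darts ((d, c) # z)"
  moreover have "c \<noteq> pos z" using assms by auto
  moreover have "(c, d', c') \<notin> darts z" using assms darts_names by blast
  ultimately have "d' = inv_letter d" by auto
  with n show False by (auto simp: nstep_def reduced_append reduced_Cons)
qed

definition next_letters :: "(('x \<times> bool) list \<Rightarrow> bool) \<Rightarrow> ('x \<times> bool) list \<Rightarrow> ('x \<times> bool) set" where
  "next_letters P u = {d. reduced (u @ [d]) \<and> P (u @ [d])}"

text \<open>A weighted sum over reduced extensions of \<open>u\<close>, in the recursive form that
  matches an exploration which keeps discovering new vertices.\<close>

fun wsum :: "(('x \<times> bool) list \<Rightarrow> bool) \<Rightarrow> ('x \<times> bool \<Rightarrow> real) \<Rightarrow> ('x \<times> bool) list \<Rightarrow> nat \<Rightarrow> real" where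
  "wsum P f u 0 = 1"
| "wsum P f u (Suc l) = (\<Sum>d\<in>next_letters P u. f d * wsum P f (u @ [d]) l)"

section \<open>Weighted counting of explorations\<close>

text \<open>\<open>P\<close> stands for labelling a path from a fixed vertex. The last assumption is
  the analytic input: runs of new edges of any given length have total weight at most
  \<open>K\<close>.\<close>

locale weighted_exploration =
  fixes P :: "('x \<times> bool) list \<Rightarrow> bool" and f :: "'x \<times> bool \<Rightarrow> real"
    and L :: "('x \<times> bool) set" and m :: nat and K :: real
  assumes finite_L: "finite L" and P_L: "P (u @ [d]) \<Longrightarrow> d \<in> L" and P_Nil: "P []"
    and f_nonneg: "f d \<ge> 0" and f_le: "f d \<le> 1"
    and m: "1 \<le> m" and K: "1 \<le> K"
    and wsum_le: "P u \<Longrightarrow> reduced u \<Longrightarrow> wsum P f u l \<le> K"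
begin

text \<open>The condition on the start is built in because a closed, cyclically reduced word adds no
  edge once the rank is \<open>m\<close>: by then the start has its final degree, which is at least
  2.\<close>

definition steps :: "'x exploration \<Rightarrow> (('x \<times> bool) \<times> nat) set" where
  "steps z = {(d, c). d \<in> next_letters P (lab z) \<and> nstep z d c \<and> rk ((d, c) # z) \<le> m \<and>
     (rk ((d, c) # z) = m \<longrightarrow> 2 \<le> deg ((d, c) # z) 0)}"

definition wt :: "'x exploration \<Rightarrow> ('x \<times> bool) \<times> nat \<Rightarrow> real" where
  "wt z s = (if (pos z, fst s, snd s) \<in> darts z then 1 else f (fst s))"

fun good :: "'x exploration \<Rightarrow> bool" where
  "good [] = True"
| "good (s # z) \<longleftrightarrow> good z \<and> s \<in> steps z"

fun weight :: "'x exploration \<Rightarrow> real" where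
  "weight [] = 1"
| "weight (s # z) = weight z * wt z s"

fun future_weight :: "nat \<Rightarrow> 'x exploration \<Rightarrow> real" where
  "future_weight 0 z = 1"
| "future_weight (Suc n) z = (\<Sum>s\<in>steps z. wt z s * future_weight n (s # z))"

lemma next_letters_L: "next_letters P u \<subseteq> L"
  by (auto simp: next_letters_def dest: P_L)

lemma finite_nx [simp]: "finite (next_letters P u)"
  using next_letters_L finite_L by (rule finite_subset)

lemma good_valid: "good z \<Longrightarrow> valid z"
  by (induction z rule: valid.induct) (auto simp: steps_def)

lemma good_lab: "good z \<Longrightarrow> P (lab z) \<and> reduced (lab z)"
  by (induction z) (auto simp: steps_def next_letters_def P_Nil)

lemma good_rk: "good z \<Longrightarrow> rk z \<le> m" "good z \<Longrightarrow> rk z = m \<Longrightarrow> 2 \<le> deg z 0"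
  using m by (cases z; auto simp: steps_def)+

lemma steps_subset: "good z \<Longrightarrow> steps z \<subseteq> L \<times> {..Suc (length z)}"
proof safe
  fix d :: 'x and b c assume z: "good z" and s: "((d, b), c) \<in> steps z"
  then show "(d, b) \<in> L" using next_letters_L by (auto simp: steps_def)
  have "valid (((d, b), c) # z)" using z s good_valid by (auto simp: steps_def)
  from valid_names_le[OF this, of c] show "c \<le> Suc (length z)" by simp
qed

lemma finite_steps: "good z \<Longrightarrow> finite (steps z)"
  by (rule finite_subset[OF steps_subset]) (simp_all add: finite_L)

lemma wt_nonneg: "0 \<le> wt z s"
  by (simp add: wt_def f_nonneg)

lemma wt_le: "wt z s \<le> 1"
  by (simp add: wt_def f_le)

lemma future_weight_nonneg: "0 \<le> future_weight n z"
  by (induction n arbitrary: z) (auto intro!: sum_nonneg mult_nonneg_nonneg wt_nonneg)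

lemma wsum_nonneg: "0 \<le> wsum P f u l"
  by (induction l arbitrary: u) (auto intro!: sum_nonneg mult_nonneg_nonneg f_nonneg)

definition states :: "nat \<Rightarrow> 'x exploration set" where
  "states n = {z. good z \<and> length z = n}"

lemma states_0: "states 0 = {[]}"
  by (auto simp: states_def)

lemma states_Suc: "states (Suc n) = (\<lambda>(z, s). s # z) ` Sigma (states n) steps"
  by (auto simp: states_def image_iff length_Suc_conv)

lemma finite_states: "finite (states n)"
proof (induction n)
  case (Suc n)
  then show ?case
    unfolding states_Suc by (intro finite_imageI finite_SigmaI) (auto simp: states_def intro: finite_steps)
qed (simp add: states_0)

lemma sum_states_W: "(\<Sum>z\<in>states n. weight z * future_weight k z) = future_weight (n + k) []"
proof (induction n arbitrary: k)
  case (Suc n)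
  have "(\<Sum>z\<in>states (Suc n). weight z * future_weight k z) =
      (\<Sum>(z, s)\<in>Sigma (states n) steps. weight (s # z) * future_weight k (s # z))"
    unfolding states_Suc by (subst sum.reindex) (auto simp: inj_on_def case_prod_unfold)
  also have "\<dots> = (\<Sum>z\<in>states n. \<Sum>s\<in>steps z. weight (s # z) * future_weight k (s # z))"
    by (rule sum.Sigma[symmetric]) (rule finite_states, auto simp: states_def intro: finite_steps)
  also have "\<dots> = (\<Sum>z\<in>states n. weight z * future_weight (Suc k) z)"
    by (simp add: sum_distrib_left mult_ac)
  finally show ?case using Suc[of "Suc k"] by simp
qed (simp add: states_0)

lemma sum_weight_states: "(\<Sum>z\<in>states n. weight z) = future_weight n []"
  using sum_states_W[where n = n and k = 0] by simp

definition new_steps :: "'x exploration \<Rightarrow> (('x \<times> bool) \<times> nat) set" where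
  "new_steps z = {s \<in> steps z. (pos z, fst s, snd s) \<notin> darts z}"

definition beta :: real where
  "beta = 2 * real m - 1"

lemma beta: "1 \<le> beta"
  using m by (simp add: beta_def)

text \<open>The ways to close a cycle up to time \<open>s\<close>: a letter and one of at most
  \<open>s + 1\<close> vertex names.\<close>

definition closing_bound :: "nat \<Rightarrow> real" where
  "closing_bound s = real (card L) * (real s + 1)"

lemma closing_bound_nonneg: "0 \<le> closing_bound s"
  by (simp add: closing_bound_def)

text \<open>One stage of the induction on the missing rank: \<open>Q\<close> bounds the
  continuations after the next cycle has been closed.\<close>

context
  fixes s r :: nat and Q :: real
  assumes Q: "0 \<le> Q"
    and hyp: "\<And>n z. good z \<Longrightarrow> rk z = Suc r \<Longrightarrow> length z + n \<le> s \<Longrightarrow> future_weight n z \<le> Q * beta ^ n"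
begin

definition fresh_bound_factor :: "nat \<Rightarrow> real" where
  "fresh_bound_factor n = 1 + closing_bound s * Q * beta ^ n"

lemma fresh_bound_factor_mono: "fresh_bound_factor n \<le> fresh_bound_factor (Suc n)"
  unfolding fresh_bound_factor_def using beta Q closing_bound_nonneg by (intro add_left_mono mult_left_mono power_increasing) auto

lemma fresh_bound_factor_ge: "1 \<le> fresh_bound_factor n"
  unfolding fresh_bound_factor_def using beta Q closing_bound_nonneg by simp

text \<open>A new edge leads to a new vertex, where its weight lengthens the sums
  \<open>wsum\<close> by a letter, or it closes a cycle, where the bound \<open>Q\<close> of the
  next stage takes over. Closing a cycle at once accounts for the term \<open>l = 0\<close>.\<close>

lemma new_steps_bound:
  assumes z: "good z" "rk z = r" "length z + Suc n \<le> s"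
    and fresh: "\<And>z'. good z' \<Longrightarrow> rk z' = r \<Longrightarrow> length z' + n \<le> s \<Longrightarrow> fresh_end z' \<Longrightarrow>
      future_weight n z' \<le> (\<Sum>l\<le>n. wsum P f (lab z') l) * fresh_bound_factor n"
  shows "(\<Sum>t\<in>new_steps z. wt z t * future_weight n (t # z)) \<le> (\<Sum>l\<le>Suc n. wsum P f (lab z) l) * fresh_bound_factor (Suc n)"
proof -
  let ?B = "{t \<in> new_steps z. snd t \<notin> names z}" and ?C = "{t \<in> new_steps z. snd t \<in> names z}"
  have fin: "finite (new_steps z)" unfolding new_steps_def using finite_steps[OF z(1)] by simp
  have v: "valid z" using z(1) by (rule good_valid)
  have snd_B: "snd t = Suc (length z)" if "t \<in> ?B" for t
    using that nstep_fresh[OF v] by (auto simp: new_steps_def steps_def)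
  have "(\<Sum>t\<in>?B. wt z t * future_weight n (t # z)) \<le> (\<Sum>t\<in>?B. f (fst t) * ((\<Sum>l\<le>n. wsum P f (lab z @ [fst t]) l) * fresh_bound_factor n))"
  proof (rule sum_mono)
    fix t assume t: "t \<in> ?B"
    then obtain d c where tdc: "t = (d, c)" "c \<notin> names z" by (cases t) auto
    have "future_weight n (t # z) \<le> (\<Sum>l\<le>n. wsum P f (lab (t # z)) l) * fresh_bound_factor n"
      using t z tdc fresh_end_new[OF tdc(2), of d] by (intro fresh) (auto simp: new_steps_def)
    moreover have "wt z t = f (fst t)" using t by (simp add: wt_def new_steps_def)
    ultimately show "wt z t * future_weight n (t # z) \<le> f (fst t) * ((\<Sum>l\<le>n. wsum P f (lab z @ [fst t]) l) * fresh_bound_factor n)"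
      using f_nonneg[of "fst t"] by (simp add: mult_left_mono)
  qed
  \<comment> \<open>A new vertex is named by the current time, so a step to it is determined by its
    letter.\<close>
  also have "\<dots> = (\<Sum>d\<in>fst ` ?B. f d * ((\<Sum>l\<le>n. wsum P f (lab z @ [d]) l) * fresh_bound_factor n))"
  proof (subst sum.reindex)
    show "inj_on fst ?B"
    proof (rule inj_onI)
      fix t t' assume t: "t \<in> ?B" "t' \<in> ?B" "fst t = fst t'"
      from snd_B[OF t(1)] snd_B[OF t(2)] t(3) show "t = t'" by (simp add: prod_eq_iff)
    qed
  qed simp
  also have "\<dots> \<le> (\<Sum>d\<in>next_letters P (lab z). f d * ((\<Sum>l\<le>n. wsum P f (lab z @ [d]) l) * fresh_bound_factor n))"
  proof (rule sum_mono2)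
    show "fst ` ?B \<subseteq> next_letters P (lab z)" by (auto simp: new_steps_def steps_def)
    fix d
    have "0 \<le> fresh_bound_factor n" using fresh_bound_factor_ge[of n] by simp
    then show "0 \<le> f d * ((\<Sum>l\<le>n. wsum P f (lab z @ [d]) l) * fresh_bound_factor n)"
      by (intro mult_nonneg_nonneg f_nonneg sum_nonneg wsum_nonneg)
  qed simp
  also have "\<dots> = (\<Sum>l\<le>n. wsum P f (lab z) (Suc l)) * fresh_bound_factor n"
    by (simp add: sum_distrib_left sum_distrib_right mult_ac) (rule sum.swap)
  also have "\<dots> \<le> (\<Sum>l\<le>n. wsum P f (lab z) (Suc l)) * fresh_bound_factor (Suc n)"
    by (intro mult_left_mono fresh_bound_factor_mono sum_nonneg wsum_nonneg)
  finally have B: "(\<Sum>t\<in>?B. wt z t * future_weight n (t # z)) \<le> (\<Sum>l\<le>n. wsum P f (lab z) (Suc l)) * fresh_bound_factor (Suc n)" .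
  have "(\<Sum>t\<in>?C. wt z t * future_weight n (t # z)) \<le> (\<Sum>t\<in>?C. Q * beta ^ n)"
  proof (rule sum_mono)
    fix t assume t: "t \<in> ?C"
    then obtain d c where tdc: "t = (d, c)" by (cases t)
    have "future_weight n (t # z) \<le> Q * beta ^ n"
      using t z tdc by (intro hyp) (auto simp: new_steps_def)
    then show "wt z t * future_weight n (t # z) \<le> Q * beta ^ n"
      using mult_mono[OF wt_le[of z t] _ _ future_weight_nonneg[of n "t # z"]] by fastforce
  qed
  also have "\<dots> = real (card ?C) * (Q * beta ^ n)" by simp
  also have "\<dots> \<le> closing_bound s * (Q * beta ^ n)"
  proof (rule mult_right_mono)
    have "?C \<subseteq> L \<times> {..length z}"
      using steps_subset[OF z(1)] valid_names_le[OF v] by (auto simp: new_steps_def subset_iff)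
    then have "card ?C \<le> card (L \<times> {..length z})" using finite_L by (intro card_mono) auto
    also have "\<dots> = card L * Suc (length z)" by (simp add: card_cartesian_product)
    also have "\<dots> \<le> card L * (s + 1)" using z(3) by (intro mult_left_mono) auto
    finally have "real (card ?C) \<le> real (card L * (s + 1))" by (rule of_nat_mono)
    also have "\<dots> = closing_bound s" by (simp only: closing_bound_def of_nat_mult of_nat_add of_nat_1)
    finally show "real (card ?C) \<le> closing_bound s" .
    show "0 \<le> Q * beta ^ n" using Q beta by simp
  qed
  also have "\<dots> \<le> closing_bound s * (Q * beta ^ Suc n)"
    using closing_bound_nonneg Q beta by (intro mult_left_mono power_increasing) auto
  also have "\<dots> \<le> fresh_bound_factor (Suc n)" by (simp add: fresh_bound_factor_def mult_ac)
  finally have C: "(\<Sum>t\<in>?C. wt z t * future_weight n (t # z)) \<le> fresh_bound_factor (Suc n)" .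
  have "(\<Sum>t\<in>new_steps z. wt z t * future_weight n (t # z)) =
      (\<Sum>t\<in>?B. wt z t * future_weight n (t # z)) + (\<Sum>t\<in>?C. wt z t * future_weight n (t # z))"
    using fin by (subst sum.union_disjoint[symmetric]) (auto intro!: sum.cong)
  also have "\<dots> \<le> (1 + (\<Sum>l\<le>n. wsum P f (lab z) (Suc l))) * fresh_bound_factor (Suc n)"
    using B C by (simp add: algebra_simps)
  also have "1 + (\<Sum>l\<le>n. wsum P f (lab z) (Suc l)) = (\<Sum>l\<le>Suc n. wsum P f (lab z) l)"
    by (subst sum.atMost_Suc_shift) simp
  finally show ?thesis .
qed

text \<open>At a new vertex there are no known steps, so a run of new vertices pays only its weights
  until it closes a cycle.\<close>

lemma fresh_bound:
  "good z \<Longrightarrow> rk z = r \<Longrightarrow> length z + n \<le> s \<Longrightarrow> fresh_end z \<Longrightarrow>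
    future_weight n z \<le> (\<Sum>l\<le>n. wsum P f (lab z) l) * fresh_bound_factor n"
proof (induction n arbitrary: z)
  case 0
  then show ?case using fresh_bound_factor_ge[of 0] by simp
next
  case (Suc n)
  have "new_steps z = steps z"
    using Suc.prems(4) by (auto simp: new_steps_def steps_def fresh_end_def)
  then show ?case
    using new_steps_bound[OF Suc.prems(1-3) Suc.IH] by simp
qed

text \<open>Known steps cost a factor \<open>beta\<close> by induction, while the continuations that
  begin with a new edge are estimated at once by \<open>new_steps_bound\<close>. The first new edge
  may come at any time, hence the factor \<open>n + 1\<close>.\<close>

lemma future_weight_bound:
  "good z \<Longrightarrow> rk z = r \<Longrightarrow> length z + n \<le> s \<Longrightarrow>
    future_weight n z \<le> ((real s + 2) * K * (1 + closing_bound s * Q)) * (real n + 1) * beta ^ n"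
proof (induction n arbitrary: z)
  case 0
  have "1 * 1 * 1 \<le> (real s + 2) * K * (1 + closing_bound s * Q)"
    using K Q closing_bound_nonneg by (intro mult_mono) auto
  then show ?case by simp
next
  case (Suc n)
  let ?Y = "(real s + 2) * K * (1 + closing_bound s * Q)"
  have Y: "0 \<le> ?Y" using K Q closing_bound_nonneg by simp
  have v: "valid z" using Suc.prems(1) by (rule good_valid)
  let ?A = "steps z - new_steps z"
  have fin: "finite (steps z)" using Suc.prems(1) by (rule finite_steps)
  have A: "?A \<subseteq> known_steps z" by (auto simp: new_steps_def known_steps_def steps_def)
  have "(\<Sum>t\<in>?A. wt z t * future_weight n (t # z)) \<le> (\<Sum>t\<in>?A. ?Y * (real n + 1) * beta ^ n)"
  proof (rule sum_mono)
    fix t assume t: "t \<in> ?A"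
    then obtain d c where tdc: "t = (d, c)" by (cases t)
    have "future_weight n (t # z) \<le> ?Y * (real n + 1) * beta ^ n"
      using t Suc.prems tdc by (intro Suc.IH) (auto simp: new_steps_def)
    moreover have "wt z t = 1" using t by (auto simp: wt_def new_steps_def)
    ultimately show "wt z t * future_weight n (t # z) \<le> ?Y * (real n + 1) * beta ^ n" by simp
  qed
  also have "\<dots> = real (card ?A) * (?Y * (real n + 1) * beta ^ n)" by simp
  also have "\<dots> \<le> beta * (?Y * (real n + 1) * beta ^ n)"
  proof (rule mult_right_mono)
    have "card ?A \<le> card (known_steps z)" using A finite_known_steps by (rule card_mono[rotated])
    also have "\<dots> \<le> 2 * m - 1"
      using card_known_steps[OF v m] good_rk Suc.prems(1) by blast
    finally show "real (card ?A) \<le> beta" using m by (simp add: beta_def)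
    show "0 \<le> ?Y * (real n + 1) * beta ^ n" using Y beta by simp
  qed
  finally have 1: "(\<Sum>t\<in>?A. wt z t * future_weight n (t # z)) \<le> ?Y * (real n + 1) * beta ^ Suc n"
    by (simp add: mult_ac)
  have "(\<Sum>t\<in>new_steps z. wt z t * future_weight n (t # z)) \<le> (\<Sum>l\<le>Suc n. wsum P f (lab z) l) * fresh_bound_factor (Suc n)"
    using Suc.prems fresh_bound by (intro new_steps_bound) auto
  also have "\<dots> \<le> (\<Sum>l\<le>Suc n. K) * fresh_bound_factor (Suc n)"
    using good_lab[OF Suc.prems(1)] fresh_bound_factor_ge[of "Suc n"] wsum_le by (intro mult_right_mono sum_mono) auto
  also have "\<dots> = (real n + 2) * K * fresh_bound_factor (Suc n)" by simp
  also have "\<dots> \<le> (real s + 2) * K * ((1 + closing_bound s * Q) * beta ^ Suc n)"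
  proof (intro mult_mono)
    show "real n + 2 \<le> real s + 2" using Suc.prems(3) by simp
    have "1 \<le> beta ^ Suc n" using beta by (rule one_le_power)
    then show "fresh_bound_factor (Suc n) \<le> (1 + closing_bound s * Q) * beta ^ Suc n" by (simp add: fresh_bound_factor_def algebra_simps)
  qed (use K fresh_bound_factor_ge[of "Suc n"] in auto)
  finally have 2: "(\<Sum>t\<in>new_steps z. wt z t * future_weight n (t # z)) \<le> ?Y * beta ^ Suc n" by (simp add: mult_ac)
  have "new_steps z \<subseteq> steps z" by (auto simp: new_steps_def)
  then have "future_weight (Suc n) z = (\<Sum>t\<in>?A. wt z t * future_weight n (t # z)) + (\<Sum>t\<in>new_steps z. wt z t * future_weight n (t # z))"
    unfolding future_weight.simps using fin by (rule sum.subset_diff)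
  also have "\<dots> \<le> ?Y * (real n + 1) * beta ^ Suc n + ?Y * beta ^ Suc n" using 1 2 by (rule add_mono)
  also have "\<dots> = ?Y * (real (Suc n) + 1) * beta ^ Suc n" by (simp add: algebra_simps)
  finally show ?case .
qed

lemma future_weight_bound':
  assumes "good z" "rk z = r" "length z + n \<le> s"
  shows "future_weight n z \<le> ((real s + 2)\<^sup>2 * K * (1 + closing_bound s * Q)) * beta ^ n"
proof -
  have "future_weight n z \<le> ((real s + 2) * K * (1 + closing_bound s * Q)) * (real n + 1) * beta ^ n"
    using assms by (rule future_weight_bound)
  also have "\<dots> \<le> ((real s + 2) * K * (1 + closing_bound s * Q)) * (real s + 2) * beta ^ n"
    using assms(3) K Q closing_bound_nonneg beta by (intro mult_right_mono mult_left_mono) auto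
  finally show ?thesis by (simp add: power2_eq_square mult_ac)
qed

end

text \<open>Stage \<open>j\<close> leaves room for \<open>j - 1\<close> further cycles. The value 0
  at stage 0 expresses that no admissible exploration exceeds rank \<open>m\<close>.\<close>

fun poly_bound :: "nat \<Rightarrow> nat \<Rightarrow> real" where
  "poly_bound s 0 = 0"
| "poly_bound s (Suc j) = (real s + 2)\<^sup>2 * K * (1 + closing_bound s * poly_bound s j)"

lemma poly_bound_nonneg: "0 \<le> poly_bound s j"
  using K closing_bound_nonneg by (induction j) auto

lemma future_weight_le_poly_bound:
  "good z \<Longrightarrow> length z + n \<le> s \<Longrightarrow> future_weight n z \<le> poly_bound s (Suc (m - rk z)) * beta ^ n"
proof (induction "m - rk z" arbitrary: z n)
  case 0
  then have "rk z = m" using good_rk(1)[of z] by simp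
  have "future_weight n' z' \<le> 0 * beta ^ n'" if "good z'" "rk z' = Suc m" for n' z'
    using good_rk(1)[OF that(1)] that(2) by simp
  note future_weight_bound'[of 0 m s, OF order_refl this 0(2) \<open>rk z = m\<close> 0(3)]
  then show ?case
    unfolding \<open>rk z = m\<close> diff_self_eq_0 poly_bound.simps mult_zero_right .
next
  case (Suc j)
  have "future_weight n' z' \<le> poly_bound s (m - rk z) * beta ^ n'"
    if "good z'" "rk z' = Suc (rk z)" "length z' + n' \<le> s" for n' z'
  proof -
    have j: "j = m - rk z'" using that(2) Suc.hyps(2) by simp
    have "Suc (m - rk z') = m - rk z" using j Suc.hyps(2) by simp
    with Suc.hyps(1)[OF j that(1,3)] show ?thesis by simp
  qed
  from future_weight_bound'[of "poly_bound s (m - rk z)" "rk z" s, OF poly_bound_nonneg this Suc.prems(1) refl Suc.prems(2)]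
  show ?case by simp
qed

text \<open>The cube has two factors from the length of a stage and one from the place where its
  cycle is closed.\<close>

lemma poly_bound_le: "poly_bound s j \<le> ((real s + 2) ^ 3 * (K * (1 + real (card L)))) ^ j"
proof (induction j)
  case (Suc j)
  let ?H = "(real s + 2) ^ 3 * (K * (1 + real (card L)))"
  have "1 * (1 * 1) \<le> ?H" using K by (intro mult_mono one_le_power) auto
  then have H: "1 \<le> ?H ^ j" by (intro one_le_power) simp
  have "1 + real (card L) * (real s + 1) * poly_bound s j \<le>
      (real s + 2) * ?H ^ j + real (card L) * (real s + 2) * ?H ^ j"
    using Suc H poly_bound_nonneg K by (intro add_mono mult_mono) (auto intro: order_trans[OF H] mult_mono[of 1 _ "?H ^ j" "?H ^ j", simplified])
  also have "\<dots> = (real s + 2) * (1 + real (card L)) * ?H ^ j" by (simp add: algebra_simps)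
  finally have "1 + closing_bound s * poly_bound s j \<le> (real s + 2) * (1 + real (card L)) * ?H ^ j"
    by (simp add: closing_bound_def)
  then have "poly_bound s (Suc j) \<le> (real s + 2)\<^sup>2 * K * ((real s + 2) * (1 + real (card L)) * ?H ^ j)"
    using K by (simp add: mult_left_mono)
  also have "\<dots> = ?H ^ Suc j" by (simp add: power2_eq_square power3_eq_cube mult_ac)
  finally show ?case .
qed simp

theorem sum_weight_states_le:
  "(\<Sum>z\<in>states n. weight z) \<le> ((real n + 2) ^ 3 * (K * (1 + real (card L)))) ^ Suc m * (2 * real m - 1) ^ n"
proof -
  have "(\<Sum>z\<in>states n. weight z) \<le> poly_bound n (Suc m) * beta ^ n"
    unfolding sum_weight_states using future_weight_le_poly_bound[of "[]" n n] by simp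
  also have "\<dots> \<le> ((real n + 2) ^ 3 * (K * (1 + real (card L)))) ^ Suc m * beta ^ n"
    using beta by (intro mult_right_mono poly_bound_le) simp
  finally show ?thesis by (simp add: beta_def)
qed

end

section \<open>Critical subgroups\<close>

text \<open>Minimality is asked among the subgroups of \<open>J\<close>, where it forces the path of
  \<open>v\<close> to fill the graph, and the alphabet is no longer mentioned.\<close>

definition crit_pair :: "nat \<Rightarrow> ('x \<times> bool) list \<Rightarrow> ('x \<times> bool) list set \<Rightarrow> bool" where
  "crit_pair m v J \<longleftrightarrow> subgroup J (free_group UNIV) \<and> v \<in> J \<and>
     \<not> primitive_in (free_group UNIV\<lparr>carrier := J\<rparr>) v \<and>
     free_rank (free_group UNIV\<lparr>carrier := J\<rparr>) = enat m \<and>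
     (\<forall>K. subgroup K (free_group UNIV) \<longrightarrow> K \<subseteq> J \<longrightarrow> v \<in> K \<longrightarrow>
        \<not> primitive_in (free_group UNIV\<lparr>carrier := K\<rparr>) v \<longrightarrow>
        enat m \<le> free_rank (free_group UNIV\<lparr>carrier := K\<rparr>))"

section \<open>Explorations of Schreier graphs\<close>

context free_subgroup
begin

definition first_visit :: "('x \<times> bool) list \<Rightarrow> ('x \<times> bool) list set \<Rightarrow> nat" where
  "first_visit v q = (LEAST j. st (take j v) = q)"

definition name_at :: "('x \<times> bool) list \<Rightarrow> nat \<Rightarrow> nat" where
  "name_at v i = first_visit v (st (take i v))"

fun enc :: "('x \<times> bool) list \<Rightarrow> nat \<Rightarrow> 'x exploration" where
  "enc v 0 = []"
| "enc v (Suc k) = (v ! k, name_at v (Suc k)) # enc v k"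

lemma st_name_at [simp]: "st (take (name_at v i) v) = st (take i v)"
  unfolding name_at_def first_visit_def by (rule LeastI) (rule refl)

lemma name_at_le: "name_at v i \<le> i"
  unfolding name_at_def first_visit_def by (rule Least_le) (rule refl)

lemma name_at_cong: "st (take i v) = st (take j v) \<Longrightarrow> name_at v i = name_at v j"
  by (simp add: name_at_def)

lemma name_at_eq_iff: "name_at v i = name_at v j \<longleftrightarrow> st (take i v) = st (take j v)"
  using st_name_at[of v i] st_name_at[of v j] name_at_cong by metis

lemma name_at_0 [simp]: "name_at v 0 = 0"
  using name_at_le[of v 0] by simp

lemma name_at_name_at [simp]: "name_at v (name_at v i) = name_at v i"
  by (rule name_at_cong) simp

lemma length_enc [simp]: "length (enc v k) = k"
  by (induction k) auto

lemma pos_enc [simp]: "pos (enc v k) = name_at v k"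
  by (cases k) auto

lemma names_enc: "names (enc v k) = name_at v ` {..k}"
  by (induction k) (auto simp: atMost_Suc)

lemma lab_enc: "k \<le> length v \<Longrightarrow> lab (enc v k) = take k v"
  by (induction k) (auto simp: take_Suc_conv_app_nth)

lemma darts_enc:
  "darts (enc v k) = (\<Union>i<k. {(name_at v i, v ! i, name_at v (Suc i)), (name_at v (Suc i), inv_letter (v ! i), name_at v i)})"
  by (induction k) (auto simp: lessThan_Suc)

lemma st_Suc: "i < length v \<Longrightarrow> st (take (Suc i) v) = st (take i v @ [v ! i])"
  by (simp add: take_Suc_conv_app_nth)

lemma st_Suc_inv: "i < length v \<Longrightarrow> st (take (Suc i) v @ [inv_letter (v ! i)]) = st (take i v)"
  by (simp add: take_Suc_conv_app_nth)

lemma darts_encD: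
  assumes "(x, d, y) \<in> darts (enc v k)" "k \<le> length v"
  shows "st (take y v) = st (take x v @ [d])" "name_at v x = x" "name_at v y = y"
proof -
  from assms(1) obtain i where i: "i < k"
    and "(x, d, y) = (name_at v i, v ! i, name_at v (Suc i)) \<or> (x, d, y) = (name_at v (Suc i), inv_letter (v ! i), name_at v i)"
    unfolding darts_enc by auto
  then consider "x = name_at v i" "d = v ! i" "y = name_at v (Suc i)"
    | "x = name_at v (Suc i)" "d = inv_letter (v ! i)" "y = name_at v i" by auto
  then have "st (take y v) = st (take x v @ [d]) \<and> name_at v x = x \<and> name_at v y = y"
  proof cases
    case 1
    have "st (take x v @ [d]) = st (take i v @ [v ! i])" unfolding 1 by (rule st_append_cong) simp
    then show ?thesis using st_Suc[of i v] i assms(2) by (simp add: 1)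
  next
    case 2
    have "st (take x v @ [d]) = st (take (Suc i) v @ [inv_letter (v ! i)])"
      unfolding 2 by (rule st_append_cong) simp
    then show ?thesis using st_Suc_inv[of i v] i assms(2) by (simp add: 2)
  qed
  then show "st (take y v) = st (take x v @ [d])" "name_at v x = x" "name_at v y = y" by auto
qed

abbreviation known :: "('x \<times> bool) list \<Rightarrow> nat \<Rightarrow> bool" where
  "known v k \<equiv> (name_at v k, v ! k, name_at v (Suc k)) \<in> darts (enc v k)"

text \<open>Darts between names and edges of the Schreier graph determine each other, so the
  exploration meets an unknown dart exactly when \<open>v\<close> crosses an edge for the first
  time.\<close>

lemma known_iff:
  assumes k: "k < length v"
  shows "known v k \<longleftrightarrow> edge (take k v) (v ! k) \<in> trav [] (take k v)"
proof -
  have tr: "trav [] (take k v) = (\<lambda>i. edge (take i v) (v ! i)) ` {..<k}"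
    using trav_conv_nth[of "[]" "take k v"] k by (auto simp: min_def)
  show ?thesis
  proof
    assume "known v k"
    then obtain i where i: "i < k" and
      "name_at v k = name_at v i \<and> v ! k = v ! i \<or> name_at v k = name_at v (Suc i) \<and> v ! k = inv_letter (v ! i)"
      unfolding darts_enc by auto
    then consider "st (take k v) = st (take i v)" "v ! k = v ! i"
      | "st (take k v) = st (take (Suc i) v)" "v ! k = inv_letter (v ! i)"
      by (auto simp: name_at_eq_iff)
    then have "edge (take k v) (v ! k) = edge (take i v) (v ! i)"
    proof cases
      case 1
      then show ?thesis using edge_cong[OF 1(1)] by simp
    next
      case 2
      then show ?thesis
        using edge_cong[OF 2(1)] i k edge_inv_letter[of "take i v" "v ! i"]
        by (simp add: take_Suc_conv_app_nth)
    qed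
    then show "edge (take k v) (v ! k) \<in> trav [] (take k v)" unfolding tr using i by auto
  next
    assume "edge (take k v) (v ! k) \<in> trav [] (take k v)"
    then obtain i where i: "i < k" "edge (take k v) (v ! k) = edge (take i v) (v ! i)"
      unfolding tr by auto
    have il: "i < length v" using i(1) k by simp
    from edge_eqD[OF i(2)] consider
        "name_at v k = name_at v i" "name_at v (Suc k) = name_at v (Suc i)" "v ! k = v ! i"
      | "name_at v k = name_at v (Suc i)" "name_at v (Suc k) = name_at v i" "v ! k = inv_letter (v ! i)"
      unfolding st_Suc[OF k, symmetric] st_Suc[OF il, symmetric] name_at_eq_iff by blast
    then show "known v k" unfolding darts_enc using i(1) by cases auto
  qed
qed

text \<open>The determinism required by \<open>nstep\<close> holds because a coset and a letter
  determine the next coset, and the inverse letter leads back.\<close>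

lemma nstep_enc:
  assumes red: "reduced v" and k: "k < length v"
  shows "nstep (enc v k) (v ! k) (name_at v (Suc k))"
proof -
  have "reduced (take (Suc k) v)"
    using red reduced_append[of "take (Suc k) v" "drop (Suc k) v"] by simp
  then have r: "reduced (lab (enc v k) @ [v ! k])" using k by (simp add: lab_enc take_Suc_conv_app_nth)
  show ?thesis
  proof (cases "known v k")
    case False
    have a: "(name_at v k, v ! k, c') \<notin> darts (enc v k)" for c'
    proof
      assume d: "(name_at v k, v ! k, c') \<in> darts (enc v k)"
      have "st (take c' v) = st (take (name_at v k) v @ [v ! k])" using darts_encD(1)[OF d] k by simp
      also have "\<dots> = st (take k v @ [v ! k])" by (rule st_append_cong) simp
      finally have "name_at v c' = name_at v (Suc k)" unfolding name_at_eq_iff st_Suc[OF k] .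
      with darts_encD(3)[OF d] k have "c' = name_at v (Suc k)" by simp
      with d False show False by simp
    qed
    have b: "(name_at v (Suc k), inv_letter (v ! k), c') \<notin> darts (enc v k)" for c'
    proof
      assume d: "(name_at v (Suc k), inv_letter (v ! k), c') \<in> darts (enc v k)"
      have "st (take c' v) = st (take (name_at v (Suc k)) v @ [inv_letter (v ! k)])"
        using darts_encD(1)[OF d] k by simp
      also have "\<dots> = st (take (Suc k) v @ [inv_letter (v ! k)])" by (rule st_append_cong) simp
      also have "\<dots> = st (take k v)" using k by (rule st_Suc_inv)
      finally have "name_at v c' = name_at v k" unfolding name_at_eq_iff .
      with darts_encD(3)[OF d] k have "c' = name_at v k" by simp
      with darts_sym[OF d] False show False by simp
    qed
    have "name_at v (Suc k) = Suc k \<or> name_at v (Suc k) \<in> names (enc v k)"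
    proof (cases "name_at v (Suc k) = Suc k")
      case False
      then have "name_at v (Suc k) \<le> k" using name_at_le[of v "Suc k"] by simp
      then have "name_at v (name_at v (Suc k)) \<in> names (enc v k)" unfolding names_enc by blast
      then show ?thesis by simp
    qed simp
    then show ?thesis using r a b by (auto simp: nstep_def)
  qed (use r in \<open>simp add: nstep_def\<close>)
qed

lemma trav_take_Suc:
  "k < length v \<Longrightarrow> trav [] (take (Suc k) v) = insert (edge (take k v) (v ! k)) (trav [] (take k v))"
  by (simp add: take_Suc_conv_app_nth trav_append)

lemma card_trav_enc:
  "k \<le> length v \<Longrightarrow> card (trav [] (take k v)) = fresh_count (enc v k) + rk (enc v k)"
proof (induction k)
  case (Suc k)
  then show ?case
    using known_iff[of k v] by (cases "known v k") (auto simp: trav_take_Suc insert_absorb)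
qed simp

lemma card_visited_enc: "card (visited v) = Suc (fresh_count (enc v (length v)))"
proof -
  have "names (enc v (length v)) = first_visit v ` visited v"
    unfolding names_enc visited_def name_at_def by auto
  moreover have "inj_on (first_visit v) (visited v)"
  proof (rule inj_onI)
    fix p q assume "p \<in> visited v" "q \<in> visited v" "first_visit v p = first_visit v q"
    then obtain i j where "p = st (take i v)" "q = st (take j v)" "name_at v i = name_at v j"
      by (auto simp: visited_def name_at_def)
    then show "p = q" by (simp add: name_at_eq_iff)
  qed
  ultimately show ?thesis using card_names[of "enc v (length v)"] by (simp add: card_image)
qed

lemma rk_enc_mono: "i \<le> j \<Longrightarrow> rk (enc v i) \<le> rk (enc v j)"
  by (induction rule: dec_induct) auto

text \<open>Closing a cycle would raise the rank. A step to a new vertex would be followed by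
  another unknown step, which the backward induction excludes, and it cannot be the last step
  because \<open>v\<close> ends at the start.\<close>

lemma known_after_full_rank:
  assumes red: "reduced v" and v: "st v = st []" and rk: "rk (enc v (length v)) = rk (enc v k)"
    and i: "k \<le> i" "i < length v"
  shows "known v i"
  using i
proof (induction "length v - i" arbitrary: i)
  case (Suc n)
  show ?case
  proof (rule ccontr)
    assume nk: "\<not> known v i"
    have "rk (enc v (Suc i)) \<le> rk (enc v (length v))" "rk (enc v k) \<le> rk (enc v i)"
      using Suc.prems by (intro rk_enc_mono; simp)+
    then have fresh: "name_at v (Suc i) \<notin> names (enc v i)" using rk nk by auto
    have "name_at v (length v) = name_at v 0" unfolding name_at_eq_iff using v by simp
    then have "Suc i \<noteq> length v" using fresh zero_names[of "enc v i"] by auto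
    then have Si: "Suc i < length v" using Suc.prems by simp
    then have "known v (Suc i)" using Suc by (intro Suc.hyps(1)) auto
    moreover have "nstep (enc v (Suc i)) (v ! Suc i) (name_at v (Suc (Suc i)))"
      using red Si by (rule nstep_enc)
    moreover have "fresh_end (enc v (Suc i))" using fresh_end_new[OF fresh] by simp
    ultimately show False unfolding fresh_end_def pos_enc by blast
  qed
qed simp

lemma darts_full_rank:
  assumes "reduced v" "st v = st []" "rk (enc v (length v)) = rk (enc v k)" "k \<le> length v"
  shows "darts (enc v k) = darts (enc v (length v))"
proof -
  have "darts (enc v j) = darts (enc v k)" if "k \<le> j" "j \<le> length v" for j
    using that
  proof (induction rule: dec_induct)
    case (step j)
    then have "known v j" by (intro known_after_full_rank[OF assms(1-3)]) simp_all
    from this darts_sym[OF this] have "darts (enc v (Suc j)) = darts (enc v j)" by auto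
    with step show ?case by simp
  qed simp
  from this[of "length v"] assms(4) show ?thesis by simp
qed

text \<open>The first letter and the inverse of the last leave the start by different darts. Both
  are present at full rank already, since no dart is added later.\<close>

lemma deg_zero_full_rank:
  assumes "reduced v" "st v = st []" "rk (enc v (length v)) = rk (enc v k)" "k \<le> length v"
    and ne: "v \<noteq> []" and cyc: "hd v \<noteq> inv_letter (last v)"
  shows "2 \<le> deg (enc v k) 0"
proof -
  have "name_at v (length v) = name_at v 0" unfolding name_at_eq_iff using assms(2) by simp
  moreover obtain n where n: "length v = Suc n" using ne by (cases v) auto
  ultimately have "name_at v (Suc n) = 0" by simp
  have "(inv_letter (v ! n), name_at v n) \<in> darts (enc v (length v)) `` {name_at v (Suc n)}"
    unfolding darts_enc n by auto
  moreover have "(v ! 0, name_at v (Suc 0)) \<in> darts (enc v (length v)) `` {name_at v 0}"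
    unfolding darts_enc n by (auto simp: Image_iff intro!: bexI[of _ 0])
  moreover have "v ! 0 \<noteq> inv_letter (v ! n)"
    using cyc ne n by (simp add: hd_conv_nth last_conv_nth)
  ultimately have "2 \<le> deg (enc v (length v)) 0"
    using \<open>name_at v (Suc n) = 0\<close>
    by (intro two_le_deg[of "(v ! 0, name_at v (Suc 0))" "(inv_letter (v ! n), name_at v n)"]) auto
  then show ?thesis unfolding deg_def darts_full_rank[OF assms(1-4)] .
qed

text \<open>Each position carries a factor \<open>h\<close>, and each edge collects at least two of
  them; since \<open>h\<close> is at most 1, further crossings only lower the product.\<close>

lemma prod_le_traversed:
  fixes h :: "'x \<Rightarrow> real"
  assumes h: "\<And>x. 0 \<le> h x" "\<And>x. h x \<le> 1"
    and twice: "\<And>e. e \<in> trav [] v \<Longrightarrow> 2 \<le> card {i. i < length v \<and> edge (take i v) (v ! i) = e}"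
  shows "(\<Prod>i<length v. h (fst (v ! i))) \<le> (\<Prod>e\<in>trav [] v. (h (snd e))\<^sup>2)"
proof -
  let ?e = "\<lambda>i. edge (take i v) (v ! i)"
  have tr: "trav [] v = ?e ` {..<length v}" using trav_conv_nth[of "[]" v] by simp
  have "(\<Prod>i<length v. h (fst (v ! i))) = (\<Prod>e\<in>trav [] v. \<Prod>i\<in>{i \<in> {..<length v}. ?e i = e}. h (fst (v ! i)))"
    unfolding tr by (rule prod.image_gen) simp
  also have "\<dots> = (\<Prod>e\<in>trav [] v. h (snd e) ^ card {i. i < length v \<and> ?e i = e})"
  proof (rule prod.cong[OF refl])
    fix e
    have "(\<Prod>i\<in>{i \<in> {..<length v}. ?e i = e}. h (fst (v ! i))) = (\<Prod>i\<in>{i \<in> {..<length v}. ?e i = e}. h (snd e))"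
      by (rule prod.cong[OF refl]) auto
    then show "(\<Prod>i\<in>{i \<in> {..<length v}. ?e i = e}. h (fst (v ! i))) = h (snd e) ^ card {i. i < length v \<and> ?e i = e}"
      by simp
  qed
  also have "\<dots> \<le> (\<Prod>e\<in>trav [] v. (h (snd e))\<^sup>2)"
    using h twice by (intro prod_mono conjI power_decreasing zero_le_power) auto
  finally show ?thesis .
qed

end

context weighted_exploration
begin

text \<open>Known steps have weight 1, so every edge is charged once, at its first crossing.\<close>

lemma weight_enc:
  assumes "free_subgroup J" "k \<le> length v" "f = (\<lambda>d. g (fst d))"
  shows "weight (free_subgroup.enc J v k) = (\<Prod>e\<in>free_subgroup.trav J [] (take k v). g (snd e))"
proof -
  interpret free_subgroup J by fact
  have w: "wt (enc v i) (v ! i, name_at v (Suc i)) = (if known v i then 1 else g (fst (v ! i)))" for i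
    unfolding wt_def pos_enc fst_conv snd_conv using fun_cong[OF assms(3), of "v ! i"] by simp
  show ?thesis using assms(2)
  proof (induction k)
    case (Suc k)
    then show ?case
      using known_iff[of k v]
      by (cases "known v k") (auto simp: trav_take_Suc insert_absorb w mult.commute)
  qed simp
qed

lemma good_enc:
  assumes "free_subgroup J" "reduced v" "v \<in> J" "v = [] \<or> hd v \<noteq> inv_letter (last v)"
    and rk: "rk (free_subgroup.enc J v (length v)) = m"
    and P: "\<And>k. k \<le> length v \<Longrightarrow> P (take k v)"
    and k: "k \<le> length v"
  shows "good (free_subgroup.enc J v k)"
proof -
  interpret free_subgroup J by fact
  have stv: "st v = st []" using assms(2,3) by (simp add: st_eq_base_iff)
  show ?thesis using k
  proof (induction k)
    case (Suc k)
    have n: "nstep (enc v k) (v ! k) (name_at v (Suc k))" using assms(2) Suc.prems by (intro nstep_enc) auto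
    have "v ! k \<in> next_letters P (lab (enc v k))"
      using n P[OF Suc.prems] Suc.prems by (simp add: next_letters_def nstep_def lab_enc take_Suc_conv_app_nth)
    moreover have "rk (enc v (Suc k)) \<le> m" using rk_enc_mono[OF Suc.prems, of v] rk by simp
    moreover have "2 \<le> deg (enc v (Suc k)) 0" if "rk (enc v (Suc k)) = m"
    proof (rule deg_zero_full_rank[OF assms(2) stv _ Suc.prems])
      show "v \<noteq> []" using Suc.prems by auto
      then show "hd v \<noteq> inv_letter (last v)" using assms(4) by blast
      show "rk (enc v (length v)) = rk (enc v (Suc k))" unfolding rk that ..
    qed
    ultimately have "(v ! k, name_at v (Suc k)) \<in> steps (enc v k)"
      using n unfolding steps_def by (simp del: rk.simps flip: enc.simps(2))
    with Suc show ?case by simp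
  qed simp
qed

text \<open>The encoding is injective: an exploration yields \<open>v\<close> as its label and,
  through equal names, the coincidences among prefixes of \<open>v\<close>; these determine
  \<open>loops\<close> and hence \<open>J\<close>.\<close>

lemma crit_pair_sum_le:
  fixes h :: "'x \<Rightarrow> real"
  assumes f: "f = (\<lambda>d. (h (fst d))\<^sup>2)" and h: "\<And>x. 0 \<le> h x" "\<And>x. h x \<le> 1"
    and S: "\<And>v J. (v, J) \<in> S \<Longrightarrow> crit_pair m v J \<and> reduced v \<and> length v = n \<and>
      (v = [] \<or> hd v \<noteq> inv_letter (last v)) \<and> (\<forall>k\<le>n. P (take k v))"
  shows "finite S" "(\<Sum>(v, J)\<in>S. \<Prod>i<n. h (fst (v ! i))) \<le> (\<Sum>z\<in>states n. weight z)"
proof -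
  define enc' where "enc' = (\<lambda>(v :: ('x \<times> bool) list, J). free_subgroup.enc J v n)"
  have *: "enc' (v, J) \<in> states n \<and> lab (enc' (v, J)) = v \<and> J = generate (free_group UNIV) (free_subgroup.loops J v)
      \<and> (\<Prod>i<n. h (fst (v ! i))) \<le> weight (enc' (v, J))"
    if vJ: "(v, J) \<in> S" for v J
  proof -
    have c: "crit_pair m v J" "reduced v" "length v = n" "v = [] \<or> hd v \<noteq> inv_letter (last v)"
      "\<And>k. k \<le> length v \<Longrightarrow> P (take k v)"
      using S[OF vJ] by auto
    interpret free_subgroup J using c(1) by (intro free_subgroup.intro) (simp add: crit_pair_def)
    have vJ: "v \<in> J" and np: "\<not> primitive_in G v" using c(1) by (auto simp: crit_pair_def)
    have cs: "card (trav [] v) + 1 = m + card (visited v)" "J = generate F (loops v)"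
      using critical_structure[of v m] c(1) by (auto simp: crit_pair_def)
    have "rk (enc v (length v)) = m"
      using cs(1) card_trav_enc[of "length v" v] card_visited_enc[of v] by simp
    then have "good (enc v (length v))"
      using c vJ free_subgroup_axioms by (intro good_enc) auto
    moreover have "(\<Prod>i<n. h (fst (v ! i))) \<le> weight (enc v (length v))"
      using prod_le_traversed[where v = v and h = h, OF h traversed_twice[OF vJ np]]
        weight_enc[where v = v and g = "\<lambda>x. (h x)\<^sup>2", OF free_subgroup_axioms order_refl f] c(3) by simp
    ultimately show ?thesis
      using cs(2) c(3) by (simp add: enc'_def states_def lab_enc)
  qed
  have inj: "inj_on enc' S"
  proof (rule inj_onI)
    fix x y assume "x \<in> S" "y \<in> S" and eq: "enc' x = enc' y"
    then obtain v J w K where xy: "x = (v, J)" "y = (w, K)" "(v, J) \<in> S" "(w, K) \<in> S"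
      by (cases x, cases y) auto
    have vw: "w = v" using *[OF xy(3)] *[OF xy(4)] eq xy by metis
    interpret A: free_subgroup J using S[OF xy(3)] by (intro free_subgroup.intro) (simp add: crit_pair_def)
    interpret B: free_subgroup K using S[OF xy(4)] by (intro free_subgroup.intro) (simp add: crit_pair_def)
    have len: "length v = n" using S[OF xy(3)] by simp
    have enc: "A.enc v n = B.enc v n" using eq by (simp add: xy vw enc'_def)
    have "A.name_at v i = B.name_at v i" if "i \<le> n" for i
    proof -
      have "A.enc v i = B.enc v i"
        using that enc by (induction rule: inc_induct) auto
      then show ?thesis using A.pos_enc[of v i] B.pos_enc[of v i] by simp
    qed
    then have "A.st (take i v) = A.st (take j v) \<longleftrightarrow> B.st (take i v) = B.st (take j v)"
      if "i \<le> length v" "j \<le> length v" for i j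
      using that len A.name_at_eq_iff[of v i j] B.name_at_eq_iff[of v i j] by auto
    then have "A.loops v = B.loops v" unfolding A.loops_def B.loops_def by blast
    then have "J = K" using *[OF xy(3)] *[OF xy(4)] vw by metis
    then show "x = y" using xy vw by simp
  qed
  have img: "enc' ` S \<subseteq> states n" using * by auto
  then show "finite S" using finite_states inj by (rule inj_on_finite[rotated])
  have "(\<Sum>(v, J)\<in>S. \<Prod>i<n. h (fst (v ! i))) \<le> (\<Sum>x\<in>S. weight (enc' x))"
    using * by (intro sum_mono) auto
  also have "\<dots> = (\<Sum>z\<in>enc' ` S. weight z)" using inj by (simp add: sum.reindex)
  also have "\<dots> \<le> (\<Sum>z\<in>states n. weight z)"
  proof (rule sum_mono2[OF finite_states img])
    fix z :: "'x exploration"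
    show "0 \<le> weight z" by (induction z) (auto intro: mult_nonneg_nonneg wt_nonneg)
  qed
  finally show "(\<Sum>(v, J)\<in>S. \<Prod>i<n. h (fst (v ! i))) \<le> (\<Sum>z\<in>states n. weight z)" .
qed

end

section \<open>Change of alphabet and conjugation\<close>

lemma carrier_update_free_group:
  "free_group X\<lparr>carrier := J\<rparr> = free_group UNIV\<lparr>carrier := J\<rparr>"
  by (simp add: free_group_def)

lemma subgroup_carrier_free_group: "subgroup (carrier (free_group X)) (free_group UNIV)"
proof (rule group.subgroupI[OF group_free_group])
  have "[] \<in> carrier (free_group X)" by simp
  then show "carrier (free_group X) \<noteq> {}" by blast
next
  fix a assume "a \<in> carrier (free_group X)"
  then show "inv\<^bsub>free_group UNIV\<^esub> a \<in> carrier (free_group X)"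
    using inv_free_group[of a UNIV] by (simp add: set_winv_subset)
next
  fix a b assume "a \<in> carrier (free_group X)" "b \<in> carrier (free_group X)"
  then show "a \<otimes>\<^bsub>free_group UNIV\<^esub> b \<in> carrier (free_group X)"
    using set_reduce[of "a @ b"] by auto
qed auto

lemma subgroup_free_group_iff:
  "subgroup J (free_group X) \<longleftrightarrow> subgroup J (free_group UNIV) \<and> J \<subseteq> carrier (free_group X)"
proof -
  have eq: "free_group X = free_group UNIV\<lparr>carrier := carrier (free_group X)\<rparr>"
    by (simp add: free_group_def)
  show ?thesis
  proof
    assume J: "subgroup J (free_group X)"
    then have "subgroup J (free_group UNIV)"
      using group.incl_subgroup[OF group_free_group subgroup_carrier_free_group] eq by metis
    with subgroup.subset[OF J] show "subgroup J (free_group UNIV) \<and> J \<subseteq> carrier (free_group X)" by simp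
  next
    assume "subgroup J (free_group UNIV) \<and> J \<subseteq> carrier (free_group X)"
    then show "subgroup J (free_group X)"
      using group.subgroup_incl[OF group_free_group _ subgroup_carrier_free_group] eq by metis
  qed
qed

lemma subgroup_has_basis:
  assumes "subgroup J (free_group X)"
  shows "\<exists>B. is_basis (free_group X\<lparr>carrier := J\<rparr>) B"
proof -
  interpret free_subgroup J using assms by (intro free_subgroup.intro) (simp add: subgroup_free_group_iff[where J = J and X = X])
  obtain key par where "schreier_tree J key par" using exploration_tree[of "[]"] by metis
  then interpret T: schreier_tree J key par .
  show ?thesis using T.is_basis_gam unfolding carrier_update_free_group[where X = X] by blast
qed

lemma Crit_crit_pair:
  assumes "J \<in> Crit (free_group X) v" "primitivity_rank (free_group X) v = enat m"
  shows "crit_pair m v J"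
proof -
  have J: "J \<in> imprimitivity_subgroups (free_group X) v" "free_rank (free_group X\<lparr>carrier := J\<rparr>) = enat m"
    using assms by (simp_all add: Crit_def)
  then have sub: "subgroup J (free_group UNIV)" "J \<subseteq> carrier (free_group X)"
    using subgroup_free_group_iff[where J = J and X = X] by (simp_all add: imprimitivity_subgroups_def)
  have "enat m \<le> free_rank (free_group UNIV\<lparr>carrier := K\<rparr>)"
    if "subgroup K (free_group UNIV)" "K \<subseteq> J" "v \<in> K"
      "\<not> primitive_in (free_group UNIV\<lparr>carrier := K\<rparr>) v" for K
  proof -
    have "K \<in> imprimitivity_subgroups (free_group X) v"
      using that sub subgroup_free_group_iff[where J = K and X = X]
      unfolding imprimitivity_subgroups_def carrier_update_free_group[where X = X] by auto
    then have "primitivity_rank (free_group X) v \<le> free_rank (free_group X\<lparr>carrier := K\<rparr>)"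
      unfolding primitivity_rank_def by (rule INF_lower)
    then show ?thesis using assms(2) unfolding carrier_update_free_group[where X = X] by simp
  qed
  then show ?thesis
    using J sub(1) unfolding crit_pair_def imprimitivity_subgroups_def carrier_update_free_group[where X = X]
    by simp
qed

lemma iso_restrict_subgroup:
  assumes "group F" "h \<in> iso F F" "subgroup J F"
  shows "h \<in> iso (F\<lparr>carrier := J\<rparr>) (F\<lparr>carrier := h ` J\<rparr>)" "subgroup (h ` J) F"
proof -
  interpret h: group_hom F F h using assms(1,2) by (simp add: group_hom_def group_hom_axioms_def iso_def)
  show "subgroup (h ` J) F" using assms(3) by (rule h.subgroup_img_is_subgroup)
  have "J \<subseteq> carrier F" using assms(3) by (rule subgroup.subset)
  then have "inj_on h J" using assms(2) by (auto simp: iso_def bij_betw_def intro: inj_on_subset)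
  then show "h \<in> iso (F\<lparr>carrier := J\<rparr>) (F\<lparr>carrier := h ` J\<rparr>)"
    using \<open>J \<subseteq> carrier F\<close> assms(2) by (auto simp: iso_def hom_def bij_betw_def subset_iff)
qed

lemma imprimitivity_subgroups_iso:
  assumes F: "group F" and h: "h \<in> iso F F" and k: "k \<in> iso F F"
    and kh: "\<And>x. x \<in> carrier F \<Longrightarrow> k (h x) = x"
    and J: "J \<in> imprimitivity_subgroups F w"
  shows "h ` J \<in> imprimitivity_subgroups F (h w)"
proof -
  have sub: "subgroup J F" and w: "w \<in> J" and np: "\<not> primitive_in (F\<lparr>carrier := J\<rparr>) w"
    using J by (simp_all add: imprimitivity_subgroups_def)
  note hJ = iso_restrict_subgroup[OF F h sub]
  have Jc: "J \<subseteq> carrier F" using sub by (rule subgroup.subset)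
  have khJ: "k ` h ` J = J" using Jc kh by (force simp: image_image)
  have "k \<in> iso (F\<lparr>carrier := h ` J\<rparr>) (F\<lparr>carrier := J\<rparr>)"
    using iso_restrict_subgroup(1)[OF F k hJ(2)] khJ by simp
  from primitive_in_iso[OF subgroup.subgroup_is_group[OF hJ(2) F] subgroup.subgroup_is_group[OF sub F] this, of "h w"]
  have "\<not> primitive_in (F\<lparr>carrier := h ` J\<rparr>) (h w)" using np kh[OF subsetD[OF Jc w]] by auto
  then show ?thesis using hJ(2) w by (simp add: imprimitivity_subgroups_def)
qed

text \<open>An automorphism permutes the subgroups together with primitivity and rank. Bases of
  subgroups are assumed because \<open>free_rank\<close> has a meaning only when one exists.\<close>

lemma Crit_iso:
  assumes F: "group F" and h: "h \<in> iso F F" and k: "k \<in> iso F F"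
    and kh: "\<And>x. x \<in> carrier F \<Longrightarrow> k (h x) = x" and hk: "\<And>x. x \<in> carrier F \<Longrightarrow> h (k x) = x"
    and basis: "\<And>J. subgroup J F \<Longrightarrow> \<exists>B. is_basis (F\<lparr>carrier := J\<rparr>) B"
    and w: "w \<in> carrier F"
  shows "primitivity_rank F (h w) = primitivity_rank F w" "ecard (Crit F (h w)) = ecard (Crit F w)"
proof -
  let ?I = "imprimitivity_subgroups F"
  let ?r = "\<lambda>J. free_rank (F\<lparr>carrier := J\<rparr>)"
  have sub: "J \<subseteq> carrier F" if "J \<in> ?I v" for J v
    using that by (auto simp: imprimitivity_subgroups_def dest: subgroup.subset)
  have I: "?I (h w) = (`) h ` ?I w"
  proof (intro equalityI subsetI)
    fix J assume J: "J \<in> ?I (h w)"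
    have "k ` J \<in> ?I (k (h w))" using imprimitivity_subgroups_iso[OF F k h hk J] .
    moreover have "h ` k ` J = J" using sub[OF J] hk by (force simp: image_image)
    ultimately show "J \<in> (`) h ` ?I w" using kh[OF w] by (metis imageI)
  qed (use imprimitivity_subgroups_iso[OF F h k kh] in auto)
  have r: "?r (h ` J) = ?r J" if "J \<in> ?I w" for J
  proof -
    have J: "subgroup J F" using that by (simp add: imprimitivity_subgroups_def)
    note hJ = iso_restrict_subgroup[OF F h J]
    from basis[OF J] obtain B where "is_basis (F\<lparr>carrier := J\<rparr>) B" ..
    then show ?thesis
      using free_rank_iso[OF subgroup.subgroup_is_group[OF J F] subgroup.subgroup_is_group[OF hJ(2) F] hJ(1)]
      by simp
  qed
  show pr: "primitivity_rank F (h w) = primitivity_rank F w"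
    unfolding primitivity_rank_def I image_image using r by (auto intro!: INF_cong)
  have "Crit F (h w) = (`) h ` Crit F w"
    unfolding Crit_def pr I using r by auto
  moreover have "inj_on ((`) h) (Crit F w)"
  proof (rule inj_onI)
    fix J K assume "J \<in> Crit F w" "K \<in> Crit F w" "h ` J = h ` K"
    moreover have "inj_on h (carrier F)" using h by (simp add: iso_def bij_betw_def)
    ultimately show "J = K" using sub by (auto simp: Crit_def inj_on_image_eq_iff)
  qed
  ultimately show "ecard (Crit F (h w)) = ecard (Crit F w)" by (simp add: ecard_image_inj)
qed

lemma conj_iso:
  assumes p: "set p \<subseteq> X \<times> UNIV"
  shows "(\<lambda>x. reduce (p @ x @ winv p)) \<in> iso (free_group X) (free_group X)"
proof -
  have cl: "reduce (q @ x @ winv q) \<in> carrier (free_group X)"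
    if "set q \<subseteq> X \<times> UNIV" "x \<in> carrier (free_group X)" for q x
    using that set_reduce[of "q @ x @ winv q"] set_winv_subset[of q X] by auto
  have "reduce (p @ reduce (x @ y) @ winv p)
      = reduce (reduce (p @ x @ winv p) @ reduce (p @ y @ winv p))" for x y
    using reduce_mid_cancel(2)[of "p @ x" p "y @ winv p"] by simp
  then have "(\<lambda>x. reduce (p @ x @ winv p)) \<in> hom (free_group X) (free_group X)"
    using cl[OF p] by (intro homI) auto
  moreover have "bij_betw (\<lambda>x. reduce (p @ x @ winv p)) (carrier (free_group X)) (carrier (free_group X))"
  proof (rule bij_betw_byWitness[where f' = "\<lambda>x. reduce (winv p @ x @ p)"])
    have "reduce (winv p @ p @ x @ winv p @ p) = x" if "reduced x" for x
      using that reduce_end_cancel(2)[of x p] by simp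
    then show "\<forall>a\<in>carrier (free_group X). reduce (winv p @ reduce (p @ a @ winv p) @ p) = a" by simp
    have "reduce (p @ winv p @ x @ p @ winv p) = x" if "reduced x" for x
      using that reduce_end_cancel(1)[of x p] by simp
    then show "\<forall>a\<in>carrier (free_group X). reduce (p @ reduce (winv p @ a @ p) @ winv p) = a" by simp
    show "(\<lambda>x. reduce (p @ x @ winv p)) ` carrier (free_group X) \<subseteq> carrier (free_group X)"
      using cl[OF p] by blast
    show "(\<lambda>x. reduce (winv p @ x @ p)) ` carrier (free_group X) \<subseteq> carrier (free_group X)"
      using cl[of "winv p"] p set_winv_subset[of p X] by auto
  qed
  ultimately show ?thesis by (simp add: iso_def)
qed

lemma Crit_conj:
  assumes v: "v \<in> carrier (free_group X)" and p: "set p \<subseteq> X \<times> UNIV" and r: "reduced (p @ v @ winv p)"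
  shows "primitivity_rank (free_group X) (p @ v @ winv p) = primitivity_rank (free_group X) v"
    "ecard (Crit (free_group X) (p @ v @ winv p)) = ecard (Crit (free_group X) v)"
proof -
  have 1: "reduce (winv p @ reduce (p @ x @ winv p) @ p) = x" if "x \<in> carrier (free_group X)" for x
    using that reduce_end_cancel(2)[of x p] by simp
  have 2: "reduce (p @ reduce (winv p @ x @ p) @ winv p) = x" if "x \<in> carrier (free_group X)" for x
    using that reduce_end_cancel(1)[of x p] by simp
  have k: "(\<lambda>x. reduce (winv p @ x @ p)) \<in> iso (free_group X) (free_group X)"
    using conj_iso[of "winv p" X] p set_winv_subset[of p X] by simp
  show "primitivity_rank (free_group X) (p @ v @ winv p) = primitivity_rank (free_group X) v"
    "ecard (Crit (free_group X) (p @ v @ winv p)) = ecard (Crit (free_group X) v)"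
    using Crit_iso[OF group_free_group conj_iso[OF p] k 1 2 subgroup_has_basis v] reduce_reduced[OF r]
    by simp_all
qed

lemma cyclic_reduction:
  assumes "reduced v"
  obtains p u where "v = p @ u @ winv p" "u = [] \<or> hd u \<noteq> inv_letter (last u)"
  using assms
proof (induction "length v" arbitrary: v thesis rule: less_induct)
  case less
  show thesis
  proof (cases "v = [] \<or> hd v \<noteq> inv_letter (last v)")
    case True
    then show ?thesis using less.prems(1)[of "[]" v] by simp
  next
    case False
    then obtain d x where v: "v = d # x" by (cases v) auto
    with False have "x \<noteq> []" by auto
    then obtain y e where x: "x = y @ [e]" by (metis append_butlast_last_id)
    have e: "e = inv_letter d" using False v x by auto
    have "reduced y" using less.prems(2) v x by (auto simp: reduced_Cons reduced_append)
    then obtain p u where "y = p @ u @ winv p" "u = [] \<or> hd u \<noteq> inv_letter (last u)"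
      using less.hyps[of y] v x by auto
    then show ?thesis using less.prems(1)[of "d # p" u] v x e by simp
  qed
qed

section \<open>Walks and the Green function\<close>

context fin_digraph
begin

abbreviation "src \<equiv> tail (both_directions G)"
abbreviation "tgt \<equiv> head (both_directions G)"

lemma both_simps [simp]:
  "verts (both_directions G) = verts G" "arcs (both_directions G) = arcs G \<times> UNIV"
  "src (inv_letter d) = tgt d" "tgt (inv_letter d) = src d"
  by (cases d; simp add: both_directions_def inv_letter_def)+

lemma src_tgt_verts: "d \<in> arcs G \<times> UNIV \<Longrightarrow> tgt d \<in> verts G \<and> src d \<in> verts G"
  by (cases d) (auto simp: both_directions_def)

lemma path_Nil [simp]: "path G u [] v \<longleftrightarrow> u = v \<and> u \<in> verts G"
  by (auto simp: pre_digraph.awalk_def pre_digraph.cas.simps)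

lemma path_Cons: "path G u (d # w) v \<longleftrightarrow> d \<in> arcs G \<times> UNIV \<and> src d = u \<and> path G (tgt d) w v"
  using src_tgt_verts[of d] by (auto simp: pre_digraph.awalk_def pre_digraph.cas.simps)

lemma path_start: "path G u p v \<Longrightarrow> u \<in> verts G"
  by (simp add: pre_digraph.awalk_def)

lemma inv_letter_arcs [simp]: "inv_letter d \<in> arcs G \<times> UNIV \<longleftrightarrow> d \<in> arcs G \<times> UNIV"
  by (cases d) (simp add: inv_letter_def)

lemma path_append: "path G u (p @ q) v \<longleftrightarrow> (\<exists>x. path G u p x \<and> path G x q v)"
proof (induction p arbitrary: u)
  case Nil
  show ?case by (auto dest: path_start)
qed (auto simp: path_Cons)

lemma path_end: "path G u p v \<Longrightarrow> v \<in> verts G"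
  by (induction p arbitrary: u) (auto simp: path_Cons)

lemma path_unique: "path G u p v \<Longrightarrow> path G u p v' \<Longrightarrow> v = v'"
  by (induction p arbitrary: u) (auto simp: path_Cons)

lemma path_set: "path G u p v \<Longrightarrow> set p \<subseteq> arcs G \<times> UNIV"
  by (simp add: pre_digraph.awalk_def)

lemma path_winv: "path G u p v \<Longrightarrow> path G v (winv p) u"
proof (induction p arbitrary: u)
  case (Cons d p)
  then have d: "d \<in> arcs G \<times> UNIV" "src d = u" "path G (tgt d) p v"
    unfolding path_Cons by blast+
  then have "path G (tgt d) [inv_letter d] u"
    using src_tgt_verts[OF d(1)] unfolding path_Cons by simp
  with Cons.IH[OF d(3)] show ?case unfolding winv_Cons path_append by blast
qed simp

lemma path_winv_iff: "path G v (winv p) u \<longleftrightarrow> path G u p v"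
  using path_winv[of u p v] path_winv[of v "winv p" u] by auto

lemma path_reduce: "path G u p v \<Longrightarrow> path G u (reduce p) v"
proof (induction p arbitrary: u)
  case (Cons d p)
  then have d: "d \<in> arcs G \<times> UNIV" "src d = u" and r: "path G (tgt d) (reduce p) v"
    by (auto simp: path_Cons)
  show ?case
  proof (cases "reduce p \<noteq> [] \<and> hd (reduce p) = inv_letter d")
    case True
    then obtain t where "reduce p = inv_letter d # t" by (cases "reduce p") auto
    then show ?thesis using r d by (simp add: reduce_Cons path_Cons)
  next
    case False
    then have "reduce (d # p) = d # reduce p" by (auto simp: reduce_Cons cons_reduce_alt)
    then show ?thesis using r d by (simp add: path_Cons)
  qed
qed simp

definition words :: "'a \<Rightarrow> nat \<Rightarrow> ('b \<times> bool) list set" where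
  "words a t = {w. length w = t \<and> (\<exists>b. path G a w b)}"

text \<open>Words from \<open>a\<close> that reduce to \<open>v\<close> are the walks from the root
  to the vertex \<open>v\<close> in the covering tree based at \<open>a\<close>, so tree walks are
  counted without mentioning a tree.\<close>

definition walks :: "'a \<Rightarrow> nat \<Rightarrow> ('b \<times> bool) list \<Rightarrow> ('b \<times> bool) list set" where
  "walks a t v = {w \<in> words a t. reduce w = v}"

lemma finite_words [simp]: "finite (words a t)"
proof (rule finite_subset)
  show "words a t \<subseteq> {w. set w \<subseteq> arcs G \<times> UNIV \<and> length w = t}"
    unfolding words_def using path_set by blast
qed (intro finite_lists_length_eq finite_cartesian_product finite_arcs finite)

lemma finite_walks [simp]: "finite (walks a t v)"
  unfolding walks_def by simp

lemma walks_path: "path G a v b \<Longrightarrow> w \<in> walks a t v \<Longrightarrow> path G a w b"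
  unfolding walks_def words_def using path_reduce path_unique by blast

text \<open>A walk to \<open>v\<close> followed by the reverse of another closes up in the tree, and
  the known lengths allow the two to be separated again. This is the combinatorial form of the
  symmetry of the adjacency operator.\<close>

lemma sum_walks_mult_le:
  assumes "finite V"
  shows "(\<Sum>v\<in>V. card (walks a s v) * card (walks a t v)) \<le> card (walks a (s + t) [])"
proof -
  let ?S = "SIGMA v:V. walks a s v \<times> walks a t v"
  have "(\<Sum>v\<in>V. card (walks a s v) * card (walks a t v)) = card ?S"
    using assms by (simp add: card_cartesian_product)
  also have "\<dots> \<le> card (walks a (s + t) [])"
  proof (rule card_inj_on_le[of "\<lambda>(v, w, w'). w @ winv w'"])
    show "inj_on (\<lambda>(v, w, w'). w @ winv w') ?S"
    proof (rule inj_onI)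
      fix p q assume "p \<in> ?S" "q \<in> ?S" and eq: "(\<lambda>(v, w, w'). w @ winv w') p = (\<lambda>(v, w, w'). w @ winv w') q"
      then obtain v w x v' w' x' where pq: "p = (v, w, x)" "q = (v', w', x')"
        and "w \<in> walks a s v" "x \<in> walks a t v" "w' \<in> walks a s v'" "x' \<in> walks a t v'"
        by auto
      then have l: "length w = length w'" "reduce w = v" "reduce w' = v'" by (auto simp: walks_def words_def)
      with eq pq have e: "w = w'" "winv x = winv x'" by auto
      from e(2) have "x = x'" by (metis winv_winv)
      with e(1) l pq show "p = q" by simp
    qed
    show "(\<lambda>(v, w, w'). w @ winv w') ` ?S \<subseteq> walks a (s + t) []"
    proof
      fix y assume "y \<in> (\<lambda>(v, w, w'). w @ winv w') ` ?S"
      then obtain v w x where y: "y = w @ winv x" and wx: "w \<in> walks a s v" "x \<in> walks a t v" by auto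
      then obtain b c where b: "path G a w b" "path G a x c" and r: "reduce w = v" "reduce x = v"
        and l: "length w = s" "length x = t"
        by (auto simp: walks_def words_def)
      have "path G a v b" "path G a v c" using path_reduce[OF b(1)] path_reduce[OF b(2)] r by auto
      then have "b = c" by (rule path_unique)
      then have "path G a (w @ winv x) a" using b path_winv path_append by blast
      moreover have "reduce (w @ winv x) = []" using r by (simp add: reduce_append_winv_eq_Nil_iff)
      ultimately show "y \<in> walks a (s + t) []" using l y by (auto simp: walks_def words_def)
    qed
  qed simp
  finally show ?thesis .
qed

lemma card_walks_winv:
  assumes "path G a v b"
  shows "card (walks a t v) = card (walks b t (winv v))"
proof (rule bij_betw_same_card[of winv], rule bij_betw_byWitness[of _ winv])
  have *: "winv ` walks a t v \<subseteq> walks b t (winv v)" if ab: "path G a v b" for a v b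
  proof
    fix w assume "w \<in> winv ` walks a t v"
    then obtain x where x: "x \<in> walks a t v" "w = winv x" by auto
    have "path G b (winv x) a" using walks_path[OF ab x(1)] by (rule path_winv)
    then show "w \<in> walks b t (winv v)" using x by (auto simp: walks_def words_def reduce_winv)
  qed
  show "winv ` walks a t v \<subseteq> walks b t (winv v)" using assms by (rule *)
  show "winv ` walks b t (winv v) \<subseteq> walks a t v" using *[OF path_winv[OF assms]] by simp
qed auto

section \<open>First passage across an edge\<close>

definition first_walks :: "nat \<Rightarrow> ('b \<times> bool) \<Rightarrow> ('b \<times> bool) list set" where
  "first_walks t d = {w \<in> walks (src d) t [d]. \<forall>k<t. reduce (take k w) \<noteq> [d]}"

definition hitting :: "('b \<times> bool) \<Rightarrow> nat \<Rightarrow> ('b \<times> bool) list \<Rightarrow> ('b \<times> bool) list set" where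
  "hitting d t v = {w \<in> walks (src d) t v. \<exists>k\<le>t. reduce (take k w) = [d]}"

text \<open>The walk is cut at the first time it reaches \<open>[d]\<close>; the rest is a walk to
  \<open>v\<close> as seen from the far end of \<open>d\<close>. The target is
  \<open>reduce (d # v)\<close> so that an immediate return, \<open>v = [inv_letter d]\<close>, is
  included.\<close>

lemma card_hitting:
  assumes d: "d \<in> arcs G \<times> UNIV" and v: "reduced v"
  shows "card (hitting d t (reduce (d # v))) =
    (\<Sum>s\<le>t. card (first_walks s d) * card (walks (tgt d) (t - s) v))"
proof -
  let ?S = "SIGMA s:{..t}. first_walks s d \<times> walks (tgt d) (t - s) v"
  have fin: "finite (first_walks s d)" for s by (simp add: first_walks_def)
  have pd: "path G (src d) [d] (tgt d)" using d src_tgt_verts[OF d] by (simp add: path_Cons)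
  have "bij_betw (\<lambda>(s, w, x). w @ x) ?S (hitting d t (reduce (d # v)))"
  proof (rule bij_betwI[where g = "\<lambda>w. let s = (LEAST k. reduce (take k w) = [d]) in (s, take s w, drop s w)"])
    show "(\<lambda>(s, w, x). w @ x) \<in> ?S \<rightarrow> hitting d t (reduce (d # v))"
    proof clarify
      fix s w x assume s: "s \<le> t" and w: "w \<in> first_walks s d" and x: "x \<in> walks (tgt d) (t - s) v"
      have w': "w \<in> walks (src d) s [d]" using w by (simp add: first_walks_def)
      then have "path G (src d) w (tgt d)" "length w = s" "reduce w = [d]"
        using walks_path[OF pd] by (auto simp: walks_def words_def)
      moreover obtain c where "path G (tgt d) x c" "length x = t - s" "reduce x = v"
        using x by (auto simp: walks_def words_def)
      moreover have "reduce (w @ x) = reduce (d # v)"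
        using \<open>reduce w = [d]\<close> \<open>reduce x = v\<close>
        by (metis append_Cons append_Nil reduce_append_reduce reduce_reduce_append)
      ultimately have "path G (src d) (w @ x) c" "length (w @ x) = t" "reduce (w @ x) = reduce (d # v)"
          "reduce (take s (w @ x)) = [d]"
        using s path_append by auto
      then show "w @ x \<in> hitting d t (reduce (d # v))"
        using s unfolding hitting_def walks_def words_def by blast
    qed
    show "(\<lambda>w. let s = (LEAST k. reduce (take k w) = [d]) in (s, take s w, drop s w))
        \<in> hitting d t (reduce (d # v)) \<rightarrow> ?S"
    proof
      fix w assume w: "w \<in> hitting d t (reduce (d # v))"
      define s where "s = (LEAST k. reduce (take k w) = [d])"
      from w obtain k where k: "k \<le> t" "reduce (take k w) = [d]" by (auto simp: hitting_def)
      have s: "reduce (take s w) = [d]" unfolding s_def using k(2) by (rule LeastI)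
      have st: "s \<le> t" using Least_le[of "\<lambda>k. reduce (take k w) = [d]", OF k(2)] k(1) s_def by simp
      have before: "reduce (take k w) \<noteq> [d]" if "k < s" for k
        using that not_less_Least unfolding s_def by blast
      obtain b where b: "path G (src d) w b" and l: "length w = t" and r: "reduce w = reduce (d # v)"
        using w by (auto simp: hitting_def walks_def words_def)
      obtain c where c: "path G (src d) (take s w) c" "path G c (drop s w) b"
        using b path_append[of "src d" "take s w" "drop s w" b] by auto
      have "c = tgt d" using path_reduce[OF c(1)] s pd path_unique by metis
      have "take s w \<in> first_walks s d"
        using c s st l before by (auto simp: first_walks_def walks_def words_def min_def)
      moreover have "reduce ([d] @ drop s w) = reduce ([d] @ v)"
        using r s by (metis append_Cons append_Nil append_take_drop_id reduce_reduce_append)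
      then have "reduce (drop s w) = v" using v by (simp only: reduce_cancel_left) simp
      then have "drop s w \<in> walks (tgt d) (t - s) v"
        using c(2) \<open>c = tgt d\<close> l by (auto simp: walks_def words_def)
      ultimately show "(let s = (LEAST k. reduce (take k w) = [d]) in (s, take s w, drop s w)) \<in> ?S"
        using st by (simp add: s_def[symmetric])
    qed
    show "(let s = (LEAST k. reduce (take k ((\<lambda>(s, w, x). w @ x) y)) = [d])
        in (s, take s ((\<lambda>(s, w, x). w @ x) y), drop s ((\<lambda>(s, w, x). w @ x) y))) = y"
      if "y \<in> ?S" for y
    proof -
      obtain s w x where y: "y = (s, w, x)" "w \<in> first_walks s d" using \<open>y \<in> ?S\<close> by auto
      then have l: "length w = s" "reduce w = [d]" "\<And>k. k < s \<Longrightarrow> reduce (take k w) \<noteq> [d]"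
        by (auto simp: first_walks_def walks_def words_def)
      have "(LEAST k. reduce (take k (w @ x)) = [d]) = s"
      proof (rule Least_equality)
        fix k assume k: "reduce (take k (w @ x)) = [d]"
        show "s \<le> k"
        proof (rule ccontr)
          assume "\<not> s \<le> k"
          with k l(1) l(3)[of k] show False by simp
        qed
      qed (simp add: l)
      then show ?thesis using l(1) by (simp add: y)
    qed
    show "(\<lambda>(s, w, x). w @ x) (let s = (LEAST k. reduce (take k w) = [d]) in (s, take s w, drop s w)) = w" for w
      by (simp add: Let_def)
  qed
  then have "card (hitting d t (reduce (d # v))) = card ?S" by (simp add: bij_betw_same_card)
  also have "\<dots> = (\<Sum>s\<le>t. card (first_walks s d) * card (walks (tgt d) (t - s) v))"
    using fin by (simp add: card_cartesian_product)
  finally show ?thesis .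
qed

text \<open>In a tree \<open>[d]\<close> separates the root from everything beyond it: the reduced
  word grows and shrinks at its end, so its first letter can become \<open>d\<close> only when the
  whole word is \<open>[d]\<close>.\<close>

lemma prefix_hit:
  "reduce w = d # v \<Longrightarrow> \<exists>k\<le>length w. reduce (take k w) = [d]"
proof (induction w arbitrary: v rule: rev_induct)
  case (snoc e w)
  have eq: "reduce (w @ [e]) = reduce (reduce w @ [e])" by simp
  show ?case
  proof (cases "reduce w")
    case Nil
    then have "reduce (w @ [e]) = [e]" unfolding eq by simp
    then show ?thesis using snoc.prems by (intro exI[of _ "Suc (length w)"]) simp
  next
    case (Cons d' u)
    show ?thesis
    proof (cases "d' = d")
      case True
      with snoc.IH[of u] Cons obtain k where "k \<le> length w" "reduce (take k w) = [d]" by auto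
      then show ?thesis by (intro exI[of _ k]) simp
    next
      case False
      then have "\<not> (reduce w \<noteq> [] \<and> last (reduce w) = inv_letter e) \<Longrightarrow> False"
        using snoc.prems Cons reduce_snoc[OF reduced_reduce, of w e] unfolding eq by auto
      then have "reduce (w @ [e]) = butlast (reduce w)"
        using reduce_snoc[OF reduced_reduce, of w e] unfolding eq by auto
      then show ?thesis using snoc.prems Cons False by (cases u) auto
    qed
  qed
qed simp

lemma hitting_eq_walks:
  assumes "reduced (d # v)"
  shows "hitting d t (reduce (d # v)) = walks (src d) t (d # v)"
proof -
  have "\<exists>k\<le>t. reduce (take k w) = [d]" if "w \<in> walks (src d) t (d # v)" for w
    using that prefix_hit[of w d v] by (auto simp: walks_def words_def)
  then show ?thesis unfolding reduce_reduced[OF assms] hitting_def by auto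
qed

end

section \<open>The Green function within its radius of convergence\<close>

locale green = fin_digraph +
  fixes R z :: real
  assumes R: "0 < R" and z: "0 < z" "z * R < 1"
    and spec: "real (card (walks a (2 * t) [])) \<le> R ^ (2 * t)"
begin

text \<open>Squaring turns any endpoint and any parity into closed walks of even length, for which
  the bound is assumed.\<close>

lemma card_walks_le: "real (card (walks a t v)) \<le> R ^ t"
proof -
  have "(real (card (walks a t v)))\<^sup>2 \<le> real (card (walks a (2 * t) []))"
    using sum_walks_mult_le[of "{v}" a t t] by (simp add: power2_eq_square mult_2 flip: of_nat_mult)
  also have "\<dots> \<le> (R ^ t)\<^sup>2" using spec[of a t] by (simp add: power_mult[symmetric] mult.commute)
  finally show ?thesis using R by (simp add: power2_le_iff_abs_le)
qed

definition walk_term :: "'a \<Rightarrow> ('b \<times> bool) list \<Rightarrow> nat \<Rightarrow> real" where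
  "walk_term a v t = real (card (walks a t v)) * z ^ t"

definition Green :: "'a \<Rightarrow> ('b \<times> bool) list \<Rightarrow> real" where
  "Green a v = (\<Sum>t. walk_term a v t)"

definition first_passage :: "'b \<times> bool \<Rightarrow> real" where
  "first_passage d = (\<Sum>t. real (card (first_walks t d)) * z ^ t)"

lemma zR: "norm (z * R) < 1"
  using z R by simp

lemma walk_term_nonneg: "0 \<le> walk_term a v t"
  using z by (simp add: walk_term_def)

lemma walk_term_le: "walk_term a v t \<le> (z * R) ^ t"
  unfolding walk_term_def power_mult_distrib using card_walks_le[of a t v] z by (simp add: mult.commute)

lemma summable_walk_term: "summable (walk_term a v)"
  by (rule summable_comparison_test'[OF summable_geometric[OF zR], of 0])
    (simp add: walk_term_nonneg walk_term_le)

lemma first_walks_le: "card (first_walks t d) \<le> card (walks (src d) t [d])"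
  by (rule card_mono) (auto simp: first_walks_def)

lemma summable_first: "summable (\<lambda>t. real (card (first_walks t d)) * z ^ t)"
proof (rule summable_comparison_test'[OF summable_walk_term[of "src d" "[d]"], of 0])
  fix t show "norm (real (card (first_walks t d)) * z ^ t) \<le> walk_term (src d) [d] t"
    unfolding walk_term_def using first_walks_le[of t d] z by (simp add: mult_right_mono)
qed

lemma first_passage_nonneg: "0 \<le> first_passage d"
  unfolding first_passage_def using z by (intro suminf_nonneg summable_first) simp

lemma Green_Nil_ge_1: "a \<in> verts G \<Longrightarrow> 1 \<le> Green a []"
proof -
  assume a: "a \<in> verts G"
  have "walks a 0 [] = {[]}" using a by (auto simp: walks_def words_def)
  then have "walk_term a [] 0 = 1" by (simp add: walk_term_def)
  moreover have "(\<Sum>t<1. walk_term a [] t) \<le> Green a []"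
    unfolding Green_def by (intro sum_le_suminf summable_walk_term) (auto simp: walk_term_nonneg)
  ultimately show ?thesis by simp
qed

lemma first_passage_Green:
  assumes d: "d \<in> arcs G \<times> UNIV" and v: "reduced v"
  shows "(\<lambda>t. real (card (hitting d t (reduce (d # v)))) * z ^ t) sums (first_passage d * Green (tgt d) v)"
proof -
  let ?f = "\<lambda>t. real (card (first_walks t d)) * z ^ t"
  have "(\<lambda>k. \<Sum>i\<le>k. ?f i * walk_term (tgt d) v (k - i)) sums (first_passage d * Green (tgt d) v)"
    unfolding first_passage_def Green_def
    using summable_first summable_walk_term walk_term_nonneg z by (intro Cauchy_product_sums) auto
  moreover have "(\<Sum>i\<le>k. ?f i * walk_term (tgt d) v (k - i)) = real (card (hitting d k (reduce (d # v)))) * z ^ k" for k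
  proof -
    have "?f i * walk_term (tgt d) v (k - i) = real (card (first_walks i d) * card (walks (tgt d) (k - i) v)) * z ^ k"
      if "i \<in> {..k}" for i
      using that by (simp add: walk_term_def mult_ac flip: power_add)
    then have "(\<Sum>i\<le>k. ?f i * walk_term (tgt d) v (k - i)) =
        (\<Sum>i\<le>k. real (card (first_walks i d) * card (walks (tgt d) (k - i) v)) * z ^ k)"
      by (rule sum.cong[OF refl])
    then show ?thesis unfolding card_hitting[OF d v] of_nat_sum sum_distrib_right .
  qed
  ultimately show ?thesis by simp
qed

lemma Green_Cons:
  assumes d: "d \<in> arcs G \<times> UNIV" and r: "reduced (d # v)"
  shows "Green (src d) (d # v) = first_passage d * Green (tgt d) v"
proof -
  have "reduced v" using r by (simp add: reduced_Cons)
  from first_passage_Green[OF d this] show ?thesis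
    unfolding hitting_eq_walks[OF r] Green_def walk_term_def by (simp add: sums_iff)
qed

lemma Green_winv: "path G a v b \<Longrightarrow> Green a v = Green b (winv v)"
  unfolding Green_def walk_term_def by (simp add: card_walks_winv)

text \<open>Crossing \<open>d\<close> for the first time, returning for the first time and then
  closing up arbitrarily produces some of the closed walks at the tail of \<open>d\<close>, each
  once. The claim follows on dividing by the Green function there.\<close>

lemma first_passage_mult_le:
  assumes d: "d \<in> arcs G \<times> UNIV"
  shows "first_passage d * first_passage (inv_letter d) \<le> 1"
proof -
  let ?a = "src d" and ?i = "inv_letter d"
  have a: "?a \<in> verts G" using src_tgt_verts[OF d] by simp
  have i: "?i \<in> arcs G \<times> UNIV" using d by (cases d) (simp add: inv_letter_def)
  let ?h = "\<lambda>t. real (card (hitting d t [])) * z ^ t"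
  have "reduce (d # [?i]) = []" by (simp add: reduce_Cons)
  then have h: "?h sums (first_passage d * Green (tgt d) [?i])"
    using first_passage_Green[OF d, of "[?i]"] by simp
  have "Green (tgt d) [?i] = first_passage ?i * Green ?a []" using Green_Cons[OF i, of "[]"] by simp
  with h have sh: "summable ?h" and eq: "suminf ?h = first_passage d * first_passage ?i * Green ?a []"
    by (simp_all add: sums_iff)
  have "(\<lambda>t. if t = 0 then 1 else 0) sums (1 :: real)" using sums_single[of 0 "\<lambda>_. 1 :: real"] by simp
  then have s1: "(\<lambda>t. ?h t + (if t = 0 then 1 else 0)) sums (suminf ?h + 1)"
    by (intro sums_add summable_sums sh)
  have "suminf ?h + 1 \<le> Green ?a []"
    unfolding Green_def
  proof (rule sums_le[OF _ s1 summable_sums[OF summable_walk_term]])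
    fix t show "?h t + (if t = 0 then 1 else 0) \<le> walk_term ?a [] t"
    proof (cases "t = 0")
      case True
      have "hitting d 0 [] = {}" by (auto simp: hitting_def walks_def words_def)
      moreover have "walks ?a 0 [] = {[]}" using a by (auto simp: walks_def words_def)
      ultimately show ?thesis using True by (simp add: walk_term_def)
    next
      case False
      have "card (hitting d t []) \<le> card (walks ?a t [])" by (rule card_mono) (auto simp: hitting_def)
      then show ?thesis using False z by (simp add: walk_term_def mult_right_mono)
    qed
  qed
  then have "first_passage d * first_passage ?i * Green ?a [] \<le> 1 * Green ?a []" using eq by simp
  moreover have "0 < Green ?a []" using Green_Nil_ge_1[OF a] by simp
  ultimately show ?thesis using mult_le_cancel_right_pos by blast
qed

text \<open>The geometric mean of the passages in both directions, hence independent of the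
  orientation. The value 0 off the arcs keeps the bound by 1 valid for all arguments.\<close>

definition phi :: "'b \<Rightarrow> real" where
  "phi e = (if e \<in> arcs G then sqrt (first_passage (e, True) * first_passage (e, False)) else 0)"

lemma phi_nonneg: "0 \<le> phi e"
  by (simp add: phi_def first_passage_nonneg)

lemma phi_le_1: "phi e \<le> 1"
  using first_passage_mult_le[of "(e, True)"] by (simp add: phi_def inv_letter_def)

lemma phi_square:
  "d \<in> arcs G \<times> UNIV \<Longrightarrow> (phi (fst d))\<^sup>2 = first_passage d * first_passage (inv_letter d)"
  using first_passage_nonneg by (cases d; cases "snd d") (auto simp: phi_def inv_letter_def mult.commute)

lemma Green_prod:
  "path G a v b \<Longrightarrow> reduced v \<Longrightarrow> Green a v = (\<Prod>d\<leftarrow>v. first_passage d) * Green b []"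
proof (induction v arbitrary: a)
  case (Cons d v)
  then show ?case using Green_Cons[of d v] by (auto simp: path_Cons reduced_Cons)
qed simp

text \<open>Multiplying the Green function along \<open>v\<close> by the equal one along the reverse
  pairs the two passages of every edge.\<close>

lemma Green_square:
  assumes p: "path G a v b" and r: "reduced v"
  shows "(Green a v)\<^sup>2 = (\<Prod>d\<leftarrow>v. (phi (fst d))\<^sup>2) * Green a [] * Green b []"
proof -
  have "Green a v * Green b (winv v) =
      ((\<Prod>d\<leftarrow>v. first_passage d) * (\<Prod>d\<leftarrow>winv v. first_passage d)) * Green a [] * Green b []"
    using Green_prod[OF p r] Green_prod[OF path_winv[OF p]] r by simp
  also have "(\<Prod>d\<leftarrow>v. first_passage d) * (\<Prod>d\<leftarrow>winv v. first_passage d) = (\<Prod>d\<leftarrow>v. (phi (fst d))\<^sup>2)"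
    using path_set[OF p]
  proof (induction v)
    case (Cons d v)
    then have "(\<Prod>d\<leftarrow>v. first_passage d) * (\<Prod>d\<leftarrow>winv v. first_passage d) = (\<Prod>d\<leftarrow>v. (phi (fst d))\<^sup>2)"
      by auto
    moreover have "(phi (fst d))\<^sup>2 = first_passage d * first_passage (inv_letter d)"
      using Cons.prems by (intro phi_square) auto
    ultimately show ?case by (simp add: mult_ac flip: \<open>_ = (\<Prod>d\<leftarrow>v. (phi (fst d))\<^sup>2)\<close>)
  qed simp
  finally show ?thesis using Green_winv[OF p] by (simp add: power2_eq_square)
qed

lemma Green_nonneg: "0 \<le> Green a v"
  unfolding Green_def by (intro suminf_nonneg summable_walk_term walk_term_nonneg)

text \<open>The diagonal values depend only on the vertex of the graph below, so they coincide for a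
  path that is closed in the graph, and the square root can be taken.\<close>

lemma Green_closed:
  assumes p: "path G a v a" and r: "reduced v"
  shows "Green a v = (\<Prod>d\<leftarrow>v. phi (fst d)) * Green a []"
proof -
  have "(\<Prod>d\<leftarrow>v. (phi (fst d))\<^sup>2) = (\<Prod>d\<leftarrow>v. phi (fst d))\<^sup>2"
    by (induction v) (auto simp: power_mult_distrib)
  then have "(Green a v)\<^sup>2 = ((\<Prod>d\<leftarrow>v. phi (fst d)) * Green a [])\<^sup>2"
    using Green_square[OF p r] by (simp add: power2_eq_square mult_ac)
  moreover have "0 \<le> (\<Prod>d\<leftarrow>v. phi (fst d))" by (induction v) (auto simp: phi_nonneg)
  ultimately show ?thesis using Green_nonneg by (simp add: power2_eq_iff_nonneg)
qed

text \<open>The sum of the series with terms \<open>(k + 1) * (z * R) ^ k\<close>.\<close>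

definition green_energy :: real where
  "green_energy = 1 / (1 - z * R)\<^sup>2"

lemma green_energy: "1 \<le> green_energy"
proof -
  have "(1 - z * R)\<^sup>2 \<le> 1\<^sup>2" using z R by (intro power_mono) auto
  then show ?thesis using z by (simp add: green_energy_def le_divide_eq)
qed

text \<open>Summed over \<open>v\<close>, the coefficient of order \<open>k\<close> in the Cauchy
  products counts pairs that glue to closed walks of length \<open>k\<close>, cut at one of
  \<open>k + 1\<close> times.\<close>

lemma sum_Green_square_le:
  assumes V: "finite V"
  shows "(\<Sum>v\<in>V. (Green a v)\<^sup>2) \<le> green_energy"
proof -
  have s1: "(\<lambda>k. \<Sum>v\<in>V. \<Sum>i\<le>k. walk_term a v i * walk_term a v (k - i)) sums (\<Sum>v\<in>V. Green a v * Green a v)"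
    unfolding Green_def using summable_walk_term walk_term_nonneg by (intro sums_sum Cauchy_product_sums) auto
  have s2: "(\<lambda>k. of_nat (Suc k) * (z * R) ^ k) sums green_energy"
    unfolding green_energy_def using geometric_deriv_sums[OF zR] by simp
  have le: "(\<Sum>v\<in>V. \<Sum>i\<le>k. walk_term a v i * walk_term a v (k - i)) \<le> of_nat (Suc k) * (z * R) ^ k" for k
  proof -
    have "(\<Sum>v\<in>V. \<Sum>i\<le>k. walk_term a v i * walk_term a v (k - i)) = (\<Sum>i\<le>k. \<Sum>v\<in>V. walk_term a v i * walk_term a v (k - i))"
      by (rule sum.swap)
    also have "\<dots> \<le> (\<Sum>i\<le>k. (z * R) ^ k)"
    proof (rule sum_mono)
      fix i assume "i \<in> {..k}"
      then have i: "i \<le> k" by simp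
      have "(\<Sum>v\<in>V. walk_term a v i * walk_term a v (k - i)) = real (\<Sum>v\<in>V. card (walks a i v) * card (walks a (k - i) v)) * z ^ k"
      proof -
        have "z ^ k = z ^ i * z ^ (k - i)" using i by (simp flip: power_add)
        then show ?thesis by (simp add: walk_term_def sum_distrib_right sum_distrib_left mult_ac)
      qed
      also have "\<dots> \<le> real (card (walks a k [])) * z ^ k"
        using sum_walks_mult_le[OF V, of a i "k - i"] i z by (intro mult_right_mono of_nat_mono) auto
      also have "\<dots> \<le> (z * R) ^ k" using walk_term_le[of a "[]" k] by (simp add: walk_term_def)
      finally show "(\<Sum>v\<in>V. walk_term a v i * walk_term a v (k - i)) \<le> (z * R) ^ k" .
    qed
    finally show ?thesis by simp
  qed
  have "(\<Sum>v\<in>V. Green a v * Green a v) \<le> green_energy" using le s1 s2 by (rule sums_le)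
  then show ?thesis by (simp add: power2_eq_square)
qed

text \<open>By \<open>Green_square\<close> each product is a squared Green function divided by two
  diagonal values, both at least 1.\<close>

lemma sum_phi_le:
  assumes a: "a \<in> verts G" and V: "finite V" "\<And>v. v \<in> V \<Longrightarrow> reduced v \<and> (\<exists>b. path G a v b)"
  shows "(\<Sum>v\<in>V. \<Prod>d\<leftarrow>v. (phi (fst d))\<^sup>2) \<le> green_energy"
proof -
  have "(\<Prod>d\<leftarrow>v. (phi (fst d))\<^sup>2) \<le> (Green a v)\<^sup>2" if "v \<in> V" for v
  proof -
    obtain b where b: "path G a v b" "reduced v" using V(2)[OF \<open>v \<in> V\<close>] by auto
    have 1: "1 \<le> Green a []" "1 \<le> Green b []"
      using a path_end[OF b(1)] by (auto intro: Green_Nil_ge_1)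
    have "0 \<le> (\<Prod>d\<leftarrow>v. (phi (fst d))\<^sup>2)" by (induction v) auto
    moreover have "1 * 1 \<le> Green a [] * Green b []" using 1 by (intro mult_mono) auto
    ultimately have "(\<Prod>d\<leftarrow>v. (phi (fst d))\<^sup>2) * 1 \<le> (\<Prod>d\<leftarrow>v. (phi (fst d))\<^sup>2) * (Green a [] * Green b [])"
      by (intro mult_left_mono) auto
    then show ?thesis unfolding Green_square[OF b] by (simp add: mult_ac)
  qed
  then have "(\<Sum>v\<in>V. \<Prod>d\<leftarrow>v. (phi (fst d))\<^sup>2) \<le> (\<Sum>v\<in>V. (Green a v)\<^sup>2)" by (rule sum_mono)
  also have "\<dots> \<le> green_energy" using V(1) by (rule sum_Green_square_le)
  finally show ?thesis .
qed

end

section \<open>Square-summable functions and the adjacency operator\<close>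

text \<open>Bounds on finite subsets give membership and norm at once, so later estimates are made
  with finite sums.\<close>

lemma ell2I:
  assumes "\<And>v. v \<notin> V \<Longrightarrow> f v = 0" "0 \<le> C"
    and le: "\<And>S. finite S \<Longrightarrow> S \<subseteq> V \<Longrightarrow> L2_set (\<lambda>v. cmod (f v)) S \<le> C"
  shows "f \<in> ell2 V" "ell2_norm V f \<le> C"
proof -
  have le2: "(\<Sum>v\<in>S. (cmod (f v))\<^sup>2) \<le> C\<^sup>2" if "finite S" "S \<subseteq> V" for S
    using le[OF that] unfolding L2_set_def by (rule sqrt_le_D)
  then have "bdd_above (sum (\<lambda>v. (cmod (f v))\<^sup>2) ` {F. F \<subseteq> V \<and> finite F})"
    by (intro bdd_aboveI[of _ "C\<^sup>2"]) auto
  then have s: "(\<lambda>v. (cmod (f v))\<^sup>2) summable_on V"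
    by (intro nonneg_bdd_above_summable_on) auto
  then show "f \<in> ell2 V" using assms(1) by (simp add: ell2_def)
  have "(\<Sum>\<^sub>\<infinity>v\<in>V. (cmod (f v))\<^sup>2) \<le> C\<^sup>2" using s le2 by (rule infsum_le_finite_sums)
  then show "ell2_norm V f \<le> C" unfolding ell2_norm_def using assms(2) by (rule real_le_lsqrt[rotated])
qed

lemma ell2_norm_nonneg: "0 \<le> ell2_norm V f"
  by (simp add: ell2_norm_def infsum_nonneg)

lemma L2_set_le_ell2_norm:
  assumes "f \<in> ell2 V" "finite S" "S \<subseteq> V"
  shows "L2_set (\<lambda>v. cmod (f v)) S \<le> ell2_norm V f"
proof -
  have "(\<Sum>v\<in>S. (cmod (f v))\<^sup>2) \<le> (\<Sum>\<^sub>\<infinity>v\<in>V. (cmod (f v))\<^sup>2)"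
    using assms by (intro finite_sum_le_infsum) (auto simp: ell2_def)
  then show ?thesis by (simp add: L2_set_def ell2_norm_def)
qed

lemma ell2_outside: "f \<in> ell2 V \<Longrightarrow> v \<notin> V \<Longrightarrow> f v = 0"
  by (simp add: ell2_def)

lemma cmod_le_ell2_norm:
  assumes "f \<in> ell2 V"
  shows "cmod (f v) \<le> ell2_norm V f"
proof (cases "v \<in> V")
  case True
  then show ?thesis using L2_set_le_ell2_norm[OF assms, of "{v}"] by simp
next
  case False
  then show ?thesis using ell2_outside[OF assms] ell2_norm_nonneg by simp
qed

lemma ell2_add:
  assumes "f \<in> ell2 V" "g \<in> ell2 V"
  shows "(\<lambda>v. f v + g v) \<in> ell2 V" "ell2_norm V (\<lambda>v. f v + g v) \<le> ell2_norm V f + ell2_norm V g"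
proof -
  have *: "L2_set (\<lambda>v. cmod (f v + g v)) S \<le> ell2_norm V f + ell2_norm V g" if "finite S" "S \<subseteq> V" for S
  proof -
    have "L2_set (\<lambda>v. cmod (f v + g v)) S \<le> L2_set (\<lambda>v. cmod (f v) + cmod (g v)) S"
      by (rule L2_set_mono) (auto intro: norm_triangle_ineq)
    also have "\<dots> \<le> L2_set (\<lambda>v. cmod (f v)) S + L2_set (\<lambda>v. cmod (g v)) S"
      by (rule L2_set_triangle_ineq)
    also have "\<dots> \<le> ell2_norm V f + ell2_norm V g"
      using assms that by (intro add_mono L2_set_le_ell2_norm)
    finally show ?thesis .
  qed
  show "(\<lambda>v. f v + g v) \<in> ell2 V"
    by (rule ell2I(1)[OF _ _ *]) (simp_all add: ell2_outside[OF assms(1)] ell2_outside[OF assms(2)] ell2_norm_nonneg)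
  show "ell2_norm V (\<lambda>v. f v + g v) \<le> ell2_norm V f + ell2_norm V g"
    by (rule ell2I(2)[OF _ _ *]) (simp_all add: ell2_outside[OF assms(1)] ell2_outside[OF assms(2)] ell2_norm_nonneg)
qed

lemma ell2_scale:
  assumes "f \<in> ell2 V"
  shows "(\<lambda>v. c * f v) \<in> ell2 V" "ell2_norm V (\<lambda>v. c * f v) \<le> cmod c * ell2_norm V f"
proof -
  have *: "L2_set (\<lambda>v. cmod (c * f v)) S \<le> cmod c * ell2_norm V f" if "finite S" "S \<subseteq> V" for S
    using L2_set_le_ell2_norm[OF assms that]
    by (simp add: norm_mult mult_left_mono flip: L2_set_right_distrib)
  show "(\<lambda>v. c * f v) \<in> ell2 V"
    by (rule ell2I(1)[OF _ _ *]) (simp_all add: ell2_outside[OF assms] ell2_norm_nonneg)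
  show "ell2_norm V (\<lambda>v. c * f v) \<le> cmod c * ell2_norm V f"
    by (rule ell2I(2)[OF _ _ *]) (simp_all add: ell2_outside[OF assms] ell2_norm_nonneg)
qed

lemma ell2_minus_scale:
  assumes "f \<in> ell2 V" "g \<in> ell2 V"
  shows "(\<lambda>v. f v - c * g v) \<in> ell2 V"
  using ell2_add(1)[OF assms(1) ell2_scale(1)[OF assms(2), of "- c"]] by simp

text \<open>Off the spectrum the shifted operator is bounded below, which is the form in which
  approximate eigenvectors will contradict invertibility.\<close>

lemma resolvent_bound:
  assumes "z \<notin> ell2_spectrum V A"
  obtains C where "0 \<le> C" "\<And>f. f \<in> ell2 V \<Longrightarrow> (\<lambda>v. A f v - z * f v) \<in> ell2 V \<Longrightarrow>
    ell2_norm V f \<le> C * ell2_norm V (\<lambda>v. A f v - z * f v)"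
proof -
  obtain B where B: "bounded_op V B"
    "\<And>f. f \<in> ell2 V \<Longrightarrow> B (\<lambda>v. A f v - z * f v) = f"
    using assms unfolding ell2_spectrum_def by auto
  then obtain C where C: "\<forall>f\<in>ell2 V. ell2_norm V (B f) \<le> C * ell2_norm V f"
    unfolding bounded_op_def by blast
  show thesis
  proof (rule that[of "max C 0"])
    fix f assume f: "f \<in> ell2 V" "(\<lambda>v. A f v - z * f v) \<in> ell2 V"
    have "ell2_norm V f = ell2_norm V (B (\<lambda>v. A f v - z * f v))" using B(2)[OF f(1)] by simp
    also have "\<dots> \<le> C * ell2_norm V (\<lambda>v. A f v - z * f v)" using C f(2) by blast
    also have "\<dots> \<le> max C 0 * ell2_norm V (\<lambda>v. A f v - z * f v)"
      by (intro mult_right_mono ell2_norm_nonneg) simp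
    finally show "ell2_norm V f \<le> max C 0 * ell2_norm V (\<lambda>v. A f v - z * f v)" .
  qed simp
qed

section \<open>Adjacency operators of graphs of bounded degree\<close>

locale bounded_degree_graph =
  fixes T :: "'a pair_pre_digraph" and D :: nat
  assumes parcs_sym: "(u, v) \<in> parcs T \<Longrightarrow> (v, u) \<in> parcs T"
    and parcs_verts: "(u, v) \<in> parcs T \<Longrightarrow> u \<in> pverts T"
    and finite_nbrs: "finite {v. (u, v) \<in> parcs T}" and card_nbrs: "card {v. (u, v) \<in> parcs T} \<le> D"
begin

abbreviation "V \<equiv> pverts T"
abbreviation "A \<equiv> adjacency_op T"

definition nbrs :: "'a \<Rightarrow> 'a set" where
  "nbrs u = {v. (u, v) \<in> parcs T}"

lemma A_nbrs: "A f u = (\<Sum>v\<in>nbrs u. f v)"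
  by (simp add: adjacency_op_def nbrs_def)

lemma nbrs: "finite (nbrs u)" "card (nbrs u) \<le> D" "v \<in> nbrs u \<longleftrightarrow> u \<in> nbrs v"
  using finite_nbrs card_nbrs parcs_sym by (auto simp: nbrs_def)

lemma nbrs_verts: "nbrs u \<subseteq> V"
  using parcs_verts[OF parcs_sym] by (auto simp: nbrs_def)

lemma A_outside: "u \<notin> V \<Longrightarrow> A f u = 0"
  using parcs_verts[of u] by (auto simp: A_nbrs nbrs_def intro: sum.neutral)

lemma A_add: "A (\<lambda>v. f v + g v) = (\<lambda>v. A f v + A g v)"
  and A_scale: "A (\<lambda>v. c * f v) = (\<lambda>v. c * A f v)"
  and A_diff: "A (\<lambda>v. f v - g v) = (\<lambda>v. A f v - A g v)"
  by (simp_all add: fun_eq_iff A_nbrs sum.distrib sum_distrib_left sum_subtractf)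

text \<open>Cauchy-Schwarz at each vertex costs one factor \<open>D\<close>; exchanging the sums
  costs another, since a vertex is a neighbour of at most \<open>D\<close> vertices.\<close>

lemma A_ell2:
  assumes f: "f \<in> ell2 V"
  shows "A f \<in> ell2 V" "ell2_norm V (A f) \<le> real D * ell2_norm V f"
proof -
  have "L2_set (\<lambda>v. cmod (A f v)) S \<le> real D * ell2_norm V f" if S: "finite S" "S \<subseteq> V" for S
  proof -
    let ?U = "\<Union>u\<in>S. nbrs u"
    have U: "finite ?U" "?U \<subseteq> V" using S(1) nbrs(1) nbrs_verts by blast+
    have "(\<Sum>u\<in>S. (cmod (A f u))\<^sup>2) \<le> (\<Sum>u\<in>S. real D * (\<Sum>v\<in>nbrs u. (cmod (f v))\<^sup>2))"
    proof (rule sum_mono)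
      fix u
      have "(cmod (A f u))\<^sup>2 \<le> (\<Sum>v\<in>nbrs u. cmod (f v))\<^sup>2"
        unfolding A_nbrs by (intro power_mono norm_sum) simp
      also have "\<dots> \<le> (\<Sum>v\<in>nbrs u. (cmod (f v))\<^sup>2) * card (nbrs u)"
        by (rule sum_squared_le_sum_of_squares)
      also have "\<dots> \<le> (\<Sum>v\<in>nbrs u. (cmod (f v))\<^sup>2) * D"
        using nbrs(2) by (intro mult_left_mono of_nat_mono sum_nonneg) auto
      finally show "(cmod (A f u))\<^sup>2 \<le> real D * (\<Sum>v\<in>nbrs u. (cmod (f v))\<^sup>2)" by (simp add: mult.commute)
    qed
    also have "\<dots> = real D * (\<Sum>u\<in>S. \<Sum>v\<in>nbrs u. (cmod (f v))\<^sup>2)" by (simp add: sum_distrib_left)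
    also have "(\<Sum>u\<in>S. \<Sum>v\<in>nbrs u. (cmod (f v))\<^sup>2) = (\<Sum>u\<in>S. \<Sum>v | v \<in> ?U \<and> v \<in> nbrs u. (cmod (f v))\<^sup>2)"
      by (intro sum.cong refl) auto
    also have "\<dots> = (\<Sum>v\<in>?U. \<Sum>u | u \<in> S \<and> v \<in> nbrs u. (cmod (f v))\<^sup>2)"
      using S(1) U(1) by (rule sum.swap_restrict)
    also have "\<dots> \<le> (\<Sum>v\<in>?U. real D * (cmod (f v))\<^sup>2)"
    proof (rule sum_mono)
      fix v
      have "{u. u \<in> S \<and> v \<in> nbrs u} \<subseteq> nbrs v" using nbrs(3) by auto
      then have "card {u. u \<in> S \<and> v \<in> nbrs u} \<le> D" using card_mono[OF nbrs(1)] nbrs(2) order_trans by blast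
      then show "(\<Sum>u | u \<in> S \<and> v \<in> nbrs u. (cmod (f v))\<^sup>2) \<le> real D * (cmod (f v))\<^sup>2"
        by (simp add: mult_right_mono)
    qed
    finally have "(\<Sum>u\<in>S. (cmod (A f u))\<^sup>2) \<le> real D * (\<Sum>v\<in>?U. real D * (cmod (f v))\<^sup>2)"
      by (simp add: mult_left_mono)
    also have "\<dots> = (real D * L2_set (\<lambda>v. cmod (f v)) ?U)\<^sup>2"
      by (simp add: L2_set_def power_mult_distrib sum_nonneg power2_eq_square[of "real D"] flip: sum_distrib_left)
    also have "\<dots> \<le> (real D * ell2_norm V f)\<^sup>2"
      using L2_set_le_ell2_norm[OF f U] by (intro power_mono mult_left_mono) auto
    finally have "(\<Sum>u\<in>S. (cmod (A f u))\<^sup>2) \<le> (real D * ell2_norm V f)\<^sup>2" .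
    then show ?thesis unfolding L2_set_def by (intro real_le_lsqrt mult_nonneg_nonneg ell2_norm_nonneg) auto
  qed
  note * = this
  show "A f \<in> ell2 V"
    by (rule ell2I(1)[OF _ _ *]) (simp_all add: A_outside ell2_norm_nonneg)
  show "ell2_norm V (A f) \<le> real D * ell2_norm V f"
    by (rule ell2I(2)[OF _ _ *]) (simp_all add: A_outside ell2_norm_nonneg)
qed

lemma A_pow_ell2:
  assumes "f \<in> ell2 V"
  shows "(A ^^ n) f \<in> ell2 V" "ell2_norm V ((A ^^ n) f) \<le> real D ^ n * ell2_norm V f"
proof -
  have "(A ^^ n) f \<in> ell2 V \<and> ell2_norm V ((A ^^ n) f) \<le> real D ^ n * ell2_norm V f"
  proof (induction n)
    case (Suc n)
    then have "ell2_norm V (A ((A ^^ n) f)) \<le> real D * (real D ^ n * ell2_norm V f)"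
      using A_ell2(2)[of "(A ^^ n) f"] by (meson mult_left_mono of_nat_0_le_iff order_trans)
    then show ?case using A_ell2(1) Suc by simp
  qed (use assms in simp)
  then show "(A ^^ n) f \<in> ell2 V" "ell2_norm V ((A ^^ n) f) \<le> real D ^ n * ell2_norm V f" by auto
qed

lemma A_pow_add: "(A ^^ n) (\<lambda>v. f v + g v) = (\<lambda>v. (A ^^ n) f v + (A ^^ n) g v)"
  and A_pow_scale: "(A ^^ n) (\<lambda>v. c * f v) = (\<lambda>v. c * (A ^^ n) f v)"
  by (induction n) (simp_all add: A_add A_scale)

lemma A_pow_minus_scale: "(A ^^ n) (\<lambda>v. A f v - c * f v) = (\<lambda>v. (A ^^ Suc n) f v - c * (A ^^ n) f v)"
  using A_pow_add[of n "A f" "\<lambda>v. - c * f v"] A_pow_scale[of n "- c" f]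
  by (simp add: funpow_swap1)

text \<open>The resolvent is given by the Neumann series.\<close>

lemma not_spectrum:
  assumes z: "real D < cmod z"
  shows "z \<notin> ell2_spectrum V A"
proof -
  define x where "x f n u = (A ^^ n) f u / z ^ Suc n" for f n u
  define B where "B f u = - (\<Sum>n. x f n u)" for f u
  have z0: "0 < cmod z" using z by (meson le_less_trans of_nat_0_le_iff)
  then have zn: "z \<noteq> 0" by auto
  have q: "norm (real D / cmod z) < 1" using z z0 by simp
  have bnd: "cmod (x f n u) \<le> ell2_norm V f / cmod z * (real D / cmod z) ^ n" if "f \<in> ell2 V" for f n u
  proof -
    have "cmod ((A ^^ n) f u) \<le> real D ^ n * ell2_norm V f"
      by (rule order_trans[OF cmod_le_ell2_norm[OF A_pow_ell2(1)[OF that]] A_pow_ell2(2)[OF that]])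
    then have "cmod ((A ^^ n) f u) / cmod z ^ Suc n \<le> real D ^ n * ell2_norm V f / cmod z ^ Suc n"
      using z0 by (intro divide_right_mono) auto
    then show ?thesis by (simp add: x_def norm_divide norm_mult norm_power power_divide mult_ac)
  qed
  have sx: "summable (\<lambda>n. x f n u)" if "f \<in> ell2 V" for f u
    by (rule summable_comparison_test'[OF summable_mult[OF summable_geometric[OF q]], of 0])
      (rule bnd[OF that])
  define C where "C = 1 / cmod z * (1 / (1 - real D / cmod z))"
  have C0: "0 \<le> C" using q z0 by (simp add: C_def)
  have partial: "(\<lambda>u. \<Sum>n<M. x f n u) \<in> ell2 V \<and> ell2_norm V (\<lambda>u. \<Sum>n<M. x f n u) \<le> C * ell2_norm V f"
    if f: "f \<in> ell2 V" for f M
  proof -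
    have xn: "(\<lambda>u. x f n u) \<in> ell2 V" "ell2_norm V (\<lambda>u. x f n u) \<le> ell2_norm V f / cmod z * (real D / cmod z) ^ n" for n
    proof -
      have eq: "(\<lambda>u. x f n u) = (\<lambda>u. inverse (z ^ Suc n) * (A ^^ n) f u)"
        by (simp add: x_def divide_inverse mult.commute)
      show "(\<lambda>u. x f n u) \<in> ell2 V" unfolding eq using A_pow_ell2(1)[OF f] by (rule ell2_scale)
      have "ell2_norm V (\<lambda>u. x f n u) \<le> cmod (inverse (z ^ Suc n)) * (real D ^ n * ell2_norm V f)"
        unfolding eq using ell2_scale(2)[OF A_pow_ell2(1)[OF f], of "inverse (z ^ Suc n)" n] A_pow_ell2(2)[OF f, of n]
        by (meson mult_left_mono norm_ge_zero order_trans)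
      then show "ell2_norm V (\<lambda>u. x f n u) \<le> ell2_norm V f / cmod z * (real D / cmod z) ^ n"
        by (simp only: norm_inverse norm_mult norm_power power_Suc divide_inverse
            inverse_mult_distrib power_mult_distrib power_inverse mult_ac)
    qed
    have "(\<lambda>u. \<Sum>n<M. x f n u) \<in> ell2 V \<and>
      ell2_norm V (\<lambda>u. \<Sum>n<M. x f n u) \<le> (\<Sum>n<M. ell2_norm V f / cmod z * (real D / cmod z) ^ n)"
    proof (induction M)
      case 0
      show ?case using ell2I[of V "\<lambda>_. 0" 0] by (simp add: L2_set_def)
    next
      case (Suc M)
      then show ?case
        using ell2_add[of "\<lambda>u. \<Sum>n<M. x f n u" V "\<lambda>u. x f M u"] xn(1)[of M] xn(2)[of M] by auto
    qed
    moreover have "(\<Sum>n<M. ell2_norm V f / cmod z * (real D / cmod z) ^ n) \<le> C * ell2_norm V f"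
    proof -
      have "(\<Sum>n<M. (real D / cmod z) ^ n) \<le> (\<Sum>n. (real D / cmod z) ^ n)"
        using summable_geometric[OF q] z0 by (intro sum_le_suminf) auto
      also have "\<dots> = 1 / (1 - real D / cmod z)" using q by (rule suminf_geometric)
      finally have "ell2_norm V f / cmod z * (\<Sum>n<M. (real D / cmod z) ^ n)
          \<le> ell2_norm V f / cmod z * (1 / (1 - real D / cmod z))"
        using ell2_norm_nonneg[of V f] z0 by (intro mult_left_mono) auto
      then show ?thesis unfolding sum_distrib_left[symmetric] C_def by (simp add: mult_ac)
    qed
    ultimately show ?thesis by linarith
  qed
  \<comment> \<open>The series is summed pointwise. The norm bound of its partial sums passes to the
    limit on every finite set, which suffices by \<open>ell2I\<close>.\<close>
  have B: "B f \<in> ell2 V \<and> ell2_norm V (B f) \<le> C * ell2_norm V f" if f: "f \<in> ell2 V" for f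
  proof -
    have *: "L2_set (\<lambda>u. cmod (B f u)) S \<le> C * ell2_norm V f" if S: "finite S" "S \<subseteq> V" for S
    proof (rule LIMSEQ_le_const2)
      show "(\<lambda>M. L2_set (\<lambda>u. cmod (\<Sum>n<M. x f n u)) S) \<longlonglongrightarrow> L2_set (\<lambda>u. cmod (B f u)) S"
        unfolding L2_set_def B_def norm_minus_cancel
        using summable_LIMSEQ[OF sx[OF f]] by (intro tendsto_intros)
      show "\<exists>N. \<forall>M\<ge>N. L2_set (\<lambda>u. cmod (\<Sum>n<M. x f n u)) S \<le> C * ell2_norm V f"
        using L2_set_le_ell2_norm[OF _ S] partial[OF f] order_trans by blast
    qed
    have "B f u = 0" if "u \<notin> V" for u
      using that ell2_outside[OF A_pow_ell2(1)[OF f]] by (simp add: B_def x_def)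
    then show ?thesis using C0 ell2_norm_nonneg[of V f] ell2I[OF _ _ *] by simp
  qed
  have "bounded_op V B"
    unfolding bounded_op_def
  proof (intro conjI ballI allI)
    fix f g assume f: "f \<in> ell2 V" and g: "g \<in> ell2 V"
    show "B (\<lambda>v. f v + g v) = (\<lambda>v. B f v + B g v)"
    proof
      fix u
      have "x (\<lambda>v. f v + g v) n u = x f n u + x g n u" for n
        by (simp add: x_def A_pow_add add_divide_distrib)
      then show "B (\<lambda>v. f v + g v) u = B f u + B g u"
        by (simp add: B_def flip: suminf_add[OF sx[OF f, of u] sx[OF g, of u]])
    qed
  next
    fix f c assume f: "f \<in> ell2 V"
    show "B (\<lambda>v. c * f v) = (\<lambda>v. c * B f v)"
    proof
      fix u
      have "x (\<lambda>v. c * f v) n u = c * x f n u" for n by (simp add: x_def A_pow_scale)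
      then show "B (\<lambda>v. c * f v) u = c * B f u"
        using suminf_mult[OF sx[OF f, of u], of c] by (simp add: B_def)
    qed
  qed (use B in blast)+
  moreover have "B (\<lambda>v. A f v - z * f v) = f \<and> (\<lambda>v. A (B f) v - z * B f v) = f" if f: "f \<in> ell2 V" for f
  proof -
    \<comment> \<open>Both resolvent identities reduce to the telescoping series with terms
      \<open>y u (Suc n) - y u n\<close>, whose sum is \<open>- f u\<close>.\<close>
    define y where "y u n = (A ^^ n) f u / z ^ n" for u n
    have zx: "z * x f n u = y u n" for n u using zn by (simp add: x_def y_def)
    have "(\<lambda>n. z * x f n u) \<longlonglongrightarrow> z * 0" for u
      by (intro tendsto_intros summable_LIMSEQ_zero[OF sx[OF f]])
    then have "y u \<longlonglongrightarrow> 0" for u by (simp add: zx)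
    then have tel: "(\<lambda>n. y u (Suc n) - y u n) sums (- f u)" for u
      using telescope_sums[of "y u" 0] by (simp add: y_def)
    have "B (\<lambda>v. A f v - z * f v) u = f u" for u
    proof -
      have "x (\<lambda>v. A f v - z * f v) n u = y u (Suc n) - y u n" for n
        unfolding x_def A_pow_minus_scale y_def using zn by (simp add: diff_divide_distrib)
      then show ?thesis using sums_unique[OF tel[of u], symmetric] by (simp add: B_def)
    qed
    moreover have "A (B f) u - z * B f u = f u" for u
    proof -
      have sumx: "(\<Sum>v\<in>nbrs u. x f n v) = y u (Suc n)" for n
        by (simp add: x_def y_def A_nbrs sum_divide_distrib)
      have "A (B f) u = - (\<Sum>v\<in>nbrs u. \<Sum>n. x f n v)" by (simp add: A_nbrs B_def sum_negf)
      also have "(\<Sum>v\<in>nbrs u. \<Sum>n. x f n v) = (\<Sum>n. \<Sum>v\<in>nbrs u. x f n v)"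
        by (rule suminf_sum[symmetric]) (rule sx[OF f])
      also have "\<dots> = (\<Sum>n. y u (Suc n))" by (simp add: sumx)
      finally have 1: "A (B f) u = - (\<Sum>n. y u (Suc n))" .
      have sy: "summable (\<lambda>n. y u (Suc n))"
        using summable_sum[of "nbrs u" "\<lambda>v n. x f n v", OF sx[OF f]] by (simp add: sumx)
      have "z * (\<Sum>n. x f n u) = (\<Sum>n. y u n)" using suminf_mult[OF sx[OF f], of z u] by (simp add: zx)
      then have 2: "z * B f u = - (\<Sum>n. y u n)" by (simp add: B_def)
      have sy': "summable (y u)" using sx[OF f, of u] summable_mult[of "\<lambda>n. x f n u" z] by (simp add: zx)
      have "(\<Sum>n. y u (Suc n)) - (\<Sum>n. y u n) = - f u"
        using suminf_diff[OF sy sy'] sums_unique[OF tel[of u], symmetric] by simp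
      with 1 2 show ?thesis by (simp add: algebra_simps)
    qed
    ultimately show ?thesis by auto
  qed
  ultimately show ?thesis unfolding ell2_spectrum_def by blast
qed

text \<open>The Neumann series bounds the spectrum, so the supremum defining the radius is a genuine
  upper bound.\<close>

lemma cmod_le_spectral_radius:
  assumes "z \<in> ell2_spectrum V A"
  shows "cmod z \<le> ell2_spectral_radius V A"
  unfolding ell2_spectral_radius_def
proof (rule cSUP_upper[OF assms])
  show "bdd_above (cmod ` ell2_spectrum V A)"
    by (rule bdd_aboveI[of _ "real D"]) (use not_spectrum in \<open>force simp: not_less\<close>)
qed

end

section \<open>Walks in the universal covering tree\<close>

context fin_digraph
begin

definition tree_verts :: "'a \<Rightarrow> ('b \<times> bool) list set" where
  "tree_verts r = {p. reduced p \<and> (\<exists>v. path G r p v)}"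

lemma pverts_universal_cover [simp]: "pverts (universal_cover G r) = tree_verts r"
  and parcs_universal_cover: "(p, q) \<in> parcs (universal_cover G r) \<longleftrightarrow>
    p \<in> tree_verts r \<and> q \<in> tree_verts r \<and> (\<exists>d. q = p @ [d] \<or> p = q @ [d])"
  by (simp_all add: universal_cover_def tree_verts_def Let_def)

lemma universal_cover_nbrs:
  "{q. (p, q) \<in> parcs (universal_cover G r)} \<subseteq> (\<lambda>d. reduce (p @ [d])) ` (arcs G \<times> UNIV)"
proof
  fix q assume "q \<in> {q. (p, q) \<in> parcs (universal_cover G r)}"
  then obtain d where p: "p \<in> tree_verts r" and q: "q \<in> tree_verts r" and d: "q = p @ [d] \<or> p = q @ [d]"
    by (auto simp: parcs_universal_cover)
  have sets: "set p \<subseteq> arcs G \<times> UNIV" "set q \<subseteq> arcs G \<times> UNIV" and r: "reduced p" "reduced q"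
    using p q path_set by (auto simp: tree_verts_def)
  from d show "q \<in> (\<lambda>d. reduce (p @ [d])) ` (arcs G \<times> UNIV)"
  proof
    assume "q = p @ [d]"
    then show ?thesis using sets r by (intro image_eqI[of _ _ d]) auto
  next
    assume pq: "p = q @ [d]"
    then have "d \<in> arcs G \<times> UNIV" using sets by auto
    moreover have "reduce (p @ [inv_letter d]) = q"
      using reduce_end_cancel(1)[of q "[d]"] r pq by simp
    ultimately show ?thesis by (intro image_eqI[of _ _ "inv_letter d"]) simp_all
  qed
qed

definition degree_bound :: nat where
  "degree_bound = card (arcs G \<times> (UNIV :: bool set))"

lemma bounded_degree_universal_cover: "bounded_degree_graph (universal_cover G r) degree_bound"
proof
  fix p q
  show "(q, p) \<in> parcs (universal_cover G r)" if "(p, q) \<in> parcs (universal_cover G r)"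
    using that by (auto simp: parcs_universal_cover)
  show "p \<in> pverts (universal_cover G r)" if "(p, q) \<in> parcs (universal_cover G r)"
    using that by (simp add: parcs_universal_cover)
  have fin: "finite ((\<lambda>d. reduce (p @ [d])) ` (arcs G \<times> (UNIV :: bool set)))" by simp
  show "finite {q. (p, q) \<in> parcs (universal_cover G r)}"
    using universal_cover_nbrs fin by (rule finite_subset)
  have "card {q. (p, q) \<in> parcs (universal_cover G r)} \<le> card ((\<lambda>d. reduce (p @ [d])) ` (arcs G \<times> (UNIV :: bool set)))"
    by (rule card_mono[OF fin universal_cover_nbrs])
  also have "\<dots> \<le> degree_bound" unfolding degree_bound_def by (rule card_image_le) simp
  finally show "card {q. (p, q) \<in> parcs (universal_cover G r)} \<le> degree_bound" .
qed

text \<open>Walks in the covering tree from \<open>p\<close> to \<open>q\<close>. The radius refers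
  to a tree with one fixed root, so a walk starting over another vertex \<open>a\<close> starts at a
  tree vertex \<open>p\<close> lying over \<open>a\<close>.\<close>

definition reach :: "('b \<times> bool) list \<Rightarrow> 'a \<Rightarrow> nat \<Rightarrow> ('b \<times> bool) list \<Rightarrow> ('b \<times> bool) list set" where
  "reach p a t q = {w \<in> words a t. reduce (p @ w) = q}"

text \<open>The iterates of the adjacency operator on the indicator function of
  \<open>p\<close>.\<close>

definition walk_count :: "('b \<times> bool) list \<Rightarrow> 'a \<Rightarrow> nat \<Rightarrow> ('b \<times> bool) list \<Rightarrow> complex" where
  "walk_count p a t q = of_nat (card (reach p a t q))"

context
  fixes r a :: 'a and p :: "('b \<times> bool) list"
  assumes p: "path G r p a" "reduced p"
begin

interpretation T: bounded_degree_graph "universal_cover G r" degree_bound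
  by (rule bounded_degree_universal_cover)

lemma reach_tree: "w \<in> words a t \<Longrightarrow> reduce (p @ w) \<in> tree_verts r"
proof -
  assume "w \<in> words a t"
  then obtain x where "path G a w x" by (auto simp: words_def)
  then have "path G r (p @ w) x" using p(1) path_append by blast
  then have "path G r (reduce (p @ w)) x" by (rule path_reduce)
  then show ?thesis by (auto simp: tree_verts_def)
qed

lemma finite_reach [simp]: "finite (reach p a t q)"
  unfolding reach_def by simp

text \<open>The last letter can be restored because it labels the tree edge from the previous vertex
  to \<open>q\<close>.\<close>

lemma reach_Suc:
  assumes q: "q \<in> tree_verts r"
  shows "bij_betw butlast (reach p a (Suc t) q) (\<Union>q'\<in>T.nbrs q. reach p a t q')"
proof (rule bij_betwI')
  fix w w' assume w: "w \<in> reach p a (Suc t) q" and w': "w' \<in> reach p a (Suc t) q"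
  show "(butlast w = butlast w') = (w = w')"
  proof
    assume eq: "butlast w = butlast w'"
    have "w \<noteq> []" "w' \<noteq> []" using w w' by (auto simp: reach_def words_def)
    then obtain u d d' where u: "w = u @ [d]" "w' = u @ [d']" using eq by (metis append_butlast_last_id)
    have "reduce ((p @ u) @ [d]) = reduce ((p @ u) @ [d'])" using w w' by (simp add: reach_def u)
    then have "reduce [d] = reduce [d']" by (simp only: reduce_cancel_left)
    then show "w = w'" by (simp add: u)
  qed simp
next
  fix w assume w: "w \<in> reach p a (Suc t) q"
  then have "w \<noteq> []" by (auto simp: reach_def words_def)
  then obtain u d where wd: "w = u @ [d]" by (metis append_butlast_last_id)
  have u: "u \<in> words a t" using w path_append by (auto simp: reach_def words_def wd)
  let ?q = "reduce (p @ u)"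
  have "q = reduce (?q @ [d])" using w by (simp add: reach_def wd)
  then have q_eq: "q = (if ?q \<noteq> [] \<and> last ?q = inv_letter d then butlast ?q else ?q @ [d])"
    by (rule trans[OF _ reduce_snoc[OF reduced_reduce]])
  have "\<exists>e. q = ?q @ [e] \<or> ?q = q @ [e]"
  proof (cases "?q \<noteq> [] \<and> last ?q = inv_letter d")
    case True
    then have "?q = q @ [inv_letter d]" using q_eq append_butlast_last_id[of ?q] by simp
    then show ?thesis by blast
  next
    case False
    then show ?thesis using q_eq by auto
  qed
  then have "?q \<in> T.nbrs q" using q reach_tree[OF u] by (auto simp: T.nbrs_def parcs_universal_cover)
  moreover have "u \<in> reach p a t ?q" using u by (simp add: reach_def)
  ultimately show "butlast w \<in> (\<Union>q'\<in>T.nbrs q. reach p a t q')" by (auto simp: wd)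
next
  fix u assume "u \<in> (\<Union>q'\<in>T.nbrs q. reach p a t q')"
  then obtain q' where q': "q' \<in> T.nbrs q" and u: "u \<in> words a t" "reduce (p @ u) = q'"
    by (auto simp: reach_def)
  then obtain d where "q' = q @ [d] \<or> q = q' @ [d]" by (auto simp: T.nbrs_def parcs_universal_cover)
  then obtain e where e: "reduce (q' @ [e]) = q" "q = q' @ [e] \<or> q' = q @ [inv_letter e]"
  proof
    assume "q' = q @ [d]"
    moreover have "reduce q = q" using q by (simp add: tree_verts_def)
    ultimately show thesis
      using reduce_end_cancel(1)[of q "[d]"] by (intro that[of "inv_letter d"]) simp_all
  next
    assume "q = q' @ [d]"
    moreover have "reduce q = q" using q by (simp add: tree_verts_def)
    ultimately show thesis by (intro that[of d]) simp_all
  qed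
  obtain c where c: "path G a u c" using u(1) by (auto simp: words_def)
  then have q'c: "path G r q' c" using path_reduce[of r "p @ u" c] path_append p(1) u(2) by auto
  obtain b where b: "path G r q b" using q by (auto simp: tree_verts_def)
  have "path G c [e] b"
    using e(2)
  proof
    assume "q = q' @ [e]"
    then show ?thesis using b q'c path_append path_unique by blast
  next
    assume "q' = q @ [inv_letter e]"
    then obtain x where "path G r q x" "path G x [inv_letter e] c" using q'c path_append by blast
    then have "path G b (winv [e]) c" using b path_unique by (metis append_Nil winv_Cons winv_Nil)
    then show ?thesis by (simp only: path_winv_iff)
  qed
  then have "path G a (u @ [e]) b" using c path_append by blast
  then have "u @ [e] \<in> words a (Suc t)" using u(1) by (auto simp: words_def)
  moreover have "reduce (p @ u @ [e]) = q" using e(1) u(2) by (metis append_assoc reduce_reduce_append)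
  ultimately show "\<exists>w\<in>reach p a (Suc t) q. u = butlast w"
    by (intro bexI[of _ "u @ [e]"]) (simp_all add: reach_def)
qed

lemma adjacency_walk_count:
  "adjacency_op (universal_cover G r) (walk_count p a t) = walk_count p a (Suc t)"
proof
  fix q
  show "adjacency_op (universal_cover G r) (walk_count p a t) q = walk_count p a (Suc t) q"
  proof (cases "q \<in> tree_verts r")
    case True
    have "card (reach p a (Suc t) q) = card (\<Union>q'\<in>T.nbrs q. reach p a t q')"
      using reach_Suc[OF True] by (rule bij_betw_same_card)
    also have "\<dots> = (\<Sum>q'\<in>T.nbrs q. card (reach p a t q'))"
      using T.nbrs(1) by (intro card_UN_disjoint) (auto simp: reach_def)
    finally show ?thesis by (simp add: T.A_nbrs walk_count_def)
  next
    case False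
    then have "reach p a (Suc t) q = {}" using reach_tree by (auto simp: reach_def)
    then show ?thesis using T.A_outside[of q] False by (simp add: walk_count_def)
  qed
qed

definition ball_verts :: "nat \<Rightarrow> ('b \<times> bool) list set" where
  "ball_verts t = (\<lambda>w. reduce (p @ w)) ` words a t"

lemma finite_ball_verts [simp]: "finite (ball_verts t)"
  by (simp add: ball_verts_def)

lemma reach_empty: "q \<notin> ball_verts t \<Longrightarrow> reach p a t q = {}"
  by (auto simp: reach_def ball_verts_def)

text \<open>The inner product of two iterates; by symmetry of the operator it depends only on the
  total length. \<open>Q\<close> is left free so that different iterates can be compared on one
  finite set.\<close>

lemma sum_reach_mult:
  assumes Q: "finite Q" "ball_verts s \<subseteq> Q"
  shows "(\<Sum>q\<in>Q. card (reach p a s q) * card (reach p a t q)) = card (walks a (s + t) [])"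
proof -
  let ?S = "SIGMA q:Q. reach p a s q \<times> reach p a t q"
  have "bij_betw (\<lambda>(q, w, w'). w @ winv w') ?S (walks a (s + t) [])"
  proof (rule bij_betw_byWitness[where f' = "\<lambda>w. (reduce (p @ take s w), take s w, winv (drop s w))"])
    show "\<forall>y\<in>?S. (\<lambda>w. (reduce (p @ take s w), take s w, winv (drop s w))) ((\<lambda>(q, w, w'). w @ winv w') y) = y"
      by (auto simp: reach_def words_def)
    show "\<forall>w\<in>walks a (s + t) []. (\<lambda>(q, w, w'). w @ winv w') (reduce (p @ take s w), take s w, winv (drop s w)) = w"
      by simp
    show "(\<lambda>(q, w, w'). w @ winv w') ` ?S \<subseteq> walks a (s + t) []"
    proof
      fix y assume "y \<in> (\<lambda>(q, w, w'). w @ winv w') ` ?S"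
      then obtain q w x where y: "y = w @ winv x" and wx: "w \<in> reach p a s q" "x \<in> reach p a t q" by auto
      then have "reduce (p @ w) = reduce (p @ x)" by (simp add: reach_def)
      then have r: "reduce w = reduce x" by (simp only: reduce_cancel_left)
      obtain b c where b: "path G a w b" "path G a x c" and l: "length w = s" "length x = t"
        using wx by (auto simp: reach_def words_def)
      have "path G a (reduce w) b" "path G a (reduce w) c"
        using path_reduce[OF b(1)] path_reduce[OF b(2)] r by auto
      then have "b = c" by (rule path_unique)
      then have "path G a (w @ winv x) a" using b path_winv path_append by blast
      moreover have "reduce (w @ winv x) = []" using r by (simp add: reduce_append_winv_eq_Nil_iff)
      ultimately show "y \<in> walks a (s + t) []" using l y by (auto simp: walks_def words_def)
    qed
    show "(\<lambda>w. (reduce (p @ take s w), take s w, winv (drop s w))) ` walks a (s + t) [] \<subseteq> ?S"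
    proof
      fix y assume "y \<in> (\<lambda>w. (reduce (p @ take s w), take s w, winv (drop s w))) ` walks a (s + t) []"
      then obtain w b where w: "path G a w b" "length w = s + t" "reduce w = []"
        and y: "y = (reduce (p @ take s w), take s w, winv (drop s w))"
        by (auto simp: walks_def words_def)
      obtain c where c: "path G a (take s w) c" "path G c (drop s w) b"
        using w(1) path_append[of a "take s w" "drop s w" b] by auto
      have "path G a [] b" using path_reduce[OF w(1)] unfolding w(3) .
      then have "a = b" by simp
      have "path G a (winv (drop s w)) c" unfolding \<open>a = b\<close> using c(2) by (rule path_winv)
      moreover have "reduce (take s w @ winv (winv (drop s w))) = []" using w(3) by simp
      then have "reduce (winv (drop s w)) = reduce (take s w)"
        unfolding reduce_append_winv_eq_Nil_iff by simp
      then have "reduce (p @ winv (drop s w)) = reduce (p @ take s w)" by (simp only: reduce_cancel_left)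
      moreover have ts: "take s w \<in> words a s" using c w(2) by (auto simp: words_def)
      moreover have "reduce (p @ take s w) \<in> Q" using ts Q(2) unfolding ball_verts_def by blast
      ultimately show "y \<in> ?S"
        using w(2) by (auto simp: y reach_def words_def)
    qed
  qed
  then have "card ?S = card (walks a (s + t) [])" by (rule bij_betw_same_card)
  then show ?thesis using Q(1) by (simp add: card_cartesian_product)
qed

section \<open>Moments of the adjacency operator\<close>

lemma ell2_norm_finite_support:
  assumes "finite Q" "Q \<subseteq> V" "\<And>q. q \<notin> Q \<Longrightarrow> f q = 0"
  shows "f \<in> ell2 V" "(ell2_norm V f)\<^sup>2 = (\<Sum>q\<in>Q. (cmod (f q))\<^sup>2)"
proof -
  have "(\<lambda>v. (cmod (f v))\<^sup>2) summable_on V \<longleftrightarrow> (\<lambda>v. (cmod (f v))\<^sup>2) summable_on Q"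
    using assms by (intro summable_on_cong_neutral) auto
  then show "f \<in> ell2 V" using assms by (auto simp: ell2_def)
  have "(\<Sum>\<^sub>\<infinity>v\<in>V. (cmod (f v))\<^sup>2) = (\<Sum>\<^sub>\<infinity>v\<in>Q. (cmod (f v))\<^sup>2)"
    using assms by (intro infsum_cong_neutral) auto
  then show "(ell2_norm V f)\<^sup>2 = (\<Sum>q\<in>Q. (cmod (f q))\<^sup>2)"
    using assms(1) by (simp add: ell2_norm_def sum_nonneg)
qed

text \<open>The even moments of the operator at a tree vertex over \<open>a\<close>, which are also
  the squared norms of the iterates.\<close>

definition return_count :: "nat \<Rightarrow> real" where
  "return_count t = real (card (walks a (2 * t) []))"

lemma ball_verts_tree: "ball_verts t \<subseteq> tree_verts r"
  using reach_tree by (auto simp: ball_verts_def)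

lemma walk_count_ell2: "walk_count p a t \<in> ell2 (tree_verts r)"
  using ball_verts_tree by (intro ell2_norm_finite_support(1)[of "ball_verts t"])
    (auto simp: walk_count_def reach_empty)

lemma sum_reach_mult':
  assumes Q: "finite Q" "ball_verts s \<subseteq> Q"
  shows "(\<Sum>q\<in>Q. real (card (reach p a s q)) * real (card (reach p a t q))) = real (card (walks a (s + t) []))"
  using sum_reach_mult[OF assms, of t] by (metis (mono_tags, lifting) of_nat_mult of_nat_sum sum.cong)

lemma norm_walk_count: "(ell2_norm (tree_verts r) (walk_count p a t))\<^sup>2 = return_count t"
proof -
  have "(ell2_norm (tree_verts r) (walk_count p a t))\<^sup>2 = (\<Sum>q\<in>ball_verts t. (cmod (walk_count p a t q))\<^sup>2)"
    using ball_verts_tree by (intro ell2_norm_finite_support(2)) (auto simp: walk_count_def reach_empty)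
  also have "\<dots> = return_count t"
    using sum_reach_mult'[of "ball_verts t" t t] by (simp add: walk_count_def return_count_def power2_eq_square mult_2)
  finally show ?thesis .
qed

text \<open>The squared norm of \<open>A^2 - c\<close> applied to an iterate, expanded in
  moments.\<close>

lemma norm_walk_count_diff:
  "(ell2_norm (tree_verts r) (\<lambda>q. walk_count p a (Suc (Suc t)) q - of_real c * walk_count p a t q))\<^sup>2
    = return_count (Suc (Suc t)) - 2 * c * return_count (Suc t) + c\<^sup>2 * return_count t"
proof -
  let ?Q = "ball_verts t \<union> ball_verts (Suc (Suc t))"
  let ?n = "\<lambda>s q. real (card (reach p a s q))"
  have "(ell2_norm (tree_verts r) (\<lambda>q. walk_count p a (Suc (Suc t)) q - of_real c * walk_count p a t q))\<^sup>2
      = (\<Sum>q\<in>?Q. (cmod (walk_count p a (Suc (Suc t)) q - of_real c * walk_count p a t q))\<^sup>2)"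
    using ball_verts_tree by (intro ell2_norm_finite_support(2)) (auto simp: walk_count_def reach_empty)
  also have "\<dots> = (\<Sum>q\<in>?Q. (?n (Suc (Suc t)) q - c * ?n t q)\<^sup>2)"
  proof (rule sum.cong[OF refl])
    fix q
    have "walk_count p a (Suc (Suc t)) q - of_real c * walk_count p a t q = of_real (?n (Suc (Suc t)) q - c * ?n t q)"
      by (simp add: walk_count_def)
    then show "(cmod (walk_count p a (Suc (Suc t)) q - of_real c * walk_count p a t q))\<^sup>2 = (?n (Suc (Suc t)) q - c * ?n t q)\<^sup>2"
      by (simp only: norm_of_real power2_abs)
  qed
  also have "\<dots> = (\<Sum>q\<in>?Q. ?n (Suc (Suc t)) q * ?n (Suc (Suc t)) q) - 2 * c * (\<Sum>q\<in>?Q. ?n (Suc (Suc t)) q * ?n t q)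
      + c\<^sup>2 * (\<Sum>q\<in>?Q. ?n t q * ?n t q)"
  proof -
    have "(x - c * y)\<^sup>2 = x * x - 2 * c * (x * y) + c\<^sup>2 * (y * y)" for x y :: real
      by (simp add: power2_eq_square algebra_simps)
    then show ?thesis by (simp only: sum.distrib sum_subtractf sum_distrib_left)
  qed
  also have "\<dots> = return_count (Suc (Suc t)) - 2 * c * return_count (Suc t) + c\<^sup>2 * return_count t"
  proof -
    have Q: "finite ?Q" "ball_verts t \<subseteq> ?Q" "ball_verts (Suc (Suc t)) \<subseteq> ?Q" by auto
    have "Suc (Suc t) + Suc (Suc t) = 2 * Suc (Suc t)" "Suc (Suc t) + t = 2 * Suc t" "t + t = 2 * t" by auto
    then show ?thesis
      unfolding return_count_def sum_reach_mult'[OF Q(1,2)] sum_reach_mult'[OF Q(1,3)] by (simp only:)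
  qed
  finally show ?thesis .
qed

text \<open>Cauchy-Schwarz for the iterates \<open>t\<close> and \<open>t + 2\<close>, whose inner
  product is the moment in between.\<close>

lemma return_count_log_convex: "(return_count (Suc t))\<^sup>2 \<le> return_count t * return_count (Suc (Suc t))"
proof -
  let ?Q = "ball_verts t \<union> ball_verts (Suc (Suc t))"
  let ?n = "\<lambda>s q. real (card (reach p a s q))"
  have "(\<Sum>q\<in>?Q. ?n t q * ?n (Suc (Suc t)) q)\<^sup>2 \<le> (\<Sum>q\<in>?Q. (?n t q)\<^sup>2) * (\<Sum>q\<in>?Q. (?n (Suc (Suc t)) q)\<^sup>2)"
    by (rule Cauchy_Schwarz_ineq_sum)
  moreover have "(\<Sum>q\<in>?Q. ?n t q * ?n (Suc (Suc t)) q) = return_count (Suc t)"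
    using sum_reach_mult'[of ?Q t "Suc (Suc t)"] by (simp add: return_count_def mult_2)
  moreover have "(\<Sum>q\<in>?Q. (?n t q)\<^sup>2) = return_count t" "(\<Sum>q\<in>?Q. (?n (Suc (Suc t)) q)\<^sup>2) = return_count (Suc (Suc t))"
    using sum_reach_mult'[of ?Q t t] sum_reach_mult'[of ?Q "Suc (Suc t)" "Suc (Suc t)"]
    by (simp_all add: return_count_def mult_2 power2_eq_square)
  ultimately show ?thesis by simp
qed

lemma return_count_Suc_le: "return_count (Suc t) \<le> (real degree_bound)\<^sup>2 * return_count t"
proof -
  have "ell2_norm (tree_verts r) (walk_count p a (Suc t)) \<le> real degree_bound * ell2_norm (tree_verts r) (walk_count p a t)"
    using T.A_ell2(2)[of "walk_count p a t"] walk_count_ell2 by (simp add: adjacency_walk_count)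
  then have "(ell2_norm (tree_verts r) (walk_count p a (Suc t)))\<^sup>2 \<le> (real degree_bound * ell2_norm (tree_verts r) (walk_count p a t))\<^sup>2"
    by (intro power_mono ell2_norm_nonneg)
  then show ?thesis by (simp add: power_mult_distrib norm_walk_count)
qed

text \<open>The ratios of the moments \<open>return_count t\<close> of \<open>\<delta>\<^sub>p\<close> increase to some \<open>\<beta>\<close>, and the
  normalised iterates are approximate eigenvectors of \<open>A\<^sup>2\<close> for \<open>\<beta>\<close>.\<close>

lemma return_count_le_spectral_radius:
  assumes b1: "1 \<le> return_count 1"
  defines "\<rho> \<equiv> ell2_spectral_radius (tree_verts r) (adjacency_op (universal_cover G r))"
  shows "1 \<le> \<rho>" "return_count t \<le> \<rho> ^ (2 * t)"
proof -
  let ?A = "adjacency_op (universal_cover G r)" and ?V = "tree_verts r"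
  have a: "a \<in> verts G" using p(1) by (rule path_end)
  have "walks a 0 [] = {[]}" using a by (auto simp: walks_def words_def)
  then have b0: "return_count 0 = 1" by (simp add: return_count_def)
  have pos: "0 < return_count t \<and> 0 < return_count (Suc t)" for t
  proof (induction t)
    case 0
    then show ?case using b0 b1 by simp
  next
    case (Suc t)
    then have "0 < (return_count (Suc t))\<^sup>2" by simp
    then have "0 < return_count t * return_count (Suc (Suc t))" using return_count_log_convex[of t] by linarith
    then show ?case using Suc by (simp add: zero_less_mult_iff)
  qed
  define q where "q t = return_count (Suc t) / return_count t" for t
  have "q t \<le> q (Suc t)" for t
    using return_count_log_convex[of t] pos[of t] by (simp add: q_def divide_simps power2_eq_square mult.commute)
  then have "incseq q" by (rule incseq_SucI)
  moreover have "\<forall>t. q t \<le> (real degree_bound)\<^sup>2" using return_count_Suc_le pos by (simp add: q_def divide_le_eq)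
  ultimately obtain \<beta> where \<beta>: "q \<longlonglongrightarrow> \<beta>" "\<forall>t. q t \<le> \<beta>" by (rule incseq_convergent)
  have \<beta>1: "1 \<le> \<beta>" using \<beta>(2)[rule_format, of 0] b1 b0 by (simp add: q_def)
  have b\<beta>: "return_count t \<le> \<beta> ^ t" for t
  proof (induction t)
    case (Suc t)
    have "return_count (Suc t) = q t * return_count t" using pos[of t] by (simp add: q_def)
    also have "\<dots> \<le> \<beta> * \<beta> ^ t" using \<beta> \<beta>1 Suc pos[of t] by (intro mult_mono) auto
    finally show ?case by simp
  qed (simp add: b0)
  \<comment> \<open>\<open>A^2 - \<beta>\<close> factors as \<open>(A - s) (A + s)\<close>, so one
    of \<open>s\<close> and \<open>- s\<close> will be found in the spectrum.\<close>
  define s where "s = sqrt \<beta>"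
  have s2: "s * s = \<beta>" and s1: "1 \<le> s" using \<beta>1 by (simp_all add: s_def)
  have "complex_of_real s \<in> ell2_spectrum ?V ?A \<or> - complex_of_real s \<in> ell2_spectrum ?V ?A"
  proof (rule ccontr)
    assume "\<not> ?thesis"
    then have n1: "complex_of_real s \<notin> ell2_spectrum ?V ?A" and n2: "- complex_of_real s \<notin> ell2_spectrum ?V ?A"
      by auto
    obtain C1 where C1: "0 \<le> C1" "\<And>f. f \<in> ell2 ?V \<Longrightarrow> (\<lambda>v. ?A f v - complex_of_real s * f v) \<in> ell2 ?V \<Longrightarrow>
        ell2_norm ?V f \<le> C1 * ell2_norm ?V (\<lambda>v. ?A f v - complex_of_real s * f v)"
      by (rule resolvent_bound[OF n1]) (rule that)
    obtain C2 where C2: "0 \<le> C2" "\<And>f. f \<in> ell2 ?V \<Longrightarrow> (\<lambda>v. ?A f v - (- complex_of_real s) * f v) \<in> ell2 ?V \<Longrightarrow>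
        ell2_norm ?V f \<le> C2 * ell2_norm ?V (\<lambda>v. ?A f v - (- complex_of_real s) * f v)"
      by (rule resolvent_bound[OF n2]) (rule that)
    \<comment> \<open>Bounded inverses of both factors would bound \<open>A^2 - \<beta>\<close>
      below on the iterates. Divided by \<open>return_count t\<close> this is the displayed
      inequality, whose right side tends to 0 as \<open>q\<close> tends to
      \<open>\<beta>\<close>.\<close>
    have main: "1 \<le> (C1 * C2)\<^sup>2 * (q (Suc t) * q t - 2 * \<beta> * q t + \<beta>\<^sup>2)" for t
    proof -
      let ?f = "walk_count p a t"
      define h where "h = (\<lambda>v. ?A ?f v - complex_of_real s * ?f v)"
      define k where "k = (\<lambda>v. ?A h v - (- complex_of_real s) * h v)"
      have f: "?f \<in> ell2 ?V" by (rule walk_count_ell2)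
      have h: "h \<in> ell2 ?V"
        unfolding h_def using T.A_ell2(1)[of ?f] f by (intro ell2_minus_scale) simp_all
      have k: "k \<in> ell2 ?V"
        unfolding k_def using T.A_ell2(1)[of h] h by (intro ell2_minus_scale) simp_all
      have "?A h = (\<lambda>v. walk_count p a (Suc (Suc t)) v - complex_of_real s * walk_count p a (Suc t) v)"
        unfolding h_def T.A_diff T.A_scale adjacency_walk_count ..
      then have "k = (\<lambda>v. walk_count p a (Suc (Suc t)) v - complex_of_real \<beta> * walk_count p a t v)"
        unfolding k_def by (simp add: h_def adjacency_walk_count fun_eq_iff algebra_simps flip: s2)
      then have kb: "(ell2_norm ?V k)\<^sup>2 = return_count (Suc (Suc t)) - 2 * \<beta> * return_count (Suc t) + \<beta>\<^sup>2 * return_count t"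
        by (simp add: norm_walk_count_diff)
      have "ell2_norm ?V ?f \<le> C1 * ell2_norm ?V h" using C1(2)[OF f] h by (simp add: h_def)
      also have "\<dots> \<le> C1 * (C2 * ell2_norm ?V k)"
        using C1(1) C2(2)[OF h] k unfolding k_def by (intro mult_left_mono) auto
      finally have "(ell2_norm ?V ?f)\<^sup>2 \<le> (C1 * C2 * ell2_norm ?V k)\<^sup>2"
        using ell2_norm_nonneg by (intro power_mono) (simp_all add: mult.assoc)
      then have "return_count t \<le> (C1 * C2)\<^sup>2 * (return_count (Suc (Suc t)) - 2 * \<beta> * return_count (Suc t) + \<beta>\<^sup>2 * return_count t)"
        by (simp add: norm_walk_count power_mult_distrib kb)
      also have "return_count (Suc (Suc t)) = q (Suc t) * q t * return_count t" using pos[of t] pos[of "Suc t"] by (simp add: q_def)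
      also have "return_count (Suc t) = q t * return_count t" using pos[of t] by (simp add: q_def)
      finally have "1 * return_count t \<le> ((C1 * C2)\<^sup>2 * (q (Suc t) * q t - 2 * \<beta> * q t + \<beta>\<^sup>2)) * return_count t"
        by (simp add: algebra_simps)
      then show ?thesis using pos[of t] mult_le_cancel_right_pos by blast
    qed
    have "(\<lambda>t. (C1 * C2)\<^sup>2 * (q (Suc t) * q t - 2 * \<beta> * q t + \<beta>\<^sup>2)) \<longlonglongrightarrow> (C1 * C2)\<^sup>2 * (\<beta> * \<beta> - 2 * \<beta> * \<beta> + \<beta>\<^sup>2)"
      using \<beta>(1) LIMSEQ_Suc[OF \<beta>(1)] by (intro tendsto_intros)
    then have "1 \<le> (C1 * C2)\<^sup>2 * (\<beta> * \<beta> - 2 * \<beta> * \<beta> + \<beta>\<^sup>2)"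
      using main by (intro LIMSEQ_le_const) auto
    then show False by (simp add: power2_eq_square)
  qed
  then have "s \<le> \<rho>"
    using T.cmod_le_spectral_radius[of "complex_of_real s"] T.cmod_le_spectral_radius[of "- complex_of_real s"] s1
    by (auto simp: \<rho>_def)
  then show "1 \<le> \<rho>" using s1 by simp
  have "return_count t \<le> s ^ (2 * t)" using b\<beta>[of t] by (simp add: power_mult power2_eq_square s2)
  also have "\<dots> \<le> \<rho> ^ (2 * t)" using \<open>s \<le> \<rho>\<close> s1 by (intro power_mono) auto
  finally show "return_count t \<le> \<rho> ^ (2 * t)" .
qed

end

end

section \<open>The main estimate\<close>

context fin_digraph
begin

lemma connected_path:
  assumes "Digraph_Component.connected G" "u \<in> verts G" "v \<in> verts G"
  shows "\<exists>p. path G u p v"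
proof -
  interpret S: pair_wf_digraph "mk_symmetric G" by (rule wellformed_mk_symmetric)
  have "u \<rightarrow>\<^sup>*\<^bsub>with_proj (mk_symmetric G)\<^esub> v"
    using assms by (simp add: Digraph_Component.connected_def strongly_connected_def)
  then show ?thesis
  proof (induction rule: S.reachable_induct)
    case base
    then show ?case using assms(2) by (intro exI[of _ "[]"]) simp
  next
    case (step x y)
    then obtain p where p: "path G u p x" by auto
    have "\<exists>d. path G x [d] y"
    proof -
      from step(2) obtain e where e: "e \<in> arcs G" "(x, y) = (tail G e, head G e) \<or> (x, y) = (head G e, tail G e)"
        by (auto simp: parcs_mk_symmetric)
      then have "path G x [(e, True)] y \<or> path G x [(e, False)] y"
        unfolding path_Cons path_Nil using wellformed[OF e(1)] by (auto simp: both_directions_def)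
      then show ?thesis by blast
    qed
    with p show ?case using path_append by blast
  qed
qed

text \<open>At a vertex with an edge, the walk across it and back makes \<open>return_count\<close>
  positive at 1. Elsewhere at most the empty word is a path, and 1 is below every power of a radius
  that is at least 1.\<close>

lemma walks_le_rho:
  assumes con: "Digraph_Component.connected G" and ne: "arcs G \<noteq> {}"
  shows "1 \<le> rho_A G" "real (card (walks a (2 * t) [])) \<le> rho_A G ^ (2 * t)"
proof -
  define r where "r = (SOME r. r \<in> verts G)"
  have "verts G \<noteq> {}" using con by (simp add: Digraph_Component.connected_def strongly_connected_def)
  then have r: "r \<in> verts G" unfolding r_def by (simp add: some_in_eq)
  have rho: "rho_A G = ell2_spectral_radius (tree_verts r) (adjacency_op (universal_cover G r))"
    by (simp add: rho_A_def Let_def r_def)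
  have main: "1 \<le> rho_A G \<and> real (card (walks a (2 * t) [])) \<le> rho_A G ^ (2 * t)"
    if d: "d \<in> arcs G \<times> UNIV" "src d = a" for a d t
  proof -
    have a: "a \<in> verts G" using src_tgt_verts[OF d(1)] d(2) by simp
    obtain p where "path G r p a" using connected_path[OF con r a] by auto
    then have p: "path G r (reduce p) a" "reduced (reduce p)" using path_reduce by auto
    have "path G a [d] (tgt d)" using d src_tgt_verts[OF d(1)] by (simp add: path_Cons)
    then have "path G a ([d] @ winv [d]) a" using path_winv path_append by blast
    then have "[d, inv_letter d] \<in> walks a (2 * 1) []"
      by (auto simp: walks_def words_def reduce_Cons)
    then have "0 < card (walks a (2 * 1) [])" unfolding card_gt_0_iff using finite_walks by blast
    then have "1 \<le> return_count a 1" unfolding return_count_def[OF p] by linarith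
    from return_count_le_spectral_radius[OF p this] show ?thesis unfolding rho return_count_def[OF p] by simp
  qed
  obtain e where e: "e \<in> arcs G" using ne by auto
  show rho1: "1 \<le> rho_A G" using main[of "(e, True)"] e by auto
  show "real (card (walks a (2 * t) [])) \<le> rho_A G ^ (2 * t)"
  proof (cases "\<exists>d\<in>arcs G \<times> UNIV. src d = a")
    case True
    then show ?thesis using main by blast
  next
    case False
    have "words a s \<subseteq> {[]}" for s
    proof
      fix w assume "w \<in> words a s"
      then obtain c where "path G a w c" by (auto simp: words_def)
      then show "w \<in> {[]}" using False by (cases w) (auto simp: path_Cons)
    qed
    then have "walks a (2 * t) [] \<subseteq> {[]}" unfolding walks_def by blast
    then have "card (walks a (2 * t) []) \<le> card {[] :: ('b \<times> bool) list}" by (rule card_mono[rotated]) simp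
    then have "card (walks a (2 * t) []) \<le> 1" by simp
    moreover have "1 \<le> rho_A G ^ (2 * t)" using rho1 by (rule one_le_power)
    ultimately show ?thesis by linarith
  qed
qed

end

lemma prod_list_nth: "(\<Prod>x\<leftarrow>xs. f x) = (\<Prod>i<length xs. f (xs ! i))"
  by (simp add: prod.list_conv_set_nth atLeast0LessThan)

section \<open>Weighted sums over closed words\<close>

context green
begin

lemma wsum_eq_sum:
  "wsum (\<lambda>w. \<exists>c. path G a w c) f u l =
    (\<Sum>y | length y = l \<and> reduced (u @ y) \<and> (\<exists>c. path G a (u @ y) c). \<Prod>d\<leftarrow>y. f d)"
  if "reduced u" "\<exists>c. path G a u c" for f :: "'b \<times> bool \<Rightarrow> real"
  using that
proof (induction l arbitrary: u)
  case 0
  then have "{y. y = [] \<and> reduced (u @ y) \<and> (\<exists>c. path G a (u @ y) c)} = {[]}" by auto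
  then show ?case by simp
next
  case (Suc l)
  let ?P = "\<lambda>w. \<exists>c. path G a w c"
  let ?Y = "\<lambda>u l. {y. length y = l \<and> reduced (u @ y) \<and> ?P (u @ y)}"
  have finY: "finite (?Y u l)" for u l
  proof (rule finite_subset)
    show "?Y u l \<subseteq> {w. set w \<subseteq> arcs G \<times> UNIV \<and> length w = l}"
    proof
      fix y assume "y \<in> ?Y u l"
      then obtain c where "path G a (u @ y) c" "length y = l" by auto
      from path_set[OF this(1)] this(2) show "y \<in> {w. set w \<subseteq> arcs G \<times> UNIV \<and> length w = l}" by auto
    qed
  qed (intro finite_lists_length_eq finite_cartesian_product finite_arcs finite)
  have fin_next: "finite (next_letters ?P u)"
  proof (rule finite_subset)
    show "next_letters ?P u \<subseteq> arcs G \<times> UNIV"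
      unfolding next_letters_def using path_set by fastforce
  qed simp
  have "?Y u (Suc l) = (\<lambda>(d, y). d # y) ` Sigma (next_letters ?P u) (\<lambda>d. ?Y (u @ [d]) l)"
  proof (intro equalityI subsetI)
    fix y assume y: "y \<in> ?Y u (Suc l)"
    then obtain d x where dx: "y = d # x" by (cases y) auto
    have r: "reduced (u @ [d])" using y reduced_append[of "u @ [d]" x] by (simp add: dx)
    obtain c where "path G a ((u @ [d]) @ x) c" using y by (auto simp: dx)
    then have "?P (u @ [d])" using path_append by blast
    with r y show "y \<in> (\<lambda>(d, y). d # y) ` Sigma (next_letters ?P u) (\<lambda>d. ?Y (u @ [d]) l)"
      by (auto simp: dx next_letters_def)
  qed (auto simp: next_letters_def)
  moreover have "inj_on (\<lambda>(d, y). d # y) (Sigma (next_letters ?P u) (\<lambda>d. ?Y (u @ [d]) l))"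
    by (auto simp: inj_on_def)
  ultimately have "(\<Sum>y\<in>?Y u (Suc l). \<Prod>d\<leftarrow>y. f d) =
      (\<Sum>(d, y)\<in>Sigma (next_letters ?P u) (\<lambda>d. ?Y (u @ [d]) l). f d * (\<Prod>d\<leftarrow>y. f d))"
    by (simp add: sum.reindex case_prod_unfold)
  also have "\<dots> = (\<Sum>d\<in>next_letters ?P u. \<Sum>y\<in>?Y (u @ [d]) l. f d * (\<Prod>d\<leftarrow>y. f d))"
    by (rule sum.Sigma[symmetric]) (use fin_next finY in blast)+
  also have "\<dots> = (\<Sum>d\<in>next_letters ?P u. f d * wsum ?P f (u @ [d]) l)"
    using Suc.IH by (intro sum.cong refl) (simp add: sum_distrib_left next_letters_def)
  finally show ?case by simp
qed

text \<open>A reduced extension of a path is a reduced path from the end of that path, and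
  \<open>sum_phi_le\<close> applies there.\<close>

lemma wsum_phi_le:
  assumes u: "reduced u" "path G a u c"
  shows "wsum (\<lambda>w. \<exists>c. path G a w c) (\<lambda>d. (phi (fst d))\<^sup>2) u l \<le> green_energy"
proof -
  let ?Y = "{y. length y = l \<and> reduced (u @ y) \<and> (\<exists>c. path G a (u @ y) c)}"
  have Y: "reduced y \<and> y \<in> words c l" if y: "y \<in> ?Y" for y
  proof -
    obtain e where "path G a (u @ y) e" "reduced (u @ y)" "length y = l" using y by auto
    then show ?thesis using path_append path_unique[OF u(2)] by (auto simp: words_def reduced_append)
  qed
  have "wsum (\<lambda>w. \<exists>c. path G a w c) (\<lambda>d. (phi (fst d))\<^sup>2) u l = (\<Sum>y\<in>?Y. \<Prod>d\<leftarrow>y. (phi (fst d))\<^sup>2)"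
    using u by (intro wsum_eq_sum) auto
  also have "\<dots> \<le> green_energy"
  proof (rule sum_phi_le)
    show "c \<in> verts G" using u(2) by (rule path_end)
    have "?Y \<subseteq> words c l" using Y by blast
    then show "finite ?Y" by (rule finite_subset) simp
    show "reduced y \<and> (\<exists>b. path G c y b)" if "y \<in> ?Y" for y using Y[OF that] by (simp add: words_def)
  qed
  finally show ?thesis .
qed

abbreviation "FG \<equiv> free_group (arcs G)"

definition cyc_closed :: "nat \<Rightarrow> 'a \<Rightarrow> nat \<Rightarrow> ('b \<times> bool) list set" where
  "cyc_closed m a n = {v. path G a v a \<and> reduced v \<and> length v = n \<and>
     (v = [] \<or> hd v \<noteq> inv_letter (last v)) \<and> primitivity_rank FG v = enat m}"

definition closed :: "nat \<Rightarrow> 'a \<Rightarrow> nat \<Rightarrow> ('b \<times> bool) list set" where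
  "closed m a n = {v. path G a v a \<and> reduced v \<and> length v = n \<and> primitivity_rank FG v = enat m}"

definition path_phi :: "('b \<times> bool) list \<Rightarrow> real" where
  "path_phi v = (\<Prod>d\<leftarrow>v. phi (fst d))"

text \<open>The estimate \<open>sum_weight_states_le\<close> with \<open>green_energy\<close> for
  \<open>K\<close> and the oriented edges of the graph for \<open>L\<close>.\<close>

definition count_bound :: "nat \<Rightarrow> nat \<Rightarrow> real" where
  "count_bound m n = ((real n + 2) ^ 3 * (green_energy * (1 + real degree_bound))) ^ Suc m * (2 * real m - 1) ^ n"

lemma path_phi_nonneg: "0 \<le> path_phi v"
  unfolding path_phi_def by (induction v) (auto simp: phi_nonneg)

lemma finite_closed: "finite (closed m a n)"
  by (rule finite_subset[OF _ finite_words[of a n]]) (auto simp: closed_def words_def)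

lemma finite_cyc_closed: "finite (cyc_closed m a n)"
  by (rule finite_subset[OF _ finite_words[of a n]]) (auto simp: cyc_closed_def words_def)

lemma weighted_exploration_paths:
  assumes "a \<in> verts G" "1 \<le> m"
  shows "weighted_exploration (\<lambda>w. \<exists>c. path G a w c) (\<lambda>d. (phi (fst d))\<^sup>2) (arcs G \<times> UNIV) m green_energy"
proof
  show "finite (arcs G \<times> (UNIV :: bool set))" by simp
  show "d \<in> arcs G \<times> UNIV" if "\<exists>c. path G a (u @ [d]) c" for u d
    using that path_set[of a "u @ [d]"] by auto
  show "\<exists>c. path G a [] c" using assms(1) by simp
  show "0 \<le> (phi (fst d))\<^sup>2" "(phi (fst d))\<^sup>2 \<le> 1" for d :: "'b \<times> bool"
    using phi_nonneg phi_le_1 by (simp_all add: power_le_one)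
  show "1 \<le> m" by fact
  show "1 \<le> green_energy" by (rule green_energy)
  show "wsum (\<lambda>w. \<exists>c. path G a w c) (\<lambda>d. (phi (fst d))\<^sup>2) u l \<le> green_energy"
    if "\<exists>c. path G a u c" "reduced u" for u l
    using that wsum_phi_le by blast
qed

text \<open>Positions are weighted by \<open>phi\<close> and new edges by its square, so
  \<open>crit_pair_sum_le\<close> applies to all pairs of a word and a critical subgroup; its
  finiteness claim makes \<open>card\<close> meaningful here.\<close>

lemma sum_cyc_closed_le:
  assumes "a \<in> verts G" "1 \<le> m"
  shows "v \<in> cyc_closed m a n \<Longrightarrow> finite (Crit FG v)"
    "(\<Sum>v\<in>cyc_closed m a n. real (card (Crit FG v)) * path_phi v) \<le> count_bound m n"
proof -
  interpret E: weighted_exploration "\<lambda>w. \<exists>c. path G a w c" "\<lambda>d. (phi (fst d))\<^sup>2" "arcs G \<times> UNIV" m green_energy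
    using assms by (rule weighted_exploration_paths)
  let ?S = "Sigma (cyc_closed m a n) (Crit FG)"
  have S: "crit_pair m v J \<and> reduced v \<and> length v = n \<and>
      (v = [] \<or> hd v \<noteq> inv_letter (last v)) \<and> (\<forall>k\<le>n. \<exists>c. path G a (take k v) c)"
    if "(v, J) \<in> ?S" for v J
  proof -
    have v: "path G a v a" using that by (simp add: cyc_closed_def)
    have "\<exists>c. path G a (take k v) c" for k
      using v path_append[of a "take k v" "drop k v" a] by auto
    then show ?thesis using that Crit_crit_pair[of J "arcs G" v m] by (auto simp: cyc_closed_def)
  qed
  note main = E.crit_pair_sum_le[OF refl phi_nonneg phi_le_1 S]
  have fin: "finite (Crit FG v)" if "v \<in> cyc_closed m a n" for v
  proof (rule inj_on_finite[of "Pair v" _ ?S])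
    show "finite ?S" by (rule main(1))
  qed (use that in \<open>auto intro: inj_onI\<close>)
  then show "v \<in> cyc_closed m a n \<Longrightarrow> finite (Crit FG v)" .
  have "(\<Sum>v\<in>cyc_closed m a n. real (card (Crit FG v)) * path_phi v) = (\<Sum>v\<in>cyc_closed m a n. \<Sum>J\<in>Crit FG v. path_phi v)"
    by simp
  also have "\<dots> = (\<Sum>(v, J)\<in>?S. path_phi v)"
    using fin by (intro sum.Sigma finite_cyc_closed) auto
  also have "\<dots> = (\<Sum>(v, J)\<in>?S. \<Prod>i<n. phi (fst (v ! i)))"
    by (intro sum.cong refl) (auto simp: path_phi_def prod_list_nth cyc_closed_def)
  also have "\<dots> \<le> (\<Sum>z\<in>E.states n. E.weight z)" by (rule main(2))
  also have "\<dots> \<le> count_bound m n" unfolding count_bound_def degree_bound_def by (rule E.sum_weight_states_le)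
  finally show "(\<Sum>v\<in>cyc_closed m a n. real (card (Crit FG v)) * path_phi v) \<le> count_bound m n" .
qed

lemma count_bound_nonneg: "1 \<le> m \<Longrightarrow> 0 \<le> count_bound m n"
  unfolding count_bound_def using green_energy by (intro mult_nonneg_nonneg zero_le_power) auto

lemma count_bound_mono:
  assumes "1 \<le> m" "n \<le> n'"
  shows "count_bound m n \<le> count_bound m n'"
  unfolding count_bound_def using assms green_energy
  by (intro mult_mono power_mono power_increasing mult_nonneg_nonneg zero_le_power) auto

text \<open>The conjugator \<open>p\<close> of a cyclic reduction is read twice, so its weight
  enters squared, and the squared weights of reduced paths of one length add up to at most
  \<open>green_energy\<close>. The \<open>s + 1\<close> candidate lengths of \<open>p\<close> give
  the remaining factor.\<close>

lemma sum_closed_le: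
  assumes a: "a \<in> verts G" and m: "1 \<le> m"
  shows "v \<in> closed m a s \<Longrightarrow> finite (Crit FG v)"
    "(\<Sum>v\<in>closed m a s. real (card (Crit FG v)) * path_phi v) \<le> (real s + 1) * green_energy * count_bound m s"
proof -
  define ep where "ep p = (SOME c. path G a p c)" for p
  have ep: "path G a p (ep p)" if "path G a p c" for p c
    unfolding ep_def using that by (rule someI)
  have "\<exists>h. v = fst h @ snd h @ winv (fst h) \<and> (snd h = [] \<or> hd (snd h) \<noteq> inv_letter (last (snd h)))"
    if "v \<in> closed m a s" for v
  proof -
    have "reduced v" using that by (simp add: closed_def)
    then show ?thesis by (rule cyclic_reduction) auto
  qed
  then obtain h where h: "\<And>v. v \<in> closed m a s \<Longrightarrow>
      v = fst (h v) @ snd (h v) @ winv (fst (h v)) \<and>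
      (snd (h v) = [] \<or> hd (snd (h v)) \<noteq> inv_letter (last (snd (h v))))"
    by metis
  have *: "path G a (fst (h v)) (ep (fst (h v))) \<and> reduced (fst (h v)) \<and> length (fst (h v)) \<le> s \<and>
      snd (h v) \<in> cyc_closed m (ep (fst (h v))) (s - 2 * length (fst (h v))) \<and>
      ecard (Crit FG v) = ecard (Crit FG (snd (h v))) \<and> path_phi v = (path_phi (fst (h v)))\<^sup>2 * path_phi (snd (h v))"
    if v: "v \<in> closed m a s" for v
  proof -
    obtain p u where pu: "h v = (p, u)" by (cases "h v")
    have vpu: "v = p @ u @ winv p" and cyc: "u = [] \<or> hd u \<noteq> inv_letter (last u)"
      using h[OF v] by (simp_all add: pu)
    have pv: "path G a (p @ u @ winv p) a" and rv: "reduced (p @ u @ winv p)" and lv: "length v = s"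
      and prv: "primitivity_rank FG (p @ u @ winv p) = enat m"
      using v unfolding vpu closed_def by auto
    obtain c where c: "path G a p c" "path G c (u @ winv p) a" using pv path_append by blast
    then obtain e where e: "path G c u e" "path G e (winv p) a" using path_append by blast
    have "path G a p e" using e(2) by (simp only: path_winv_iff)
    then have "e = ep p" "c = ep p" using ep c(1) path_unique by blast+
    then have u: "path G (ep p) u (ep p)" using e(1) by simp
    have ru: "reduced u" "reduced p" using rv by (auto simp: reduced_append)
    have uF: "u \<in> carrier FG" using path_set[OF u] ru by simp
    note conj = Crit_conj[OF uF path_set[OF c(1)] rv]
    have "path_phi (winv p) = path_phi p" unfolding path_phi_def by (induction p) auto
    then have "path_phi v = (path_phi p)\<^sup>2 * path_phi u" by (simp add: vpu path_phi_def power2_eq_square)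
    moreover have "ecard (Crit FG v) = ecard (Crit FG u)" using conj(2) by (simp only: vpu)
    moreover have "length u = s - 2 * length p" "length p \<le> s" using lv by (simp_all add: vpu)
    ultimately show ?thesis
      using u ru conj(1) prv cyc ep[OF c(1)] by (simp add: pu cyc_closed_def)
  qed
  show fin: "v \<in> closed m a s \<Longrightarrow> finite (Crit FG v)"
  proof -
    assume v: "v \<in> closed m a s"
    have "finite (Crit FG (snd (h v)))"
      using *[OF v] path_end m by (intro sum_cyc_closed_le(1)) auto
    then show "finite (Crit FG v)" using *[OF v] by (auto simp: ecard_def split: if_splits)
  qed
  define PP where "PP k = {p \<in> words a k. reduced p}" for k
  define I where "I = (SIGMA k:{..s}. SIGMA p:PP k. cyc_closed m (ep p) (s - 2 * k))"
  define F where "F = (\<lambda>(k :: nat, p, u). (path_phi p)\<^sup>2 * (real (card (Crit FG u)) * path_phi u))"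
  \<comment> \<open>The length of the conjugator is kept as an index so that the sum can be split by
    it.\<close>
  define j where "j v = (length (fst (h v)), h v)" for v
  have finPP: "finite (PP k)" for k by (simp add: PP_def)
  have finI: "finite I" unfolding I_def by (intro finite_SigmaI finPP finite_cyc_closed) simp
  have inj: "inj_on j (closed m a s)"
  proof (rule inj_onI)
    fix v w assume "v \<in> closed m a s" "w \<in> closed m a s" "j v = j w"
    then show "v = w" using h[of v] h[of w] by (simp add: j_def)
  qed
  have "(\<Sum>v\<in>closed m a s. real (card (Crit FG v)) * path_phi v) = (\<Sum>v\<in>closed m a s. F (j v))"
  proof (rule sum.cong[OF refl])
    fix v assume v: "v \<in> closed m a s"
    have "card (Crit FG v) = card (Crit FG (snd (h v)))"
      using *[OF v] by (auto simp: ecard_def split: if_splits)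
    then show "real (card (Crit FG v)) * path_phi v = F (j v)"
      using *[OF v] by (simp add: F_def j_def case_prod_unfold)
  qed
  also have "\<dots> = sum F (j ` closed m a s)" using inj by (simp add: sum.reindex)
  also have "\<dots> \<le> sum F I"
  proof (rule sum_mono2[OF finI])
    show "j ` closed m a s \<subseteq> I"
    proof
      fix x assume "x \<in> j ` closed m a s"
      then obtain v where v: "v \<in> closed m a s" "x = j v" by auto
      obtain p u where pu: "h v = (p, u)" by (cases "h v")
      show "x \<in> I" using *[OF v(1)] by (auto simp: v(2) j_def I_def PP_def words_def pu)
    qed
  qed (auto simp: F_def path_phi_nonneg)
  also have "\<dots> = (\<Sum>k\<le>s. \<Sum>p\<in>PP k. \<Sum>u\<in>cyc_closed m (ep p) (s - 2 * k). F (k, p, u))"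
    unfolding I_def using finPP finite_cyc_closed
    by (subst sum.Sigma, simp, blast intro: finite_SigmaI, subst sum.Sigma, auto intro!: finite_SigmaI simp: case_prod_unfold)
  also have "\<dots> \<le> (\<Sum>k\<le>s. green_energy * count_bound m s)"
  proof (rule sum_mono)
    fix k assume "k \<in> {..s}"
    have "(\<Sum>p\<in>PP k. \<Sum>u\<in>cyc_closed m (ep p) (s - 2 * k). F (k, p, u)) \<le> (\<Sum>p\<in>PP k. (path_phi p)\<^sup>2 * count_bound m s)"
    proof (rule sum_mono)
      fix p assume "p \<in> PP k"
      then obtain c where "path G a p c" by (auto simp: PP_def words_def)
      then have "ep p \<in> verts G" by (intro path_end[OF ep])
      from sum_cyc_closed_le(2)[OF this m]
      have "(\<Sum>u\<in>cyc_closed m (ep p) (s - 2 * k). real (card (Crit FG u)) * path_phi u) \<le> count_bound m s"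
        using count_bound_mono[OF m, of "s - 2 * k" s] order_trans by fastforce
      then have "(path_phi p)\<^sup>2 * (\<Sum>u\<in>cyc_closed m (ep p) (s - 2 * k). real (card (Crit FG u)) * path_phi u) \<le> (path_phi p)\<^sup>2 * count_bound m s"
        by (intro mult_left_mono) auto
      then show "(\<Sum>u\<in>cyc_closed m (ep p) (s - 2 * k). F (k, p, u)) \<le> (path_phi p)\<^sup>2 * count_bound m s"
        by (simp add: F_def sum_distrib_left)
    qed
    also have "\<dots> = (\<Sum>p\<in>PP k. (path_phi p)\<^sup>2) * count_bound m s" by (simp add: sum_distrib_right)
    also have "\<dots> \<le> green_energy * count_bound m s"
    proof (rule mult_right_mono[OF _ count_bound_nonneg[OF m]])
      have "(path_phi p)\<^sup>2 = (\<Prod>d\<leftarrow>p. (phi (fst d))\<^sup>2)" for p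
        unfolding path_phi_def by (induction p) (auto simp: power_mult_distrib)
      then show "(\<Sum>p\<in>PP k. (path_phi p)\<^sup>2) \<le> green_energy"
        using sum_phi_le[OF a finPP[of k]] by (auto simp: PP_def words_def)
    qed
    finally show "(\<Sum>p\<in>PP k. \<Sum>u\<in>cyc_closed m (ep p) (s - 2 * k). F (k, p, u)) \<le> green_energy * count_bound m s" .
  qed
  also have "\<dots> = (real s + 1) * green_energy * count_bound m s" by simp
  finally show "(\<Sum>v\<in>closed m a s. real (card (Crit FG v)) * path_phi v) \<le> (real s + 1) * green_energy * count_bound m s" .
qed

text \<open>The number of walks reducing to a given \<open>v\<close>, times \<open>z ^ t\<close>, is
  one term of the Green function, which for closed \<open>v\<close> is the weight of
  \<open>v\<close> times the diagonal value at \<open>a\<close>.\<close>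

lemma sum_closed_walks_le:
  assumes a: "a \<in> verts G" and m: "1 \<le> m"
  shows "(\<Sum>w | path G a w a \<and> length w = t \<and> primitivity_rank FG (reduce w) = enat m.
      real (card (Crit FG (reduce w)))) * z ^ t \<le> Green a [] * (real t + 1)\<^sup>2 * green_energy * count_bound m t"
proof -
  let ?cl = "{w. path G a w a \<and> length w = t \<and> primitivity_rank FG (reduce w) = enat m}"
  let ?c = "\<lambda>v. real (card (Crit FG v))"
  have fin: "finite ?cl" by (rule finite_subset[OF _ finite_words[of a t]]) (auto simp: words_def)
  have sub: "reduce ` ?cl \<subseteq> (\<Union>s\<le>t. closed m a s)"
  proof
    fix v assume "v \<in> reduce ` ?cl"
    then obtain w where w: "w \<in> ?cl" "v = reduce w" by auto
    then have "path G a v a" "length v \<le> t" using path_reduce length_reduce[of w] by auto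
    then show "v \<in> (\<Union>s\<le>t. closed m a s)" using w by (auto simp: closed_def)
  qed
  have "(\<Sum>w\<in>?cl. ?c (reduce w)) = (\<Sum>v\<in>reduce ` ?cl. \<Sum>w | w \<in> ?cl \<and> reduce w = v. ?c (reduce w))"
    using fin by (rule sum.image_gen)
  also have "\<dots> \<le> (\<Sum>v\<in>reduce ` ?cl. ?c v * real (card (walks a t v)))"
  proof (rule sum_mono)
    fix v
    have "card {w. w \<in> ?cl \<and> reduce w = v} \<le> card (walks a t v)"
      by (rule card_mono[OF finite_walks]) (auto simp: walks_def words_def)
    moreover have "(\<Sum>w | w \<in> ?cl \<and> reduce w = v. ?c (reduce w)) = (\<Sum>w | w \<in> ?cl \<and> reduce w = v. ?c v)"
      by (rule sum.cong) auto
    ultimately show "(\<Sum>w | w \<in> ?cl \<and> reduce w = v. ?c (reduce w)) \<le> ?c v * real (card (walks a t v))"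
      by (simp add: mult.commute mult_left_mono)
  qed
  also have "\<dots> \<le> (\<Sum>v\<in>(\<Union>s\<le>t. closed m a s). ?c v * real (card (walks a t v)))"
    using sub finite_closed by (intro sum_mono2) auto
  also have "\<dots> = (\<Sum>s\<le>t. \<Sum>v\<in>closed m a s. ?c v * real (card (walks a t v)))"
    by (rule sum.UNION_disjoint) (simp, simp add: finite_closed, auto simp: closed_def)
  finally have "(\<Sum>w\<in>?cl. ?c (reduce w)) * z ^ t \<le>
      (\<Sum>s\<le>t. \<Sum>v\<in>closed m a s. ?c v * real (card (walks a t v))) * z ^ t"
    using z by (intro mult_right_mono) auto
  also have "\<dots> = (\<Sum>s\<le>t. \<Sum>v\<in>closed m a s. ?c v * walk_term a v t)"
    by (simp add: walk_term_def sum_distrib_right mult.assoc)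
  also have "\<dots> \<le> (\<Sum>s\<le>t. \<Sum>v\<in>closed m a s. ?c v * (path_phi v * Green a []))"
  proof (intro sum_mono mult_left_mono)
    fix s v assume "v \<in> closed m a s"
    then have v: "path G a v a" "reduced v" by (simp_all add: closed_def)
    have "sum (walk_term a v) {t} \<le> Green a v"
      unfolding Green_def by (intro sum_le_suminf summable_walk_term) (auto simp: walk_term_nonneg)
    then show "walk_term a v t \<le> path_phi v * Green a []" using Green_closed[OF v] by (simp add: path_phi_def)
  qed simp
  also have "\<dots> = (\<Sum>s\<le>t. \<Sum>v\<in>closed m a s. ?c v * path_phi v) * Green a []"
    by (simp add: sum_distrib_right mult.assoc)
  also have "\<dots> \<le> (\<Sum>s\<le>t. (real t + 1) * green_energy * count_bound m t) * Green a []"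
  proof (intro mult_right_mono sum_mono)
    fix s assume "s \<in> {..t}"
    then have st: "s \<le> t" by simp
    have "(\<Sum>v\<in>closed m a s. ?c v * path_phi v) \<le> (real s + 1) * green_energy * count_bound m s" using a m by (rule sum_closed_le)
    also have "\<dots> \<le> (real t + 1) * green_energy * count_bound m t"
      using st green_energy count_bound_mono[OF m st] count_bound_nonneg[OF m] by (intro mult_mono) auto
    finally show "(\<Sum>v\<in>closed m a s. ?c v * path_phi v) \<le> (real t + 1) * green_energy * count_bound m t" .
  qed (rule Green_nonneg)
  also have "\<dots> = Green a [] * (real t + 1)\<^sup>2 * green_energy * count_bound m t" by (simp add: power2_eq_square mult_ac)
  finally show ?thesis .
qed

lemma CPm_sum_le:
  assumes m: "1 \<le> m"
  shows "w \<in> CPm G m t \<Longrightarrow> finite (Crit FG (reduce w))" "finite (CPm G m t)"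
    "(\<Sum>w\<in>CPm G m t. real (card (Crit FG (reduce w)))) * z ^ t \<le>
      (\<Sum>a\<in>verts G. Green a []) * (real t + 1)\<^sup>2 * green_energy * count_bound m t"
proof -
  let ?cl = "\<lambda>a. {w. path G a w a \<and> length w = t \<and> primitivity_rank FG (reduce w) = enat m}"
  let ?c = "\<lambda>w. real (card (Crit FG (reduce w)))"
  have CPm: "CPm G m t = (\<Union>a\<in>verts G. ?cl a)"
    using path_start by (fastforce simp: CPm_def CP_def)
  have fin: "finite (?cl a)" for a by (rule finite_subset[OF _ finite_words[of a t]]) (auto simp: words_def)
  show finC: "finite (CPm G m t)" unfolding CPm using fin by simp
  show "finite (Crit FG (reduce w))" if w: "w \<in> CPm G m t" for w
  proof -
    obtain a where a: "a \<in> verts G" "w \<in> ?cl a" using w unfolding CPm by auto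
    then have "reduce w \<in> closed m a (length (reduce w))" using path_reduce by (auto simp: closed_def)
    then show ?thesis by (rule sum_closed_le(1)[OF a(1) m])
  qed
  \<comment> \<open>A word can be closed at several vertices, as the empty word is, so summing over
    starting vertices gives an upper bound.\<close>
  have "(\<Sum>w\<in>CPm G m t. ?c w) \<le> (\<Sum>w\<in>CPm G m t. \<Sum>a | a \<in> verts G \<and> w \<in> ?cl a. ?c w)"
  proof (rule sum_mono)
    fix w assume "w \<in> CPm G m t"
    then obtain a where a: "a \<in> verts G" "w \<in> ?cl a" unfolding CPm by auto
    then have "{a} \<subseteq> {a. a \<in> verts G \<and> w \<in> ?cl a}" by auto
    then have "card {a} \<le> card {a. a \<in> verts G \<and> w \<in> ?cl a}" by (intro card_mono) auto
    then have "1 * ?c w \<le> real (card {a. a \<in> verts G \<and> w \<in> ?cl a}) * ?c w" by (intro mult_right_mono) auto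
    then show "?c w \<le> (\<Sum>a | a \<in> verts G \<and> w \<in> ?cl a. ?c w)" by simp
  qed
  also have "\<dots> = (\<Sum>a\<in>verts G. \<Sum>w | w \<in> CPm G m t \<and> w \<in> ?cl a. ?c w)"
    using finC finite_verts by (rule sum.swap_restrict)
  also have "\<dots> = (\<Sum>a\<in>verts G. \<Sum>w\<in>?cl a. ?c w)"
    unfolding CPm by (intro sum.cong refl) auto
  finally have "(\<Sum>w\<in>CPm G m t. ?c w) * z ^ t \<le> (\<Sum>a\<in>verts G. \<Sum>w\<in>?cl a. ?c w) * z ^ t"
    using z by (intro mult_right_mono) auto
  also have "\<dots> = (\<Sum>a\<in>verts G. (\<Sum>w\<in>?cl a. ?c w) * z ^ t)" by (rule sum_distrib_right)
  also have "\<dots> \<le> (\<Sum>a\<in>verts G. Green a [] * (real t + 1)\<^sup>2 * green_energy * count_bound m t)"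
    using sum_closed_walks_le[OF _ m] by (intro sum_mono)
  also have "\<dots> = (\<Sum>a\<in>verts G. Green a []) * (real t + 1)\<^sup>2 * green_energy * count_bound m t" by (simp add: sum_distrib_right)
  finally show "(\<Sum>w\<in>CPm G m t. ?c w) * z ^ t \<le> (\<Sum>a\<in>verts G. Green a []) * (real t + 1)\<^sup>2 * green_energy * count_bound m t" .
qed

lemma limsup_CPm_le:
  assumes m: "1 \<le> m"
  shows "limsup (\<lambda>t. eroot t (\<Sum>w\<in>CPm G m t. ecard (Crit FG (reduce w)))) \<le> ereal ((2 * real m - 1) / z)"
proof -
  let ?N = "\<lambda>t. \<Sum>w\<in>CPm G m t. card (Crit FG (reduce w))"
  define q where "q = (2 * real m - 1) / z"
  have q0: "0 < q" using m z by (simp add: q_def)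
  \<comment> \<open>The summand 1 keeps \<open>A\<close> positive, so that its roots tend to
    1.\<close>
  define A where "A = (1 + (\<Sum>a\<in>verts G. Green a [])) * green_energy * (green_energy * (1 + real degree_bound)) ^ Suc m"
  have SG: "0 \<le> (\<Sum>a\<in>verts G. Green a [])" by (intro sum_nonneg Green_nonneg)
  have A0: "0 < A" unfolding A_def using SG green_energy by (intro mult_pos_pos zero_less_power) auto
  \<comment> \<open>The exponent collects the square from \<open>CPm_sum_le\<close> and the cubes of
    the \<open>m + 1\<close> stages, after \<open>t + 1\<close> and \<open>t + 2\<close> have been
    replaced by \<open>3 * t\<close>.\<close>
  define e where "e = 2 + 3 * Suc m"
  have bound: "real (?N t) \<le> A * (3 * real t) ^ e * q ^ t" if t: "1 \<le> t" for t
  proof -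
    have "real (?N t) * z ^ t \<le> (\<Sum>a\<in>verts G. Green a []) * (real t + 1)\<^sup>2 * green_energy * count_bound m t"
      using CPm_sum_le(3)[OF m, of t] by simp
    also have "\<dots> \<le> (1 + (\<Sum>a\<in>verts G. Green a [])) * (3 * real t)\<^sup>2 * green_energy *
        (((3 * real t) ^ 3 * (green_energy * (1 + real degree_bound))) ^ Suc m * (2 * real m - 1) ^ t)"
      unfolding count_bound_def using SG green_energy t m
      by (intro mult_mono power_mono mult_nonneg_nonneg zero_le_power) auto
    also have "\<dots> = A * (3 * real t) ^ e * (2 * real m - 1) ^ t"
      unfolding A_def e_def power_add power_mult power_mult_distrib by (simp only: mult_ac)
    finally show ?thesis using z by (simp add: q_def power_divide pos_le_divide_eq)
  qed
  have eq: "eroot t (\<Sum>w\<in>CPm G m t. ecard (Crit FG (reduce w))) = ereal (root t (real (?N t)))" for t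
  proof -
    have "(\<Sum>w\<in>CPm G m t. ecard (Crit FG (reduce w))) = (\<Sum>w\<in>CPm G m t. enat (card (Crit FG (reduce w))))"
      using CPm_sum_le(1)[OF m] by (intro sum.cong refl) (simp add: ecard_def)
    also have "\<dots> = enat (?N t)"
    proof -
      have "(\<Sum>w\<in>S. enat (card (Crit FG (reduce w)))) = enat (\<Sum>w\<in>S. card (Crit FG (reduce w)))"
        if "finite S" for S
        using that by (induction S) (auto simp: zero_enat_def)
      then show ?thesis using CPm_sum_le(2)[OF m] by blast
    qed
    finally show ?thesis by (simp add: eroot_def)
  qed
  have "(\<lambda>t. root t A * (root t 3 * root t (real t)) ^ e * q) \<longlonglongrightarrow> 1 * (1 * 1) ^ e * q"
    using A0 by (intro tendsto_intros LIMSEQ_root LIMSEQ_root_const) auto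
  then have lim: "(\<lambda>t. ereal (root t A * (root t 3 * root t (real t)) ^ e * q)) \<longlonglongrightarrow> ereal q"
    by simp
  have "limsup (\<lambda>t. ereal (root t (real (?N t)))) \<le> limsup (\<lambda>t. ereal (root t A * (root t 3 * root t (real t)) ^ e * q))"
  proof (rule Limsup_mono, rule eventually_sequentiallyI[of 1])
    fix t :: nat assume t: "1 \<le> t"
    have "root t (real (?N t)) \<le> root t (A * (3 * real t) ^ e * q ^ t)"
      using bound[OF t] t by (intro real_root_le_mono) auto
    also have "\<dots> = root t A * (root t 3 * root t (real t)) ^ e * q"
    proof -
      have "root t (q ^ t) = q" using t q0 by (intro real_root_power_cancel) auto
      moreover have "root t ((3 * real t) ^ e) = (root t 3 * root t (real t)) ^ e"
        using t by (simp only: real_root_power real_root_mult)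
      ultimately show ?thesis by (simp only: real_root_mult)
    qed
    finally show "ereal (root t (real (?N t))) \<le> ereal (root t A * (root t 3 * root t (real t)) ^ e * q)" by simp
  qed
  also have "\<dots> = ereal q" using lim by (intro lim_imp_Limsup) auto
  finally show ?thesis unfolding eq q_def .
qed

end

theorem theorem24:
  fixes \<Omega> :: "('v, 'e) pre_digraph" and m :: nat
  assumes "fin_digraph \<Omega>"
    and "Digraph_Component.connected \<Omega>"
    and "1 \<le> m" and "int m \<le> graph_rank \<Omega>"
  shows "limsup (\<lambda>t. eroot t (\<Sum>w\<in>CPm \<Omega> m t. ecard (Crit (free_group (arcs \<Omega>)) (reduce w))))
           \<le> ereal ((2 * real m - 1) * rho_A \<Omega>)"
proof -
  interpret fin_digraph \<Omega> by fact
  have "verts \<Omega> \<noteq> {}" using assms(2) by (simp add: Digraph_Component.connected_def strongly_connected_def)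
  then have "card (verts \<Omega>) \<noteq> 0" by simp
  then have "card (arcs \<Omega>) \<noteq> 0" using assms(3,4) unfolding graph_rank_def by linarith
  then have ne: "arcs \<Omega> \<noteq> {}" by auto
  note rho = walks_le_rho[OF assms(2) ne]
  let ?\<rho> = "rho_A \<Omega>" and ?\<beta> = "2 * real m - 1"
  have \<beta>: "0 < ?\<beta>" using assms(3) by simp
  show ?thesis
  proof (rule ereal_le_epsilon2)
    fix \<epsilon> :: real assume \<epsilon>: "0 < \<epsilon>"
    \<comment> \<open>Chosen so that \<open>?\<beta> * y\<close> exceeds the target by exactly
      \<open>\<epsilon>\<close>. The Green function is taken at \<open>1 / y\<close>, strictly
      inside its radius of convergence, and the limit \<open>\<epsilon> \<rightarrow> 0\<close> is
      left to the end.\<close>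
    define y where "y = ?\<rho> + \<epsilon> / ?\<beta>"
    have y: "?\<rho> < y" "0 < y" using \<epsilon> \<beta> rho(1) by (auto simp: y_def intro: add_pos_pos)
    interpret green \<Omega> ?\<rho> "1 / y"
    proof
      show "0 < ?\<rho>" "0 < 1 / y" "1 / y * ?\<rho> < 1" using rho(1) y by auto
      show "real (card (walks a (2 * t) [])) \<le> ?\<rho> ^ (2 * t)" for a t by (rule rho(2))
    qed
    have "?\<beta> / (1 / y) = ?\<beta> * ?\<rho> + \<epsilon>" using \<beta> by (simp add: y_def field_simps)
    then show "limsup (\<lambda>t. eroot t (\<Sum>w\<in>CPm \<Omega> m t. ecard (Crit (free_group (arcs \<Omega>)) (reduce w))))
        \<le> ereal (?\<beta> * ?\<rho>) + ereal \<epsilon>"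
      using limsup_CPm_le[OF assms(3)] by simp
  qed
qed

end
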